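(* For each $n$ let $n_1=n_1(n)\ge n$ and $n_2=n_2(n)\ge n$ be integers, let $X_n\in\mathbb R^{n\times n_1}$ and $Y_n\in\mathbb R^{n\times n_2}$ be random matrices whose entries are independent standard normal random variables (all defined on a common probability space), let $F_n=(\frac1{n_1}X_nX_n^T)(\frac1{n_2}Y_nY_n^T)^{-1}$, and let $\lambda_1^F\le\dots\le\lambda_n^F$ be its eigenvalues. Suppose $$\lim_{n\to\infty}\frac n{n_1}=0,\qquad\lim_{n\to\infty}\frac n{n_2}=0,\qquad\lim_{n\to\infty}\frac{n_1}{n_2}=\infty,$$ and that for some $\nu\in(0,1)$ there exist constants $C_1,C_2>0$ and $\mu>\frac32\nu-\frac12$ such that $n_1\le C_1n^{1+\nu}$ and $n_2\ge C_2n^{1+\mu}$. Then the empirical distribution function of the scaled eigenvalues $$\mu_i=2\frac{n_1-n}{n_1+n_2}\cdot\frac{\frac{n_1}{n_2}\big(n_2-\sqrt{n(n_2-n)}\big)\lambda_i^F-\big(n_1+\sqrt{n(n_2-n)}\big)}{\sqrt{n(n_2-n)}\,\big(1+\frac{n_1}{n_2}\lambda_i^F\big)},\qquad i=1,\dots,n,$$ converges almost surely to the distribution function with density $f(x)=\frac1{8\pi}\sqrt{(6+x)(2-x)}\,I_{[-6,2]}(x)$.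
   Context: The empirical distribution function of real numbers $\mu_1,\dots,\mu_n$ is $\xi\mapsto\frac1n\sum_{i=1}^nI\{\mu_i\le\xi\}$. *)

theory Defs
  imports "HOL-Probability.Probability" "Jordan_Normal_Form.Char_Poly"
    "Jordan_Normal_Form.Gauss_Jordan_Elimination"
begin

definition emp_df :: "nat \<Rightarrow> (nat \<Rightarrow> real) \<Rightarrow> real \<Rightarrow> real" where
  "emp_df n mu xi = (1 / real n) * (\<Sum>i<n. if mu i \<le> xi then 1 else 0)"

definition sample_cov :: "nat \<Rightarrow> nat \<Rightarrow> (nat \<Rightarrow> nat \<Rightarrow> real) \<Rightarrow> real mat" where
  "sample_cov n m Z = (1 / real m) \<cdot>\<^sub>m
     (mat n m (\<lambda>(i,j). Z i j) * transpose_mat (mat n m (\<lambda>(i,j). Z i j)))"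

definition minv :: "real mat \<Rightarrow> real mat" where
  "minv A = (case mat_inverse A of Some B \<Rightarrow> B | None \<Rightarrow> 0\<^sub>m (dim_row A) (dim_col A))"

definition F_mat :: "nat \<Rightarrow> nat \<Rightarrow> nat \<Rightarrow> (nat \<Rightarrow> nat \<Rightarrow> real) \<Rightarrow> (nat \<Rightarrow> nat \<Rightarrow> real) \<Rightarrow> real mat" where
  "F_mat n m1 m2 X Y = sample_cov n m1 X * minv (sample_cov n m2 Y)"

text \<open>Real eigenvalues of a square matrix, with algebraic multiplicity, sorted increasingly
  (lambda_1 <= ... <= lambda_n is entry 0, ..., n-1).\<close>
definition sorted_eigenvalues :: "real mat \<Rightarrow> real list" where
  "sorted_eigenvalues A = sorted_list_of_multiset (proots (char_poly A))"

definition scale_eig :: "nat \<Rightarrow> nat \<Rightarrow> nat \<Rightarrow> real \<Rightarrow> real" where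
  "scale_eig n m1 m2 l =
    (let s = sqrt (real n * (real m2 - real n)); r = real m1 / real m2 in
     2 * (real m1 - real n) / (real m1 + real m2) *
     ((r * (real m2 - s) * l - (real m1 + s)) / (s * (1 + r * l))))"

definition lim_density :: "real \<Rightarrow> real" where
  "lim_density x = (if -6 \<le> x \<and> x \<le> 2 then sqrt ((6 + x) * (2 - x)) / (8 * pi) else 0)"

end

theory Submission
  imports Defs
begin

text \<open>
  With \<open>A = X X\<^sup>T\<close>, \<open>G = Y Y\<^sup>T\<close> and \<open>t\<close> an eigenvalue of \<open>A G\<^sup>-\<^sup>1\<close>, the
  scaled eigenvalue is at most \<open>\<xi>\<close> iff \<open>(1 - x) - x t \<ge> 0\<close> for an explicit
  threshold \<open>x\<close>, so the empirical distribution function counts the nonnegative directions of the pencil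
  \<open>(1 - x) G - x A\<close>, which is a positive multiple of \<open>W\<^sub>Y + z I - \<epsilon> W\<^sub>X\<close>. Here
  \<open>W\<^sub>Y = (Y Y\<^sup>T - n\<^sub>2 I) / sqrt (n n\<^sub>2)\<close>, similarly \<open>W\<^sub>X\<close>, and
  \<open>z \<longrightarrow> 1 + \<xi> / 2\<close>, \<open>\<epsilon> \<longrightarrow> 0\<close>. Hence the count
  is that of the eigenvalues of \<open>W\<^sub>Y\<close> above \<open>- z\<close> up to a vanishing fraction of \<open>n\<close>.
  The spectrum of \<open>W\<^sub>Y\<close> converges almost surely to the semicircle law by the method of moments: Gaussian
  integration by parts yields loop equations for the normalised traces \<open>T k\<close> of \<open>W\<^sub>Y\<^sup>k\<close>, from
  which expectations of products of traces factorise up to \<open>O(1/n\<^sup>2)\<close>, and this is summable.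
\<close>

subsection \<open>Real symmetric matrices\<close>

text \<open>Counting, rather than matching eigenvalues one by one, makes the perturbation by
  \<open>W\<^sub>X\<close> harmless. Only the fraction of its eigenvalues with
  \<open>\<bar>\<epsilon> f i\<bar> > \<delta>\<close> matters, and Chebyshev bounds it by
  \<open>(\<epsilon> / \<delta>)\<^sup>2\<close> times the normalised trace of
  \<open>W\<^sub>X\<^sup>2\<close>, which tends to \<open>cat 2 = 1\<close>; the operator norm never
  enters. The loop equations carry the parameter \<open>eta = sqrt (n / m)\<close>. Letting it tend
  to 0 leaves the Catalan recursion, hence the semicircle law as limit. The support
  \<open>[-6, 2]\<close> comes from the sign in \<open>- z\<close>: the eigenvalues of F are small
  where those of \<open>W\<^sub>Y\<close> are large, and solving
  \<open>u = - (1 + \<xi> / 2)\<close> for \<xi> gives \<open>\<xi> = - 2 - 2 u\<close>, which maps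
  \<open>[-2, 2]\<close> onto \<open>[-6, 2]\<close>. Matrices of different sizes may depend on each
  other arbitrarily, so almost sure convergence has to come from summable variances. This is why
  factorisation is needed with an error \<open>O(1/n\<^sup>2)\<close> and not merely
  \<open>o(1)\<close>. The error is uniform because it is derived from the equations alone, for
  every solution at once.\<close>

definition ip :: "nat \<Rightarrow> (nat \<Rightarrow> real) \<Rightarrow> (nat \<Rightarrow> real) \<Rightarrow> real" where
  "ip n v w = (\<Sum>i<n. v i * w i)"

definition mv :: "nat \<Rightarrow> (nat \<Rightarrow> nat \<Rightarrow> real) \<Rightarrow> (nat \<Rightarrow> real) \<Rightarrow> nat \<Rightarrow> real" where
  "mv n A v = (\<lambda>i. \<Sum>j<n. A i j * v j)"

definition symm :: "nat \<Rightarrow> (nat \<Rightarrow> nat \<Rightarrow> real) \<Rightarrow> bool" where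
  "symm n A \<longleftrightarrow> (\<forall>i<n. \<forall>j<n. A i j = A j i)"

lemma ip_commute: "ip n v w = ip n w v"
  by (simp add: ip_def mult.commute)

lemma ip_add_right: "ip n v (\<lambda>i. w i + u i) = ip n v w + ip n v u"
  by (simp add: ip_def algebra_simps sum.distrib)

lemma ip_diff_right: "ip n v (\<lambda>i. w i - u i) = ip n v w - ip n v u"
  by (simp add: ip_def algebra_simps sum_subtractf)

lemma ip_scale_right: "ip n v (\<lambda>i. c * w i) = c * ip n v w"
  by (simp add: ip_def sum_distrib_left algebra_simps)

lemma ip_sum_right: "ip n v (\<lambda>i. \<Sum>k\<in>K. f k i) = (\<Sum>k\<in>K. ip n v (f k))"
  unfolding ip_def by (subst sum.swap) (simp add: sum_distrib_left)

lemma ip_self_nonneg: "0 \<le> ip n v v"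
  by (simp add: ip_def sum_nonneg)

lemma ip_self_eq_0_iff: "ip n v v = 0 \<longleftrightarrow> (\<forall>i<n. v i = 0)"
  unfolding ip_def by (subst sum_nonneg_eq_0_iff) auto

lemma ip_cong: "(\<And>i. i < n \<Longrightarrow> v i = v' i) \<Longrightarrow> (\<And>i. i < n \<Longrightarrow> w i = w' i) \<Longrightarrow> ip n v w = ip n v' w'"
  by (simp add: ip_def)

lemma mv_cong: "(\<And>i. i < n \<Longrightarrow> v i = v' i) \<Longrightarrow> mv n A v = mv n A v'"
  by (simp add: mv_def)

lemma mv_add: "mv n A (\<lambda>i. v i + c * w i) = (\<lambda>i. mv n A v i + c * mv n A w i)"
  by (simp add: mv_def fun_eq_iff algebra_simps sum.distrib sum_distrib_left)

lemma mv_scale: "mv n A (\<lambda>i. c * w i) = (\<lambda>i. c * mv n A w i)"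
  by (simp add: mv_def fun_eq_iff algebra_simps sum_distrib_left)

lemma ip_mv_sym:
  assumes "symm n A"
  shows "ip n v (mv n A w) = ip n (mv n A v) w"
proof -
  have "ip n v (mv n A w) = (\<Sum>i<n. \<Sum>j<n. v i * (A i j * w j))"
    by (simp add: ip_def mv_def sum_distrib_left)
  also have "\<dots> = (\<Sum>j<n. \<Sum>i<n. v i * (A i j * w j))" by (rule sum.swap)
  also have "\<dots> = (\<Sum>j<n. \<Sum>i<n. A j i * v i * w j)"
    by (intro sum.cong refl) (use assms in \<open>simp add: symm_def\<close>)
  finally show ?thesis by (simp add: ip_def mv_def sum_distrib_right)
qed

text \<open>Gaussian elimination: a pivot variable is eliminated from the other equations and
  recovered at the end from the last one. This is the dimension argument behind both the existence
  of eigenvectors and the eigenvalue counts.\<close>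

lemma underdetermined_system:
  fixes B :: "nat \<Rightarrow> 'b \<Rightarrow> real"
  assumes "finite J" "k < card J"
  shows "\<exists>c. (\<exists>j\<in>J. c j \<noteq> 0) \<and> (\<forall>i<k. (\<Sum>j\<in>J. B i j * c j) = 0)"
  using assms
proof (induction k arbitrary: J B)
  case 0
  then obtain j where "j \<in> J" by fastforce
  then show ?case by (intro exI[of _ "\<lambda>_. 1"]) auto
next
  case (Suc k)
  show ?case
  proof (cases "\<forall>j\<in>J. B k j = 0")
    case True
    obtain c where c: "\<exists>j\<in>J. c j \<noteq> 0" "\<forall>i<k. (\<Sum>j\<in>J. B i j * c j) = 0"
      using Suc.IH[of J B] Suc.prems by auto
    have "\<forall>i<Suc k. (\<Sum>j\<in>J. B i j * c j) = 0"
      using c(2) True by (auto simp: less_Suc_eq)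
    then show ?thesis using c(1) by blast
  next
    case False
    then obtain p where p: "p \<in> J" "B k p \<noteq> 0" by auto
    define J' where "J' = J - {p}"
    have fJ': "finite J'" "k < card J'" using Suc.prems p by (auto simp: J'_def)
    obtain c where c: "\<exists>j\<in>J'. c j \<noteq> 0"
        "\<forall>i<k. (\<Sum>j\<in>J'. (B i j - B i p * B k j / B k p) * c j) = 0"
      using Suc.IH[OF fJ', of "\<lambda>i j. B i j - B i p * B k j / B k p"] by auto
    define d where "d = c(p := - (\<Sum>j\<in>J'. B k j * c j) / B k p)"
    have sm: "(\<Sum>j\<in>J. B i j * d j) = B i p * d p + (\<Sum>j\<in>J'. B i j * c j)" for i
    proof -
      have "(\<Sum>j\<in>J. B i j * d j) = B i p * d p + (\<Sum>j\<in>J'. B i j * d j)"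
        using p Suc.prems unfolding J'_def by (subst sum.remove[of J p]) auto
      moreover have "(\<Sum>j\<in>J'. B i j * d j) = (\<Sum>j\<in>J'. B i j * c j)"
        by (rule sum.cong) (auto simp: d_def J'_def)
      ultimately show ?thesis by simp
    qed
    have "(\<Sum>j\<in>J. B i j * d j) = 0" if "i < Suc k" for i
    proof (cases "i = k")
      case True
      then show ?thesis using p by (simp add: sm) (simp add: d_def)
    next
      case False
      then have "i < k" using that by simp
      then have "0 = (\<Sum>j\<in>J'. B i j * c j) - (\<Sum>j\<in>J'. B i p * B k j / B k p * c j)"
        using c(2) by (simp add: algebra_simps sum_subtractf)
      also have "(\<Sum>j\<in>J'. B i p * B k j / B k p * c j) = B i p * (\<Sum>j\<in>J'. B k j * c j) / B k p"
        by (simp add: sum_distrib_left sum_divide_distrib algebra_simps)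
      finally show ?thesis by (simp add: sm) (simp add: d_def)
    qed
    moreover have "\<exists>j\<in>J. d j \<noteq> 0" using c(1) by (auto simp: d_def J'_def)
    ultimately show ?thesis by blast
  qed
qed

text \<open>Vectors are functions on all of \<open>nat\<close>, so the coordinates from
  \<open>n\<close> on are pinned to 0. The set is then closed inside a product of compact intervals,
  and Tychonoff applies.\<close>

lemma compact_unit_sphere_orthogonal:
  "compact {w::nat \<Rightarrow> real. (\<forall>j\<ge>n. w j = 0) \<and> ip n w w = 1 \<and> (\<forall>i<k. ip n (v i) w = 0)}" (is "compact ?K")
proof -
  let ?B = "PiE UNIV (\<lambda>j. if j < n then {-1..1::real} else {0})"
  have "compactin (product_topology (\<lambda>_::nat. euclidean::real topology) UNIV) ?B"
    by (subst compactin_PiE) auto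
  then have cB: "compact ?B" by (simp add: euclidean_product_topology)
  have eq: "?K = ?B \<inter> ({w. ip n w w = 1} \<inter> (\<Inter>i\<in>{..<k}. {w. ip n (v i) w = 0}))"
  proof (intro equalityI subsetI)
    fix w assume w: "w \<in> ?K"
    have "\<bar>w j\<bar> \<le> 1" if "j < n" for j
    proof -
      have "w j * w j \<le> ip n w w" unfolding ip_def
        by (rule member_le_sum) (use that in auto)
      then have "\<bar>w j\<bar>\<^sup>2 \<le> 1" using w by (simp add: power2_eq_square)
      then show ?thesis by (simp add: abs_square_le_1)
    qed
    then show "w \<in> ?B \<inter> ({w. ip n w w = 1} \<inter> (\<Inter>i\<in>{..<k}. {w. ip n (v i) w = 0}))"
      using w by (auto simp: abs_le_iff)
  qed (auto simp: PiE_iff split: if_splits, metis not_less)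
  have "closed {w::nat\<Rightarrow>real. ip n w w = 1}" unfolding ip_def
    by (intro closed_Collect_eq continuous_intros continuous_on_product_coordinates)
  moreover have "closed (\<Inter>i\<in>{..<k}. {w::nat\<Rightarrow>real. ip n (v i) w = 0})" unfolding ip_def
    by (intro closed_INT ballI closed_Collect_eq continuous_intros continuous_on_product_coordinates)
  ultimately show ?thesis unfolding eq
    by (intro compact_Int_closed[OF cB] closed_Int)
qed

text \<open>The first-order condition at a maximum, without derivatives: for small \<open>t\<close>
  a quadratic term cannot dominate a nonzero linear one. The test point is \<open>t = a / B\<close>
  with a positive \<open>B > b\<close>.\<close>

lemma linear_le_quadratic_imp_0:
  fixes a b :: real
  assumes "\<And>t. 2 * t * a \<le> t\<^sup>2 * b"
  shows "a = 0"
proof (rule ccontr)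
  assume "a \<noteq> 0"
  define B where "B = \<bar>b\<bar> + 1"
  have B: "B > 0" "b < B" by (auto simp: B_def)
  have "2 * (a / B) * a \<le> (a / B)\<^sup>2 * b" by (rule assms)
  also have "\<dots> \<le> (a / B)\<^sup>2 * B" using B by (intro mult_left_mono) auto
  also have "\<dots> = a\<^sup>2 / B" using B by (simp add: power2_eq_square)
  finally have "2 * a\<^sup>2 / B \<le> a\<^sup>2 / B" by (simp add: power2_eq_square)
  then have "a\<^sup>2 \<le> 0" using B by (simp add: divide_le_cancel)
  then show False using \<open>a \<noteq> 0\<close> by simp
qed

text \<open>Each new eigenvector maximises the Rayleigh quotient over the orthogonal complement of
  the previous ones.\<close>

lemma next_eigenvector:
  fixes A :: "nat \<Rightarrow> nat \<Rightarrow> real"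
  assumes sym: "symm n A"
    and k: "k < n"
    and ev: "\<forall>i<k. \<forall>j<n. mv n A (v i) j = e i * v i j"
  shows "\<exists>w l. ip n w w = 1 \<and> (\<forall>i<k. ip n (v i) w = 0) \<and> (\<forall>j<n. mv n A w j = l * w j)"
proof -
  let ?K = "{w::nat \<Rightarrow> real. (\<forall>j\<ge>n. w j = 0) \<and> ip n w w = 1 \<and> (\<forall>i<k. ip n (v i) w = 0)}"
  let ?q = "\<lambda>u. ip n u (mv n A u)"
  have normalize: "(\<lambda>j. if j < n then u j / sqrt (ip n u u) else 0) \<in> ?K"
    if "ip n u u \<noteq> 0" "\<forall>i<k. ip n (v i) u = 0" for u
  proof -
    have pos: "ip n u u > 0" using that ip_self_nonneg[of n u] by simp
    let ?w = "(\<lambda>j. if j < n then u j / sqrt (ip n u u) else 0)"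
    have *: "ip n x ?w = ip n x u / sqrt (ip n u u)" for x
      by (simp add: ip_def sum_divide_distrib)
    have "ip n ?w ?w = ip n u u / sqrt (ip n u u) / sqrt (ip n u u)"
      by (subst *, subst ip_commute, subst *, simp)
    then have "ip n ?w ?w = 1" using pos by simp
    then show ?thesis using that by (simp add: *)
  qed
  \<comment> \<open>The constraint set is nonempty: fewer than \<open>n\<close> orthogonality
    conditions on \<open>n\<close> unknowns have a nonzero solution.\<close>
  obtain c where c: "\<exists>j\<in>{..<n}. c j \<noteq> 0" "\<forall>i<k. (\<Sum>j<n. v i j * c j) = 0"
    using underdetermined_system[of "{..<n}" k v] k by auto
  have "?K \<noteq> {}" using normalize[of c] c by (force simp: ip_self_eq_0_iff ip_def[of n "v _"])
  moreover have "continuous_on ?K ?q" unfolding ip_def mv_def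
    by (intro continuous_intros continuous_on_subset[OF continuous_on_product_coordinates]) auto
  ultimately obtain w where w: "w \<in> ?K" and wmax: "\<And>u. u \<in> ?K \<Longrightarrow> ?q u \<le> ?q w"
    using continuous_attains_sup[OF compact_unit_sphere_orthogonal, of n k v ?q] by blast
  define l where "l = ?q w"
  have le: "?q u \<le> l * ip n u u" if u: "\<forall>i<k. ip n (v i) u = 0" for u
  proof (cases "ip n u u = 0")
    case True
    then have "?q u = ip n (\<lambda>_. 0) (mv n A u)" by (intro ip_cong) (auto simp: ip_self_eq_0_iff)
    then show ?thesis using True by (simp add: ip_def)
  next
    case False
    then have pos: "ip n u u > 0" using ip_self_nonneg[of n u] by simp
    let ?w = "(\<lambda>j. if j < n then u j / sqrt (ip n u u) else 0)"
    let ?r = "1 / sqrt (ip n u u)"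
    have a: "mv n A ?w = (\<lambda>i. ?r * mv n A u i)"
      by (subst mv_scale[symmetric], rule mv_cong) simp
    have "?q ?w = ?r * (?r * ?q u)" unfolding a
      by (subst ip_scale_right, subst ip_commute, subst ip_scale_right[symmetric],
          subst ip_commute[of n "mv n A u"], intro arg_cong[of _ _ "\<lambda>x. ?r * x"] ip_cong) auto
    also have "\<dots> = ?q u / ip n u u" using pos by (simp add: field_simps)
    finally have "?q u / ip n u u \<le> l" using wmax[OF normalize[OF False u]] by (simp add: l_def)
    then show ?thesis using pos by (simp add: divide_le_eq)
  qed
  \<comment> \<open>First variation of the Rayleigh quotient at \<open>w\<close>: the residual is
    orthogonal to every admissible direction \<open>h\<close>. By symmetry of \<open>A\<close> the
    residual is itself admissible, hence zero.\<close>
  have orth: "ip n h (\<lambda>j. mv n A w j - l * w j) = 0" if h: "\<forall>i<k. ip n (v i) h = 0" for h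
  proof (rule linear_le_quadratic_imp_0[where b = "l * ip n h h - ?q h"])
    fix t :: real
    let ?u = "\<lambda>i. w i + t * h i"
    have "\<forall>i<k. ip n (v i) ?u = 0" using h w by (simp add: ip_add_right ip_scale_right)
    from le[OF this] have "?q ?u \<le> l * ip n ?u ?u" .
    moreover have "ip n ?u ?u = 1 + 2 * t * ip n h w + t\<^sup>2 * ip n h h"
      using w by (simp add: ip_add_right ip_scale_right ip_commute[of n ?u] ip_commute[of n w h]
          power2_eq_square algebra_simps)
    moreover have "?q ?u = l + 2 * t * ip n h (mv n A w) + t\<^sup>2 * ?q h"
      using ip_mv_sym[OF sym, of h w] ip_commute[of n "mv n A h" w]
      by (simp add: mv_add ip_add_right ip_scale_right ip_commute[of n ?u] 
          ip_commute[of n "mv n A w" w] ip_commute[of n "mv n A w" h] 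
          ip_commute[of n "mv n A h" w] ip_commute[of n "mv n A h" h] l_def power2_eq_square algebra_simps)
    ultimately show "2 * t * ip n h (\<lambda>j. mv n A w j - l * w j) \<le> t\<^sup>2 * (l * ip n h h - ?q h)"
      by (simp add: ip_diff_right ip_scale_right algebra_simps)
  qed
  have "ip n (v i) (\<lambda>j. mv n A w j - l * w j) = 0" if "i < k" for i
  proof -
    have "ip n (v i) (mv n A w) = ip n (\<lambda>j. e i * v i j) w"
      unfolding ip_mv_sym[OF sym] by (intro ip_cong) (use ev that in auto)
    also have "\<dots> = 0" using w that
      by (subst ip_commute, subst ip_scale_right, subst ip_commute) simp
    finally show ?thesis using w that by (simp add: ip_diff_right ip_scale_right)
  qed
  then have "ip n (\<lambda>j. mv n A w j - l * w j) (\<lambda>j. mv n A w j - l * w j) = 0"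
    by (intro orth) simp
  then have "\<forall>j<n. mv n A w j = l * w j" by (simp add: ip_self_eq_0_iff)
  then show ?thesis using w by blast
qed

definition spectral_decomp ::
  "nat \<Rightarrow> (nat \<Rightarrow> nat \<Rightarrow> real) \<Rightarrow> (nat \<Rightarrow> nat \<Rightarrow> real) \<Rightarrow> (nat \<Rightarrow> real) \<Rightarrow> bool" where
  "spectral_decomp n A v e \<longleftrightarrow>
     (\<forall>i<n. \<forall>j<n. ip n (v i) (v j) = (if i = j then 1 else 0)) \<and>
     (\<forall>a<n. \<forall>b<n. (\<Sum>i<n. v i a * v i b) = (if a = b then 1 else 0)) \<and>
     (\<forall>a<n. \<forall>b<n. A a b = (\<Sum>i<n. e i * v i a * v i b))"

text \<open>A right inverse of a square matrix is also a left inverse, applied to the matrix with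
  rows \<open>v i\<close> and its transpose.\<close>

lemma orthonormal_rows_imp_columns:
  assumes "\<And>i j. i < n \<Longrightarrow> j < n \<Longrightarrow> ip n (v i) (v j) = (if i = j then 1 else 0)" "a < n" "b < n"
  shows "(\<Sum>i<n. v i a * v i b) = (if a = b then 1 else 0)"
proof -
  let ?Q = "mat n n (\<lambda>(i, j). v i j)"
  have "?Q * transpose_mat ?Q = 1\<^sub>m n"
    by (rule eq_matI) (auto simp: scalar_prod_def assms(1)[unfolded ip_def] atLeast0LessThan)
  then have "transpose_mat ?Q * ?Q = 1\<^sub>m n"
    by (intro mat_mult_left_right_inverse[of ?Q]) auto
  then have "(transpose_mat ?Q * ?Q) $$ (a, b) = 1\<^sub>m n $$ (a, b)" by simp
  then show ?thesis using assms(2,3) by (simp add: scalar_prod_def atLeast0LessThan)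
qed

text \<open>Orthonormal eigenvectors are added one at a time until there are \<open>n\<close> of
  them. Completeness, in the form of orthonormal columns, then recovers the entries of
  \<open>A\<close> from the eigenvalue equations.\<close>

theorem spectral_theorem:
  fixes A :: "nat \<Rightarrow> nat \<Rightarrow> real"
  assumes sym: "symm n A"
  obtains v e where "spectral_decomp n A v e"
proof -
  have "\<exists>v e. (\<forall>i<k. \<forall>j<k. ip n (v i) (v j) = (if i = j then 1 else 0)) \<and>
      (\<forall>i<k. \<forall>j<n. mv n A (v i) j = e i * v i j)" if "k \<le> n" for k
    using that
  proof (induction k)
    case (Suc k)
    then obtain v e where ve: "\<forall>i<k. \<forall>j<k. ip n (v i) (v j) = (if i = j then 1 else 0)"
      "\<forall>i<k. \<forall>j<n. mv n A (v i) j = e i * v i j" by auto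
    have "k < n" using Suc.prems by simp
    have "\<exists>w l. ip n w w = 1 \<and> (\<forall>i<k. ip n (v i) w = 0) \<and> (\<forall>j<n. mv n A w j = l * w j)"
      by (rule next_eigenvector[of n A k v e]) (fact sym, fact, fact ve(2))
    then obtain w l where wl: "ip n w w = 1" "\<forall>i<k. ip n (v i) w = 0" "\<forall>j<n. mv n A w j = l * w j"
      by (elim exE conjE) (rule that)
    have "\<forall>i<k. ip n w (v i) = 0" using wl(2) by (simp add: ip_commute)
    then have "ip n ((v(k := w)) i) ((v(k := w)) j) = (if i = j then 1 else 0)" if "i < Suc k" "j < Suc k" for i j
      using that wl(1,2) ve(1) by (cases "i = k"; cases "j = k") simp_all
    moreover have "mv n A ((v(k := w)) i) j = (e(k := l)) i * (v(k := w)) i j" if "i < Suc k" "j < n" for i j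
      using that wl(3) ve(2) by (cases "i = k") simp_all
    ultimately show ?case
      by (intro exI[of _ "v(k := w)"] exI[of _ "e(k := l)"]) blast
  qed auto
  from this[OF order_refl] obtain v e
    where on': "\<forall>i<n. \<forall>j<n. ip n (v i) (v j) = (if i = j then 1 else 0)"
      and ev': "\<forall>i<n. \<forall>j<n. mv n A (v i) j = e i * v i j" by (elim exE conjE)
  have on: "\<And>i j. i < n \<Longrightarrow> j < n \<Longrightarrow> ip n (v i) (v j) = (if i = j then 1 else 0)"
    and ev: "\<And>i j. i < n \<Longrightarrow> j < n \<Longrightarrow> mv n A (v i) j = e i * v i j" using on' ev' by blast+
  note cols = orthonormal_rows_imp_columns[of n v, OF on]
  have "A a b = (\<Sum>i<n. e i * v i a * v i b)" if ab: "a < n" "b < n" for a b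
  proof -
    have "(\<Sum>i<n. e i * v i a * v i b) = (\<Sum>i<n. mv n A (v i) a * v i b)"
      using ev ab by simp
    also have "\<dots> = (\<Sum>i<n. \<Sum>j<n. A a j * (v i j * v i b))"
      by (simp add: mv_def sum_distrib_right mult.assoc)
    also have "\<dots> = (\<Sum>j<n. A a j * (\<Sum>i<n. v i j * v i b))"
      by (subst sum.swap) (simp add: sum_distrib_left)
    also have "\<dots> = (\<Sum>j<n. if j = b then A a j else 0)"
      by (intro sum.cong refl) (use cols ab in auto)
    also have "\<dots> = A a b" using ab by (simp)
    finally show ?thesis by simp
  qed
  then show ?thesis using that[of v e] on cols by (auto simp: spectral_decomp_def)
qed

lemma spectral_eigen:
  assumes "spectral_decomp n A v e" "i < n" "a < n"
  shows "mv n A (v i) a = e i * v i a"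
proof -
  have "mv n A (v i) a = (\<Sum>j<n. (\<Sum>l<n. e l * v l a * v l j) * v i j)"
    using assms by (simp add: mv_def spectral_decomp_def)
  also have "\<dots> = (\<Sum>l<n. e l * v l a * ip n (v l) (v i))"
    unfolding ip_def by (simp add: sum_distrib_right sum_distrib_left mult.assoc) (rule sum.swap)
  also have "\<dots> = (\<Sum>l<n. if l = i then e l * v l a else 0)"
    using assms by (intro sum.cong refl) (auto simp: spectral_decomp_def)
  also have "\<dots> = e i * v i a" using assms by simp
  finally show ?thesis .
qed

section \<open>Powers, traces and quadratic forms in an eigenbasis\<close>

primrec mpow :: "nat \<Rightarrow> (nat \<Rightarrow> nat \<Rightarrow> real) \<Rightarrow> nat \<Rightarrow> nat \<Rightarrow> nat \<Rightarrow> real" where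
  "mpow n A 0 = (\<lambda>a b. if a = b then 1 else 0)"
| "mpow n A (Suc k) = (\<lambda>a b. \<Sum>r<n. mpow n A k a r * A r b)"

lemma mpow_spectral:
  assumes "spectral_decomp n A v e" "a < n" "b < n"
  shows "mpow n A k a b = (\<Sum>i<n. e i ^ k * v i a * v i b)"
  using assms(3)
proof (induction k arbitrary: b)
  case 0
  then show ?case using assms by (simp add: spectral_decomp_def)
next
  case (Suc k)
  have sym: "A r b = A b r" if "r < n" for r
    using that assms Suc.prems by (simp add: spectral_decomp_def mult_ac)
  have "mpow n A (Suc k) a b = (\<Sum>r<n. (\<Sum>i<n. e i ^ k * v i a * v i r) * A r b)"
    using Suc.IH by simp
  also have "\<dots> = (\<Sum>i<n. e i ^ k * v i a * mv n A (v i) b)"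
    unfolding mv_def by (simp add: sum_distrib_right sum_distrib_left mult.assoc)
      (subst sum.swap, intro sum.cong refl, simp add: sym)
  also have "\<dots> = (\<Sum>i<n. e i ^ Suc k * v i a * v i b)"
    using spectral_eigen[OF assms(1) _ Suc.prems] by (intro sum.cong refl) simp
  finally show ?case .
qed

lemma trace_mpow_spectral:
  assumes "spectral_decomp n A v e"
  shows "(\<Sum>a<n. mpow n A k a a) = (\<Sum>i<n. e i ^ k)"
proof -
  have "(\<Sum>a<n. mpow n A k a a) = (\<Sum>a<n. \<Sum>i<n. e i ^ k * (v i a * v i a))"
    by (intro sum.cong refl) (simp add: mpow_spectral[OF assms] mult.assoc)
  also have "\<dots> = (\<Sum>i<n. e i ^ k * ip n (v i) (v i))"
    by (subst sum.swap) (simp add: ip_def sum_distrib_left)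
  also have "\<dots> = (\<Sum>i<n. e i ^ k)"
    using assms by (intro sum.cong refl) (simp add: spectral_decomp_def)
  finally show ?thesis .
qed

lemma spectral_quadratic_form:
  assumes "spectral_decomp n A v e"
  shows "ip n x (mv n A x) = (\<Sum>i<n. e i * (ip n (v i) x)\<^sup>2)"
proof -
  have "ip n x (mv n A x) = (\<Sum>a<n. \<Sum>b<n. \<Sum>i<n. e i * (v i a * x a) * (v i b * x b))"
    unfolding ip_def mv_def sum_distrib_left
    by (intro sum.cong refl)
      (use assms in \<open>simp add: spectral_decomp_def sum_distrib_right sum_distrib_left mult_ac\<close>)
  also have "\<dots> = (\<Sum>a<n. \<Sum>i<n. \<Sum>b<n. e i * (v i a * x a) * (v i b * x b))"
    by (intro sum.cong refl sum.swap)
  also have "\<dots> = (\<Sum>i<n. \<Sum>a<n. \<Sum>b<n. e i * (v i a * x a) * (v i b * x b))"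
    by (rule sum.swap)
  also have "\<dots> = (\<Sum>i<n. e i * (ip n (v i) x)\<^sup>2)"
    unfolding ip_def power2_eq_square
    by (intro sum.cong refl, subst sum_product) (simp add: sum_distrib_left mult.assoc)
  finally show ?thesis .
qed

text \<open>Parseval's identity, obtained by viewing the identity matrix as diagonalised by the same
  basis with all eigenvalues 1.\<close>

lemma spectral_norm_sq:
  assumes "spectral_decomp n A v e"
  shows "ip n x x = (\<Sum>i<n. (ip n (v i) x)\<^sup>2)"
proof -
  have "spectral_decomp n (\<lambda>a b. if a = b then 1 else 0) v (\<lambda>_. 1)"
    using assms by (simp add: spectral_decomp_def)
  from spectral_quadratic_form[OF this, of x]
  have "ip n x (mv n (\<lambda>a b. if a = b then 1 else 0) x) = (\<Sum>i<n. (ip n (v i) x)\<^sup>2)" by simp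
  moreover have "ip n x (mv n (\<lambda>a b. if a = b then 1 else 0) x) = ip n x x"
    by (rule ip_cong) (simp_all add: mv_def if_distrib[of "\<lambda>z. z * _"] cong: if_cong)
  ultimately show ?thesis by simp
qed

subsection \<open>Counting eigenvalues of perturbed forms and pencils\<close>

lemma underdetermined_system_set:
  fixes B :: "'i \<Rightarrow> 'b \<Rightarrow> real"
  assumes "finite I" "finite J" "card I < card J"
  shows "\<exists>c. (\<exists>j\<in>J. c j \<noteq> 0) \<and> (\<forall>i\<in>I. (\<Sum>j\<in>J. B i j * c j) = 0)"
proof -
  obtain h where h: "bij_betw h {0..<card I} I" using ex_bij_betw_nat_finite[OF assms(1)] by auto
  obtain c where c: "\<exists>j\<in>J. c j \<noteq> 0" "\<forall>i<card I. (\<Sum>j\<in>J. B (h i) j * c j) = 0"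
    using underdetermined_system[OF assms(2,3), of "\<lambda>i. B (h i)"] by blast
  have "(\<Sum>j\<in>J. B i j * c j) = 0" if "i \<in> I" for i
  proof -
    have "i \<in> h ` {0..<card I}" using h that by (simp add: bij_betw_imp_surj_on)
    then obtain k where "k < card I" "i = h k" by auto
    then show ?thesis using c(2) by simp
  qed
  then show ?thesis using c(1) by blast
qed

text \<open>If the dimension of the span of the vectors \<open>p j\<close> with \<open>d j \<ge> 0\<close> exceeded the right-hand
  side, that span would contain a nonzero vector orthogonal to the listed eigenvectors, on which the
  quadratic form is negative.\<close>

lemma card_nonneg_le_perturbed:
  assumes W: "spectral_decomp n W v e" and V: "spectral_decomp n V w f"
    and form: "\<And>c. let x = (\<lambda>a. \<Sum>j<n. c j * p j a) in
        ip n x (mv n W x) + z * ip n x x - eps * ip n x (mv n V x) = (\<Sum>j<n. d j * (c j)\<^sup>2)"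
    and indep: "\<And>c. (\<forall>a<n. (\<Sum>j<n. c j * p j a) = 0) \<Longrightarrow> \<forall>j<n. c j = (0::real)"
  shows "card {j. j < n \<and> 0 \<le> d j}
    \<le> card {i. i < n \<and> - z - \<delta> \<le> e i} + card {i. i < n \<and> \<delta> < \<bar>eps * f i\<bar>}"
proof (rule ccontr)
  let ?J = "{j. j < n \<and> 0 \<le> d j}"
  \<comment> \<open>A disjoint sum, so that its cardinality is exactly the right-hand side of the
    claim: one equation per eigenvector from either family.\<close>
  let ?I = "{i. i < n \<and> - z - \<delta> \<le> e i} <+> {i. i < n \<and> \<delta> < \<bar>eps * f i\<bar>}"
  let ?B = "\<lambda>i j. case i of Inl i \<Rightarrow> ip n (v i) (p j) | Inr i \<Rightarrow> ip n (w i) (p j)"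
  assume "\<not> ?thesis"
  then have lt: "card ?I < card ?J" by (simp add: card_Plus)
  then obtain c where c: "\<exists>j\<in>?J. c j \<noteq> 0" "\<forall>i\<in>?I. (\<Sum>j\<in>?J. ?B i j * c j) = 0"
    using underdetermined_system_set[of ?I ?J ?B] by auto
  define c' where "c' = (\<lambda>j. if j \<in> ?J then c j else 0)"
  define x where "x = (\<lambda>a. \<Sum>j<n. c' j * p j a)"
  have ip_x: "ip n u x = (\<Sum>j\<in>?J. ip n u (p j) * c j)" for u
  proof -
    have "ip n u x = (\<Sum>j<n. c' j * ip n u (p j))"
      unfolding x_def by (subst ip_sum_right) (simp add: ip_scale_right)
    also have "\<dots> = (\<Sum>j\<in>?J. c' j * ip n u (p j))"
      by (rule sum.mono_neutral_right) (auto simp: c'_def)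
    finally show ?thesis by (simp add: c'_def mult.commute)
  qed
  have v0: "ip n (v i) x = 0" if "i < n" "- z - \<delta> \<le> e i" for i
  proof -
    have "Inl i \<in> ?I" using that by auto
    from c(2)[rule_format, OF this] show ?thesis by (simp add: ip_x)
  qed
  have w0: "ip n (w i) x = 0" if "i < n" "\<delta> < \<bar>eps * f i\<bar>" for i
  proof -
    have "Inr i \<in> ?I" using that by auto
    from c(2)[rule_format, OF this] show ?thesis by (simp add: ip_x)
  qed
  have "\<not> (\<forall>a<n. x a = 0)"
  proof
    assume "\<forall>a<n. x a = 0"
    then have "\<forall>j<n. c' j = 0" using indep[of c'] by (simp add: x_def)
    then show False using c(1) by (auto simp: c'_def)
  qed
  then have pos: "ip n x x > 0" using ip_self_nonneg[of n x] ip_self_eq_0_iff[of n x] by (metis less_eq_real_def)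
  have nonneg: "0 \<le> ip n x (mv n W x) + z * ip n x x - eps * ip n x (mv n V x)"
  proof -
    have "ip n x (mv n W x) + z * ip n x x - eps * ip n x (mv n V x) = (\<Sum>j<n. d j * (c' j)\<^sup>2)"
      using form[of c'] by (simp only: x_def Let_def)
    also have "\<dots> \<ge> 0" by (intro sum_nonneg) (auto simp: c'_def)
    finally show ?thesis .
  qed
  \<comment> \<open>Strict because \<open>x\<close> is nonzero: it has a component along some
    \<open>v i\<close>, and every such \<open>v i\<close> has its eigenvalue below
    \<open>- z - \<delta>\<close>.\<close>
  have "ip n x (mv n W x) < (- z - \<delta>) * ip n x x"
  proof -
    have "0 < (\<Sum>i<n. (ip n (v i) x)\<^sup>2)" using pos spectral_norm_sq[OF W, of x] by simp
    moreover have "(\<Sum>i<n. (ip n (v i) x)\<^sup>2) = 0" if "\<forall>i\<in>{..<n}. (ip n (v i) x)\<^sup>2 = 0"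
      using that by (rule sum.neutral)
    ultimately have "\<not> (\<forall>i\<in>{..<n}. (ip n (v i) x)\<^sup>2 = 0)" by linarith
    then obtain i where i: "i < n" "(ip n (v i) x)\<^sup>2 \<noteq> 0" by auto
    have "(\<Sum>i<n. e i * (ip n (v i) x)\<^sup>2) < (\<Sum>i<n. (- z - \<delta>) * (ip n (v i) x)\<^sup>2)"
    proof (rule sum_strict_mono_ex1)
      show "\<forall>i\<in>{..<n}. e i * (ip n (v i) x)\<^sup>2 \<le> (- z - \<delta>) * (ip n (v i) x)\<^sup>2"
      proof
        fix i assume i: "i \<in> {..<n}"
        show "e i * (ip n (v i) x)\<^sup>2 \<le> (- z - \<delta>) * (ip n (v i) x)\<^sup>2"
        proof (cases "- z - \<delta> \<le> e i")
          case True
          then show ?thesis using v0[of i] i by simp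
        next
          case False
          then show ?thesis by (intro mult_right_mono) auto
        qed
      qed
      have "\<not> - z - \<delta> \<le> e i" using v0[of i] i by auto
      then show "\<exists>i\<in>{..<n}. e i * (ip n (v i) x)\<^sup>2 < (- z - \<delta>) * (ip n (v i) x)\<^sup>2"
        using i by (intro bexI[of _ i] mult_strict_right_mono) auto
    qed simp
    then show ?thesis
      by (simp only: spectral_quadratic_form[OF W] spectral_norm_sq[OF W] sum_distrib_left)
  qed
  moreover have "- (eps * ip n x (mv n V x)) \<le> \<delta> * ip n x x"
  proof -
    have "- (eps * ip n x (mv n V x)) = (\<Sum>i<n. - (eps * f i) * (ip n (w i) x)\<^sup>2)"
      by (simp add: spectral_quadratic_form[OF V] sum_distrib_left sum_negf mult.assoc)
    also have "\<dots> \<le> (\<Sum>i<n. \<delta> * (ip n (w i) x)\<^sup>2)"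
    proof (rule sum_mono)
      fix i assume "i \<in> {..<n}"
      show "- (eps * f i) * (ip n (w i) x)\<^sup>2 \<le> \<delta> * (ip n (w i) x)\<^sup>2"
      proof (cases "\<delta> < \<bar>eps * f i\<bar>")
        case True
        then show ?thesis using w0[of i] \<open>i \<in> {..<n}\<close> by simp
      next
        case False
        then show ?thesis by (intro mult_right_mono) auto
      qed
    qed
    also have "\<dots> = \<delta> * ip n x x" by (simp add: spectral_norm_sq[OF V] sum_distrib_left)
    finally show ?thesis .
  qed
  ultimately show False using nonneg by (simp add: algebra_simps)
qed

text \<open>Chebyshev's inequality for the counting measure. With \<open>f\<close> the eigenvalues
  of \<open>W\<^sub>X\<close> the sum of squares is a trace, whose asymptotics are known.\<close>

lemma card_gt_le_sum_squares:
  fixes n :: nat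
  assumes "\<delta> > 0"
  shows "real (card {i. i < n \<and> \<delta> < \<bar>eps * f i\<bar>}) \<le> (eps / \<delta>)\<^sup>2 * (\<Sum>i<n. (f i)\<^sup>2)"
proof -
  let ?S = "{i. i < n \<and> \<delta> < \<bar>eps * f i\<bar>}"
  have "real (card ?S) = (\<Sum>i\<in>?S. 1)" by simp
  also have "\<dots> \<le> (\<Sum>i\<in>?S. (eps / \<delta>)\<^sup>2 * (f i)\<^sup>2)"
  proof (rule sum_mono)
    fix i assume "i \<in> ?S"
    then have "\<delta>\<^sup>2 \<le> \<bar>eps * f i\<bar>\<^sup>2" using assms by (intro power_mono) auto
    then show "1 \<le> (eps / \<delta>)\<^sup>2 * (f i)\<^sup>2"
      using assms by (simp add: power_divide power_mult_distrib field_simps)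
  qed
  also have "\<dots> \<le> (\<Sum>i<n. (eps / \<delta>)\<^sup>2 * (f i)\<^sup>2)" by (rule sum_mono2) auto
  finally show ?thesis by (simp add: sum_distrib_left)
qed

section \<open>Simultaneous diagonalisation and the spectrum of
  \<open>A G\<^sup>-\<^sup>1\<close>\<close>

definition posdef :: "nat \<Rightarrow> (nat \<Rightarrow> nat \<Rightarrow> real) \<Rightarrow> bool" where
  "posdef n G \<longleftrightarrow> (\<forall>x. (\<exists>i<n. x i \<noteq> 0) \<longrightarrow> ip n x (mv n G x) > 0)"

lemma ip_mv_sum:
  "ip n (\<lambda>a. \<Sum>i<m. \<alpha> i * R i a) (mv n B (\<lambda>a. \<Sum>k<m. \<beta> k * R k a)) =
     (\<Sum>i<m. \<Sum>k<m. \<alpha> i * (\<beta> k * ip n (R i) (mv n B (R k))))"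
proof -
  have 1: "mv n B (\<lambda>a. \<Sum>k<m. \<beta> k * R k a) = (\<lambda>a. \<Sum>k<m. \<beta> k * mv n B (R k) a)"
    unfolding mv_def by (rule ext, simp add: sum_distrib_left, subst sum.swap, simp add: mult_ac)
  have 2: "ip n (\<lambda>a. \<Sum>i<m. \<alpha> i * R i a) y = (\<Sum>i<m. \<alpha> i * ip n (R i) y)" for y
    by (subst ip_commute, subst ip_sum_right, simp add: ip_scale_right, simp add: ip_commute)
  show ?thesis unfolding 1 2 ip_sum_right ip_scale_right sum_distrib_left
    by (subst sum.swap, intro sum.cong refl) (simp add: mult.left_commute)
qed

text \<open>Whitening: eigenvectors of \<open>G\<close> divided by the square roots of their
  eigenvalues form a \<open>G\<close>-orthonormal basis \<open>R\<close>. The matrix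
  \<open>C\<close> of \<open>A\<close> in this basis is symmetric, and rotating \<open>R\<close> by
  the eigenvectors of \<open>C\<close> diagonalises \<open>A\<close> while keeping
  \<open>G\<close>-orthonormality.\<close>

theorem pencil_diagonalization:
  assumes A: "symm n A" and G: "symm n G" "posdef n G"
  obtains p d where
    "\<And>j l. j < n \<Longrightarrow> l < n \<Longrightarrow> ip n (p j) (mv n G (p l)) = (if j = l then 1 else 0)"
    "\<And>j l. j < n \<Longrightarrow> l < n \<Longrightarrow> ip n (p j) (mv n A (p l)) = (if j = l then d j else 0)"
proof -
  obtain u g where ug: "spectral_decomp n G u g" using spectral_theorem[OF G(1)] .
  have ipG: "ip n (u i) (mv n G (u k)) = (if i = k then g i else 0)" if "i < n" "k < n" for i k
  proof -
    have "ip n (u i) (mv n G (u k)) = ip n (u i) (\<lambda>a. g k * u k a)"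
      using spectral_eigen[OF ug] that by (intro ip_cong) auto
    also have "\<dots> = (if i = k then g i else 0)"
      using ug that by (simp add: ip_scale_right spectral_decomp_def)
    finally show ?thesis .
  qed
  have gpos: "g i > 0" if "i < n" for i
  proof -
    have "ip n (u i) (u i) = 1" using ug that by (simp add: spectral_decomp_def)
    then have "\<exists>a<n. u i a \<noteq> 0" using ip_self_eq_0_iff[of n "u i"] by auto
    then have "ip n (u i) (mv n G (u i)) > 0" using G(2) unfolding posdef_def by blast
    then show ?thesis using ipG[OF that that] by simp
  qed
  define R where "R = (\<lambda>i a. 1 / sqrt (g i) * u i a)"
  have ipR: "ip n (R i) (mv n B (R k)) = 1 / sqrt (g i) * (1 / sqrt (g k) * ip n (u i) (mv n B (u k)))" for i k B
    unfolding R_def mv_scale by (subst ip_scale_right, subst ip_commute, subst ip_scale_right, subst ip_commute) simp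
  have RG: "ip n (R i) (mv n G (R k)) = (if i = k then 1 else 0)" if "i < n" "k < n" for i k
    using gpos[OF that(1)] that by (auto simp: ipR ipG)
  define C where "C = (\<lambda>i k. ip n (R i) (mv n A (R k)))"
  have "symm n C" unfolding symm_def C_def by (metis A ip_commute ip_mv_sym)
  then obtain q d where qd: "spectral_decomp n C q d" by (rule spectral_theorem)
  define p where "p = (\<lambda>j a. \<Sum>i<n. q j i * R i a)"
  have "ip n (p j) (mv n G (p l)) = (if j = l then 1 else 0)" if "j < n" "l < n" for j l
  proof -
    have "ip n (p j) (mv n G (p l)) = (\<Sum>i<n. \<Sum>k<n. if k = i then q j i * q l k else 0)"
      unfolding p_def ip_mv_sum by (intro sum.cong refl) (auto simp: RG)
    also have "\<dots> = ip n (q j) (q l)" by (simp add: ip_def)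
    finally show ?thesis using qd that by (simp add: spectral_decomp_def)
  qed
  moreover have "ip n (p j) (mv n A (p l)) = (if j = l then d j else 0)" if "j < n" "l < n" for j l
  proof -
    have "ip n (p j) (mv n A (p l)) = ip n (q j) (mv n C (q l))"
      unfolding p_def ip_mv_sum by (simp add: ip_def[of n "q j"] mv_def C_def sum_distrib_left mult_ac)
    also have "\<dots> = ip n (q j) (\<lambda>a. d l * q l a)"
      using spectral_eigen[OF qd] that by (intro ip_cong) auto
    also have "\<dots> = (if j = l then d j else 0)"
      using qd that by (simp add: ip_scale_right spectral_decomp_def)
    finally show ?thesis .
  qed
  ultimately show ?thesis using that by blast
qed

text \<open>Exhibiting an inverse rules out the failure case of \<open>mat_inverse\<close>, so the
  default value in \<open>minv\<close> does not occur.\<close>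

lemma minv_eqI:
  fixes G H :: "real mat"
  assumes G: "G \<in> carrier_mat n n" and H: "H \<in> carrier_mat n n" and GH: "G * H = 1\<^sub>m n"
  shows "minv G = H"
proof (cases "mat_inverse G")
  case None
  have "H * G = 1\<^sub>m n" by (rule mat_mult_left_right_inverse[OF G H GH])
  then have "G \<in> Units (ring_mat TYPE(real) n ())"
    using G H GH unfolding Units_def ring_mat_def by auto
  then show ?thesis using mat_inverse(1)[OF G None, of "()"] by simp
next
  case (Some B)
  then have B: "G * B = 1\<^sub>m n" "B * G = 1\<^sub>m n" "B \<in> carrier_mat n n" using mat_inverse(2)[OF G] by auto
  have "B = B * (G * H)" using B GH by simp
  also have "\<dots> = (B * G) * H" using assoc_mult_mat[OF B(3) G H] by simp
  also have "\<dots> = H" using B H by simp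
  finally show ?thesis by (simp add: minv_def Some)
qed

text \<open>With \<open>P\<close> the matrix of columns \<open>p j\<close>, the hypotheses read
  \<open>P\<^sup>T G P = 1\<close> and \<open>P\<^sup>T A P = D\<close>. Hence
  \<open>G\<^sup>-\<^sup>1 = P P\<^sup>T\<close> and
  \<open>A G\<^sup>-\<^sup>1 = (G P) D (G P)\<^sup>-\<^sup>1\<close>: although not symmetric, the
  product is similar to a real diagonal matrix.\<close>

lemma char_poly_mult_minv:
  fixes A G :: "nat \<Rightarrow> nat \<Rightarrow> real"
  assumes PG: "\<And>j l. j < n \<Longrightarrow> l < n \<Longrightarrow> ip n (p j) (mv n G (p l)) = (if j = l then 1 else 0)"
    and PA: "\<And>j l. j < n \<Longrightarrow> l < n \<Longrightarrow> ip n (p j) (mv n A (p l)) = (if j = l then d j else 0)"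
  shows "char_poly (mat n n (\<lambda>(i, j). A i j) * minv (mat n n (\<lambda>(i, j). G i j))) =
    (\<Prod>j\<leftarrow>[0..<n]. [:- d j, 1:])"
proof -
  let ?A = "mat n n (\<lambda>(i, j). A i j)" and ?G = "mat n n (\<lambda>(i, j). G i j)"
  let ?P = "mat n n (\<lambda>(a, j). p j a)" and ?Pt = "mat n n (\<lambda>(j, a). p j a)"
  let ?D = "mat n n (\<lambda>(i, j). if i = j then d i else 0)"
  let ?H = "?G * ?P"
  have c: "?A \<in> carrier_mat n n" "?G \<in> carrier_mat n n" "?P \<in> carrier_mat n n" "?Pt \<in> carrier_mat n n"
    "?D \<in> carrier_mat n n" "?H \<in> carrier_mat n n" by auto
  have prod: "?Pt * (mat n n (\<lambda>(i, j). B i j) * ?P) = mat n n (\<lambda>(j, l). ip n (p j) (mv n B (p l)))" for B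
    by (rule eq_matI) (auto simp: scalar_prod_def ip_def mv_def atLeast0LessThan)
  have PtH: "?Pt * ?H = 1\<^sub>m n" unfolding prod by (rule eq_matI) (auto simp: PG)
  have HPt: "?H * ?Pt = 1\<^sub>m n" by (rule mat_mult_left_right_inverse[OF c(4) c(6) PtH])
  have minv: "minv ?G = ?P * ?Pt"
    by (rule minv_eqI[of _ n]) (use HPt c assoc_mult_mat[OF c(2,3,4)] in auto)
  have "?Pt * (?A * ?P) = ?D" unfolding prod by (rule eq_matI) (auto simp: PA)
  then have "?H * ?D = ?H * (?Pt * (?A * ?P))" by simp
  also have "\<dots> = (?H * ?Pt) * (?A * ?P)"
    by (rule assoc_mult_mat[symmetric, of _ n n _ n _ n]) (use c in auto)
  also have "\<dots> = ?A * ?P" unfolding HPt by (rule left_mult_one_mat[of _ n n]) (use c in auto)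
  finally have HD: "?H * ?D = ?A * ?P" .
  have "?A * minv ?G = ?H * ?D * ?Pt"
    unfolding minv HD by (rule assoc_mult_mat[symmetric, of _ n n _ n _ n]) (use c in auto)
  moreover have dim: "dim_row (?A * minv ?G) = n" by simp
  moreover have "?A * minv ?G \<in> carrier_mat n n" unfolding minv by auto
  ultimately have "similar_mat_wit (?A * minv ?G) ?D ?H ?Pt"
    unfolding similar_mat_wit_def Let_def dim using c PtH HPt by blast
  then have "char_poly (?A * minv ?G) = char_poly ?D"
    by (intro char_poly_similar) (auto simp: similar_mat_def)
  also have "\<dots> = (\<Prod>a\<leftarrow>diag_mat ?D. [:- a, 1:])"
    by (rule char_poly_upper_triangular[of _ n]) auto
  also have "diag_mat ?D = map d [0..<n]"
    by (auto simp: diag_mat_def)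
  finally show ?thesis by (simp add: comp_def)
qed

text \<open>A sum over all eigenvalues depends only on the multiset of roots, so the increasing
  order may be exchanged for the order supplied by the diagonalisation. With \<open>h\<close> an
  indicator this rewrites the empirical distribution function.\<close>

lemma sum_sorted_eigenvalues:
  fixes h :: "real \<Rightarrow> real"
  assumes "char_poly A = (\<Prod>j\<leftarrow>[0..<n]. [:- d j, 1:])"
  shows "(\<Sum>i<n. h (sorted_eigenvalues A ! i)) = (\<Sum>i<n. h (d i))"
proof -
  have "proots (char_poly A) = mset (map d [0..<n])"
  proof -
    have "proots (\<Prod>j\<leftarrow>xs. [:- d j, 1:]) = mset (map d xs)" for xs
    proof (induction xs)
      case (Cons x xs)
      have "(\<Prod>j\<leftarrow>xs. [:- d j, 1:]) \<noteq> 0" by (auto simp: prod_list_zero_iff)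
      then have "proots ([:- d x, 1:] * (\<Prod>j\<leftarrow>xs. [:- d j, 1:])) = mset (map d (x # xs))"
        using Cons.IH by (subst proots_mult) auto
      then show ?case by (simp only: list.map prod_list.Cons)
    qed simp
    then show ?thesis using assms by simp
  qed
  then have ev: "mset (sorted_eigenvalues A) = mset (map d [0..<n])"
    by (simp add: sorted_eigenvalues_def)
  have len: "length (sorted_eigenvalues A) = n" using arg_cong[OF ev, of size] by simp
  have "(\<Sum>i<n. h (sorted_eigenvalues A ! i)) = sum_list (map h (sorted_eigenvalues A))"
    by (simp add: sum_list_sum_nth len atLeast0LessThan)
  also have "\<dots> = sum_mset (image_mset h (mset (sorted_eigenvalues A)))"
    by (simp add: sum_mset_sum_list[symmetric])
  also have "\<dots> = sum_list (map h (map d [0..<n]))"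
    unfolding ev by (metis mset_map sum_mset_sum_list)
  also have "\<dots> = (\<Sum>i<n. h (d i))"
    by (simp add: sum_list_sum_nth atLeast0LessThan)
  finally show ?thesis .
qed

subsection \<open>Gaussian integration by parts\<close>

text \<open>\<open>pder I p f f'\<close>: \<open>f\<close> is a polynomial in the coordinates \<open>I\<close> with
  partial derivative \<open>f'\<close> in the coordinate \<open>p\<close>.\<close>

inductive pder :: "'i set \<Rightarrow> 'i \<Rightarrow> (('i \<Rightarrow> real) \<Rightarrow> real) \<Rightarrow> (('i \<Rightarrow> real) \<Rightarrow> real) \<Rightarrow> bool"
  for I :: "'i set" and p :: 'i where
  pder_const: "pder I p (\<lambda>_. c) (\<lambda>_. 0)"
| pder_add: "pder I p f f' \<Longrightarrow> pder I p g g' \<Longrightarrow> pder I p (\<lambda>y. f y + g y) (\<lambda>y. f' y + g' y)"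
| pder_coord_mult: "q \<in> I \<Longrightarrow> pder I p f f' \<Longrightarrow>
    pder I p (\<lambda>y. y q * f y) (\<lambda>y. (if q = p then 1 else 0) * f y + y q * f' y)"

lemma pder_cong: "pder I p f f' \<Longrightarrow> (\<And>y. f y = g y) \<Longrightarrow> (\<And>y. f' y = g' y) \<Longrightarrow> pder I p g g'"
  by (metis ext)

lemma pder_coord: "q \<in> I \<Longrightarrow> pder I p (\<lambda>y. y q) (\<lambda>y. if q = p then 1 else 0)"
  by (rule pder_cong[OF pder_coord_mult[OF _ pder_const[of I p 1]]]) auto

lemma pder_mult:
  assumes "pder I p f f'" "pder I p g g'"
  shows "pder I p (\<lambda>y. f y * g y) (\<lambda>y. f' y * g y + f y * g' y)"
  using assms(1)
proof (induction rule: pder.induct)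
  case (pder_const c)
  show ?case using assms(2)
  proof (induction rule: pder.induct)
    case (pder_const d)
    show ?case by (rule pder_cong[OF pder.pder_const[of I p "c * d"]]) auto
  next
    case (pder_add f f' g g')
    show ?case by (rule pder_cong[OF pder.pder_add[OF pder_add.IH]]) (auto simp: algebra_simps)
  next
    case (pder_coord_mult q f f')
    show ?case by (rule pder_cong[OF pder.pder_coord_mult[OF pder_coord_mult.hyps(1) pder_coord_mult.IH]])
        (auto simp: algebra_simps)
  qed
next
  case (pder_add f f' g g')
  show ?case by (rule pder_cong[OF pder.pder_add[OF pder_add.IH]]) (auto simp: algebra_simps)
next
  case (pder_coord_mult q f f')
  show ?case by (rule pder_cong[OF pder.pder_coord_mult[OF pder_coord_mult.hyps(1) pder_coord_mult.IH]])
      (auto simp: algebra_simps)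
qed

lemma pder_cmult: "pder I p f f' \<Longrightarrow> pder I p (\<lambda>y. c * f y) (\<lambda>y. c * f' y)"
  by (rule pder_cong[OF pder_mult[OF pder_const[of I p c]]]) auto

lemma pder_sum:
  assumes "\<And>s. s \<in> S \<Longrightarrow> pder I p (f s) (f' s)"
  shows "pder I p (\<lambda>y. \<Sum>s\<in>S. f s y) (\<lambda>y. \<Sum>s\<in>S. f' s y)"
  using assms
proof (induction S rule: infinite_finite_induct)
  case (insert x F)
  have "pder I p (\<lambda>y. f x y + (\<Sum>s\<in>F. f s y)) (\<lambda>y. f' x y + (\<Sum>s\<in>F. f' s y))"
    by (intro pder_add insert) auto
  then show ?case using insert.hyps by simp
qed (auto intro: pder_const)

section \<open>Monomials as lists of coordinates, and their Gaussian moments\<close>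

definition mon :: "'i list \<Rightarrow> ('i \<Rightarrow> real) \<Rightarrow> real" where
  "mon L y = prod_list (map y L)"

lemma mon_simps [simp]: "mon [] y = 1" "mon (q # L) y = y q * mon L y"
  by (simp_all add: mon_def)

text \<open>The partial derivative of \<open>mon L\<close> in the coordinate \<open>p\<close>, by
  the product rule along the list.\<close>

fun dmon :: "'i \<Rightarrow> 'i list \<Rightarrow> ('i \<Rightarrow> real) \<Rightarrow> real" where
  "dmon p [] y = 0"
| "dmon p (q # L) y = (if q = p then 1 else 0) * mon L y + y q * dmon p L y"

lemma mon_remove1: "q \<in> set L \<Longrightarrow> y q * mon (remove1 q L) y = mon L y"
  by (induction L) (auto simp: mult.left_commute)

lemma dmon_eq: "dmon p L y = real (count_list L p) * mon (remove1 p L) y"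
proof (induction L)
  case (Cons q L)
  show ?case
  proof (cases "q = p")
    case True
    have "y p * (real (count_list L p) * mon (remove1 p L) y) = real (count_list L p) * mon L y"
    proof (cases "p \<in> set L")
      case True
      then show ?thesis using mon_remove1[OF True, of y] by (metis mult.left_commute)
    next
      case False
      then show ?thesis by (simp add: count_list_0_iff)
    qed
    then show ?thesis using True Cons.IH by (simp add: algebra_simps)
  qed (use Cons.IH in auto)
qed simp

lemma mon_eq_prod:
  assumes "finite I" "set L \<subseteq> I"
  shows "mon L y = (\<Prod>q\<in>I. y q ^ count_list L q)"
  using assms(2)
proof (induction L)
  case (Cons q L)
  have "(\<Prod>r\<in>I. y r ^ count_list (q # L) r) = (\<Prod>r\<in>I. (if r = q then y q else 1) * y r ^ count_list L r)"
    by (intro prod.cong refl) auto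
  also have "\<dots> = y q * (\<Prod>r\<in>I. y r ^ count_list L r)"
    using Cons.prems assms(1) by (simp add: prod.distrib)
  finally show ?case using Cons by simp
qed simp

text \<open>The moments of the standard normal law: \<open>(k - 1)!!\<close> for even
  \<open>k\<close>.\<close>

definition nmom :: "nat \<Rightarrow> real" where
  "nmom k = (if even k then fact k / (2 ^ (k div 2) * fact (k div 2)) else 0)"

lemma nmom_has_bochner_integral:
  "has_bochner_integral lborel (\<lambda>x. std_normal_density x * x ^ k) (nmom k)"
proof (cases "even k")
  case True
  then obtain j where "k = 2 * j" by (elim evenE)
  then show ?thesis using std_normal_moment_even[of j] by (simp add: nmom_def)
next
  case False
  then obtain j where "k = 2 * j + 1" by (elim oddE)
  then show ?thesis using std_normal_moment_odd[of j] by (simp add: nmom_def)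
qed

text \<open>Integration by parts in one variable on the level of moments. At \<open>k = 0\<close>
  the factor \<open>real k\<close> cancels the truncated \<open>k - 1\<close>.\<close>

lemma nmom_Suc: "nmom (Suc k) = real k * nmom (k - 1)"
proof (cases "odd k")
  case True
  then obtain j where k: "k = 2 * j + 1" by (elim oddE)
  have "nmom (Suc k) = ((2 * (real j + 1)) * ((2 * real j + 1) * fact (2 * j))) / ((2 * (real j + 1)) * (2 ^ j * fact j))"
    by (simp add: k nmom_def algebra_simps)
  also have "\<dots> = ((2 * real j + 1) * fact (2 * j)) / (2 ^ j * fact j)"
    by (rule mult_divide_mult_cancel_left) (simp add: add_pos_nonneg less_imp_neq[symmetric])
  finally show ?thesis by (simp add: k nmom_def)
qed (auto simp: nmom_def)

locale std_gaussian_family = prob_space M for M :: "'a measure" +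
  fixes I :: "'i set" and X :: "'i \<Rightarrow> 'a \<Rightarrow> real"
  assumes finite_I: "finite I"
    and normal: "\<And>i. i \<in> I \<Longrightarrow> distributed M lborel (X i) std_normal_density"
    and indep: "indep_vars (\<lambda>_. borel) X I"
begin

definition pt :: "'a \<Rightarrow> 'i \<Rightarrow> real" where "pt w = (\<lambda>i. X i w)"

definition Exp :: "(('i \<Rightarrow> real) \<Rightarrow> real) \<Rightarrow> real" where
  "Exp f = expectation (\<lambda>w. f (pt w))"

lemma moment:
  assumes "i \<in> I"
  shows "integrable M (\<lambda>w. X i w ^ k)" "expectation (\<lambda>w. X i w ^ k) = nmom k"
proof -
  have m: "(\<lambda>x::real. x ^ k) \<in> borel_measurable lborel" by simp
  show "integrable M (\<lambda>w. X i w ^ k)"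
    using distributed_integrable[OF normal[OF assms] m] nmom_has_bochner_integral[of k]
    by (auto simp: has_bochner_integral_iff)
  show "expectation (\<lambda>w. X i w ^ k) = nmom k"
    using distributed_integral[OF normal[OF assms] m] nmom_has_bochner_integral[of k]
    by (auto simp: has_bochner_integral_iff)
qed

lemma mon_moment:
  assumes "set L \<subseteq> I"
  shows "integrable M (\<lambda>w. mon L (pt w))" "Exp (mon L) = (\<Prod>q\<in>I. nmom (count_list L q))"
proof -
  have eq: "mon L (pt w) = (\<Prod>q\<in>I. X q w ^ count_list L q)" for w
    using mon_eq_prod[OF finite_I assms] by (simp add: pt_def)
  have ind: "indep_vars (\<lambda>_. borel) (\<lambda>q w. X q w ^ count_list L q) I"
    by (rule indep_vars_compose2[OF indep]) simp
  show "integrable M (\<lambda>w. mon L (pt w))" unfolding eq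
    by (rule indep_vars_integrable[OF finite_I ind]) (rule moment)
  show "Exp (mon L) = (\<Prod>q\<in>I. nmom (count_list L q))" unfolding Exp_def eq
    by (subst indep_vars_lebesgue_integral[OF finite_I ind]) (auto simp: moment intro!: prod.cong)
qed

text \<open>By independence the expectation of a monomial is a product over the coordinates. Only
  the factor at \<open>p\<close> changes, and there \<open>nmom_Suc\<close> applies.\<close>

lemma mon_ibp:
  assumes "set L \<subseteq> I" "p \<in> I"
  shows "Exp (mon (p # L)) = Exp (dmon p L)"
proof -
  let ?c = "count_list L p"
  have L': "set (remove1 p L) \<subseteq> I" using assms by (meson notin_set_remove1 subset_iff)
  have "Exp (mon (p # L)) = (\<Prod>q\<in>I. nmom (count_list (p # L) q))"
    using assms by (intro mon_moment) auto
  also have "\<dots> = nmom (count_list (p # L) p) * (\<Prod>q\<in>I - {p}. nmom (count_list (p # L) q))"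
    by (rule prod.remove[OF finite_I assms(2)])
  also have "(\<Prod>q\<in>I - {p}. nmom (count_list (p # L) q)) = (\<Prod>q\<in>I - {p}. nmom (count_list L q))"
    by (rule prod.cong) auto
  also have "nmom (count_list (p # L) p) = real ?c * nmom (?c - 1)" by (simp add: nmom_Suc)
  also have "real ?c * nmom (?c - 1) * (\<Prod>q\<in>I - {p}. nmom (count_list L q)) =
      real ?c * (nmom (?c - 1) * (\<Prod>q\<in>I - {p}. nmom (count_list L q)))" by simp
  also have "nmom (?c - 1) * (\<Prod>q\<in>I - {p}. nmom (count_list L q)) = (\<Prod>q\<in>I. nmom (count_list (remove1 p L) q))"
  proof -
    have c: "count_list (remove1 p L) q = (if q = p then ?c - 1 else count_list L q)" for q
      by (induction L) auto
    have "(\<Prod>q\<in>I. nmom (count_list (remove1 p L) q)) =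
        nmom (count_list (remove1 p L) p) * (\<Prod>q\<in>I - {p}. nmom (count_list (remove1 p L) q))"
      by (rule prod.remove[OF finite_I assms(2)])
    also have "(\<Prod>q\<in>I - {p}. nmom (count_list (remove1 p L) q)) = (\<Prod>q\<in>I - {p}. nmom (count_list L q))"
      by (rule prod.cong) (auto simp: c)
    finally show ?thesis by (simp add: c)
  qed
  also have "\<dots> = Exp (mon (remove1 p L))" using mon_moment(2)[OF L'] by simp
  also have "real ?c * Exp (mon (remove1 p L)) = Exp (dmon p L)"
    by (simp add: Exp_def dmon_eq)
  finally show ?thesis .
qed

text \<open>The extra monomial strengthens the induction: a coordinate multiplying \<open>f\<close>
  is moved into \<open>L\<close>.\<close>

lemma pder_mon_integrable:
  assumes "pder I p f f'" "set L \<subseteq> I"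
  shows "integrable M (\<lambda>w. f (pt w) * mon L (pt w))" "integrable M (\<lambda>w. f' (pt w) * mon L (pt w))"
proof -
  have "integrable M (\<lambda>w. f (pt w) * mon L (pt w)) \<and> integrable M (\<lambda>w. f' (pt w) * mon L (pt w))"
    using assms
  proof (induction arbitrary: L rule: pder.induct)
    case (pder_const c)
    then show ?case by (simp add: mon_moment)
  next
    case (pder_add f f' g g')
    then show ?case by (simp add: distrib_right)
  next
    case (pder_coord_mult q f f')
    have 1: "integrable M (\<lambda>w. f (pt w) * mon (q # L) (pt w))" "integrable M (\<lambda>w. f' (pt w) * mon (q # L) (pt w))"
      "integrable M (\<lambda>w. f (pt w) * mon L (pt w))"
      using pder_coord_mult.IH[of "q # L"] pder_coord_mult.IH[of L] pder_coord_mult.prems pder_coord_mult.hyps by auto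
    have "integrable M (\<lambda>w. pt w q * f (pt w) * mon L (pt w))"
      using 1(1) by (simp add: mult_ac)
    moreover have "integrable M (\<lambda>w. (if q = p then 1 else 0) * (f (pt w) * mon L (pt w)) + f' (pt w) * mon (q # L) (pt w))"
      by (intro Bochner_Integration.integrable_add integrable_mult_right 1)
    then have "integrable M (\<lambda>w. ((if q = p then 1 else 0) * f (pt w) + pt w q * f' (pt w)) * mon L (pt w))"
      by (rule back_subst[where P = "integrable M"]) (auto simp: fun_eq_iff algebra_simps)
    ultimately show ?case by simp
  qed
  then show "integrable M (\<lambda>w. f (pt w) * mon L (pt w))" "integrable M (\<lambda>w. f' (pt w) * mon L (pt w))" by auto
qed

lemma pder_integrable:
  assumes "pder I p f f'"
  shows "integrable M (\<lambda>w. f (pt w))" "integrable M (\<lambda>w. f' (pt w))"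
  using pder_mon_integrable[OF assms, of "[]"] by simp_all

lemma pder_dmon_integrable:
  assumes "pder I p f f'" "set L \<subseteq> I"
  shows "integrable M (\<lambda>w. f (pt w) * dmon r L (pt w))"
proof -
  have "integrable M (\<lambda>w. real (count_list L r) * (f (pt w) * mon (remove1 r L) (pt w)))"
    by (intro integrable_mult_right pder_mon_integrable(1)[OF assms(1)]) (meson assms(2) notin_set_remove1 subset_iff)
  then show ?thesis by (simp add: dmon_eq mult_ac)
qed

theorem gaussian_ibp:
  assumes "pder I p f f'" "p \<in> I"
  shows "Exp (\<lambda>y. y p * f y) = Exp f'"
proof -
  \<comment> \<open>Generalised by a monomial factor, whose derivative is \<open>dmon p L\<close>.
    The coordinate case of the induction is then the hypothesis for \<open>q # L\<close>, and the
    constant case is \<open>mon_ibp\<close>.\<close>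
  have "Exp (\<lambda>y. f y * mon (p # L) y) = Exp (\<lambda>y. f' y * mon L y + f y * dmon p L y)" if "set L \<subseteq> I" for L
    using assms(1) that
  proof (induction arbitrary: L rule: pder.induct)
    case (pder_const c)
    then show ?case using mon_ibp[OF pder_const assms(2)] by (simp add: Exp_def del: mon_simps)
  next
    case (pder_add f f' g g')
    have pL: "set (p # L) \<subseteq> I" using pder_add.prems assms(2) by simp
    note int = pder_mon_integrable[OF pder_add.hyps(1) pL] pder_mon_integrable[OF pder_add.hyps(2) pL]
      pder_mon_integrable[OF pder_add.hyps(1) pder_add.prems] pder_mon_integrable[OF pder_add.hyps(2) pder_add.prems]
      pder_dmon_integrable[OF pder_add.hyps(1) pder_add.prems] pder_dmon_integrable[OF pder_add.hyps(2) pder_add.prems]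
    have "Exp (\<lambda>y. (f y + g y) * mon (p # L) y) = Exp (\<lambda>y. f y * mon (p # L) y) + Exp (\<lambda>y. g y * mon (p # L) y)"
      unfolding Exp_def distrib_right by (rule Bochner_Integration.integral_add) (rule int)+
    also have "\<dots> = Exp (\<lambda>y. (f' y * mon L y + f y * dmon p L y) + (g' y * mon L y + g y * dmon p L y))"
      unfolding pder_add.IH(1)[OF pder_add.prems] pder_add.IH(2)[OF pder_add.prems]
      unfolding Exp_def
      by (rule Bochner_Integration.integral_add[symmetric]) (intro Bochner_Integration.integrable_add int)+
    finally show ?case by (simp add: algebra_simps)
  next
    case (pder_coord_mult q f f')
    have qL: "set (q # L) \<subseteq> I" using pder_coord_mult.prems pder_coord_mult.hyps(1) by simp
    have "Exp (\<lambda>y. y q * f y * mon (p # L) y) = Exp (\<lambda>y. f y * mon (p # q # L) y)"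
      by (simp add: mult_ac)
    also have "\<dots> = Exp (\<lambda>y. f' y * mon (q # L) y + f y * dmon p (q # L) y)"
      by (rule pder_coord_mult.IH[OF qL])
    finally show ?case by (simp add: algebra_simps)
  qed
  from this[of "[]"] show ?thesis by (simp add: mult.commute)
qed

lemma Exp_cmult: "Exp (\<lambda>y. c * f y) = c * Exp f"
  by (simp add: Exp_def)

end

subsection \<open>Moments of the semicircle law\<close>

text \<open>The Catalan numbers at even indices and 0 at odd ones, defined by the convolution in
  which the loop equations will present them.\<close>

fun cat :: "nat \<Rightarrow> real" where
  "cat 0 = 1"
| "cat (Suc k) = (\<Sum>l<k. cat l * cat (k - 1 - l))"

declare cat.simps(2) [simp del]

text \<open>The generating function satisfies \<open>f = 1 + X\<^sup>2 f\<^sup>2\<close>; with \<open>s = 1 - 2 X\<^sup>2 f\<close> this says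
  \<open>s\<^sup>2 = 1 - 4 X\<^sup>2\<close>, and differentiating gives \<open>(1 - 4 X\<^sup>2) s' = - 4 X s\<close>.\<close>

lemma cat_linear_recurrence: "(real k + 4) * cat (k + 2) = 4 * (real k + 1) * cat k"
proof -
  define f where "f = Abs_fps cat"
  define s where "s = 1 - 2 * fps_X\<^sup>2 * f"
  have f: "f = 1 + fps_X\<^sup>2 * (f * f)"
  proof (rule fps_ext)
    fix n
    show "fps_nth f n = fps_nth (1 + fps_X\<^sup>2 * (f * f)) n"
    proof (cases "n < 2")
      case True
      then have "n = 0 \<or> n = 1" by auto
      then show ?thesis by (auto simp: f_def fps_X_power_mult_nth cat.simps(2))
    next
      case False
      define m where "m = n - 2"
      have n: "n = Suc (Suc m)" using False by (simp add: m_def)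
      have "fps_nth f n = (\<Sum>l<Suc m. cat l * cat (m - l))"
        by (simp add: f_def n cat.simps(2)[of "Suc m"])
      also have "\<dots> = fps_nth (f * f) m"
        by (simp add: fps_mult_nth f_def lessThan_Suc_atMost atLeast0AtMost)
      finally show ?thesis by (simp add: n fps_X_power_mult_nth)
    qed
  qed
  have "s * s = 1 - 4 * fps_X\<^sup>2 * (f - fps_X\<^sup>2 * (f * f))"
    by (simp add: s_def algebra_simps power2_eq_square)
  also have "f - fps_X\<^sup>2 * (f * f) = 1" using f by (metis add_diff_cancel_right')
  finally have ss: "s * s = 1 - 4 * fps_X\<^sup>2" by simp
  then have "fps_deriv (s * s) = fps_deriv (1 - 4 * fps_X\<^sup>2)" by simp
  then have "2 * (s * fps_deriv s) = 2 * (- 4 * fps_X)"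
    by (simp add: power2_eq_square algebra_simps)
  then have d: "s * fps_deriv s = - 4 * fps_X"
    by (metis mult_left_cancel zero_neq_numeral)
  have "(1 - 4 * fps_X\<^sup>2) * fps_deriv s = s * (s * fps_deriv s)"
    by (simp add: ss[symmetric] mult.assoc)
  also have "\<dots> = - 4 * (fps_X * s)" unfolding d by (simp add: algebra_simps)
  finally have e: "fps_deriv s - fps_const 4 * (fps_X\<^sup>2 * fps_deriv s) = - fps_const 4 * (fps_X * s)"
    by (simp add: algebra_simps numeral_fps_const)
  have snth: "fps_nth s (i + 2) = - 2 * cat i" for i
    by (simp add: s_def mult.assoc numeral_fps_const fps_X_power_mult_nth f_def)
  \<comment> \<open>The factor \<open>fps_X\<^sup>2\<close> in \<open>s\<close> shifts indices by
    two, so comparing coefficients at \<open>k + 3\<close> relates \<open>cat (k + 2)\<close> to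
    \<open>cat k\<close>.\<close>
  have "fps_nth (fps_deriv s - fps_const 4 * (fps_X\<^sup>2 * fps_deriv s)) (k + 3) =
      fps_nth (- fps_const 4 * (fps_X * s)) (k + 3)" by (simp only: e)
  then have "(real k + 4) * fps_nth s (k + 4) - 4 * ((real k + 2) * fps_nth s (k + 2)) = - 4 * fps_nth s (k + 2)"
    by (simp add: fps_X_power_mult_nth fps_X_mult_nth eval_nat_numeral algebra_simps)
  moreover have "fps_nth s (k + 4) = - 2 * cat (k + 2)" using snth[of "k + 2"] by (simp add: eval_nat_numeral)
  moreover have "fps_nth s (k + 2) = - 2 * cat k" by (rule snth)
  ultimately show ?thesis by (simp add: algebra_simps)
qed

section \<open>The semicircle density and its moments as integrals\<close>

definition sc :: "real \<Rightarrow> real" where "sc x = sqrt (4 - x\<^sup>2) / (2 * pi)"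

definition sc_int :: "(real \<Rightarrow> real) \<Rightarrow> real" where
  "sc_int g = (LINT x:{-2..2}|lborel. g x * sc x)"

lemma sc_nonneg: "x \<in> {-2..2} \<Longrightarrow> 0 \<le> sc x"
  using abs_square_le_1[of "x / 2"] by (auto simp: sc_def power_divide abs_le_iff)

lemma sc_le: "sc x \<le> 1 / 2"
proof (cases "4 - x\<^sup>2 \<ge> 0")
  case True
  have "sqrt (4 - x\<^sup>2) \<le> sqrt 4" by (rule real_sqrt_le_mono) simp
  then have "sc x \<le> 2 / (2 * pi)" unfolding sc_def by (intro divide_right_mono) auto
  also have "\<dots> \<le> 1 / 2" using pi_gt3 by (simp add: field_simps)
  finally show ?thesis .
next
  case False
  then have "sc x \<le> 0" by (simp add: sc_def divide_nonpos_pos)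
  then show ?thesis by simp
qed

lemma continuous_on_sc: "continuous_on A sc"
  unfolding sc_def by (intro continuous_intros) auto

lemma sc_measurable [measurable]: "sc \<in> borel_measurable borel"
  by (rule borel_measurable_continuous_onI[OF continuous_on_sc])

lemma sc_integrable:
  assumes [measurable]: "g \<in> borel_measurable borel" and "\<And>x. x \<in> {-2..2} \<Longrightarrow> \<bar>g x\<bar> \<le> B"
  shows "set_integrable lborel {-2..2} (\<lambda>x. g x * sc x)"
  unfolding set_integrable_def
proof (rule Bochner_Integration.integrable_bound)
  show "integrable lborel (\<lambda>x. indicator {-2..2} x *\<^sub>R (B * sc x))"
    by (rule borel_integrable_atLeastAtMost'[unfolded set_integrable_def])
      (intro continuous_intros continuous_on_sc)
  show "AE x in lborel. norm (indicator {-2..2} x *\<^sub>R (g x * sc x)) \<le> norm (indicator {-2..2} x *\<^sub>R (B * sc x))"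
  proof (rule AE_I2)
    fix x :: real
    show "norm (indicator {-2..2} x *\<^sub>R (g x * sc x)) \<le> norm (indicator {-2..2} x *\<^sub>R (B * sc x))"
    proof (cases "x \<in> {-2..2}")
      case True
      then have "\<bar>g x\<bar> \<le> \<bar>B\<bar>" using assms(2)[of x] by linarith
      then show ?thesis using True by (simp add: abs_mult mult_right_mono)
    qed simp
  qed
qed measurable

lemma sc_int_mono:
  assumes [measurable]: "g \<in> borel_measurable borel" "h \<in> borel_measurable borel"
    and "\<And>x. x \<in> {-2..2} \<Longrightarrow> \<bar>g x\<bar> \<le> B" "\<And>x. x \<in> {-2..2} \<Longrightarrow> \<bar>h x\<bar> \<le> B"
    and "\<And>x. x \<in> {-2..2} \<Longrightarrow> g x \<le> h x"
  shows "sc_int g \<le> sc_int h"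
  unfolding sc_int_def
  by (intro set_integral_mono sc_integrable[where B = B] mult_right_mono sc_nonneg) (use assms in auto)

lemma sc_int_HK: "continuous_on {-2..2} g \<Longrightarrow> sc_int g = integral {-2..2} (\<lambda>x. g x * sc x)"
  unfolding sc_int_def
  by (intro set_borel_integral_eq_integral(2) borel_integrable_atLeastAtMost' continuous_intros continuous_on_sc)

lemma sqrt_has_derivative:
  fixes x :: real
  assumes "x \<in> {-2<..<2}"
  shows "((\<lambda>x. sqrt (4 - x\<^sup>2)) has_real_derivative (- x / sqrt (4 - x\<^sup>2))) (at x)"
    and "0 < 4 - x\<^sup>2"
proof -
  show p: "0 < 4 - x\<^sup>2" using assms abs_square_less_1[of "x / 2"] by (auto simp: power_divide abs_less_iff)
  show "((\<lambda>x. sqrt (4 - x\<^sup>2)) has_real_derivative (- x / sqrt (4 - x\<^sup>2))) (at x)"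
    using p by (auto intro!: derivative_eq_intros simp: field_simps)
qed

text \<open>The square root is kept as an abstract \<open>S\<close> with derivative
  \<open>D\<close>, so that differentiation does not unfold it. The three antiderivatives serve, in
  this order, the moment recurrence, the first moment and the total mass.\<close>

lemma DERIV_moment_antiderivative:
  fixes S :: "real \<Rightarrow> real"
  assumes "(S has_real_derivative D) (at x)"
  shows "((\<lambda>x. x ^ (k + 1) * (4 - x\<^sup>2) * S x / (2 * pi)) has_real_derivative
     (((real k + 1) * x ^ k * (4 - x\<^sup>2) + x ^ (k + 1) * (- (2 * x))) * S x + x ^ (k + 1) * (4 - x\<^sup>2) * D) / (2 * pi)) (at x)"
    and "((\<lambda>x. - ((4 - x\<^sup>2) * S x) / (6 * pi)) has_real_derivative
     - ((- (2 * x)) * S x + (4 - x\<^sup>2) * D) / (6 * pi)) (at x)"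
    and "\<bar>x\<bar> < 2 \<Longrightarrow> ((\<lambda>x. (x * S x / 2 + 2 * arcsin (x / 2)) / (2 * pi)) has_real_derivative
     ((S x + x * D) / 2 + 2 * (inverse (sqrt (1 - (x / 2)\<^sup>2)) * (1 / 2))) / (2 * pi)) (at x)"
proof -
  have P: "((\<lambda>x. x ^ (k + 1)) has_real_derivative (real k + 1) * x ^ k) (at x)"
    using DERIV_pow[of "k + 1" x] by (simp add: add.commute)
  have Q: "((\<lambda>x. 4 - x\<^sup>2) has_real_derivative - (2 * x)) (at x)"
    by (auto intro!: derivative_eq_intros)
  show "((\<lambda>x. x ^ (k + 1) * (4 - x\<^sup>2) * S x / (2 * pi)) has_real_derivative
     (((real k + 1) * x ^ k * (4 - x\<^sup>2) + x ^ (k + 1) * (- (2 * x))) * S x + x ^ (k + 1) * (4 - x\<^sup>2) * D) / (2 * pi)) (at x)"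
    by (rule DERIV_cong[OF DERIV_cdivide[OF DERIV_mult[OF DERIV_mult[OF P Q] assms]]]) (simp add: algebra_simps)
qed (use assms in \<open>auto intro!: derivative_eq_intros simp: field_simps\<close>)

lemma sc_int_power_0: "sc_int (\<lambda>x. 1) = 1"
proof -
  let ?F = "\<lambda>x::real. (x * sqrt (4 - x\<^sup>2) / 2 + 2 * arcsin (x / 2)) / (2 * pi)"
  \<comment> \<open>The interior form of the fundamental theorem is used because the derivatives of
    the square root and of the arcsine blow up at the endpoints.\<close>
  have "((\<lambda>x. sc x) has_integral (?F 2 - ?F (-2))) {-2..2}"
  proof (rule fundamental_theorem_of_calculus_interior)
    show "continuous_on {-2..2} ?F" by (intro continuous_intros) auto
    fix x :: real assume x: "x \<in> {-2<..<2}"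
    note d = sqrt_has_derivative[OF x]
    define r where "r = sqrt (4 - x\<^sup>2)"
    have r: "r > 0" "r * r = 4 - x\<^sup>2" using d(2) by (auto simp: r_def)
    have s1: "sqrt (1 - (x / 2)\<^sup>2) = r / 2"
      using real_sqrt_divide[of "4 - x\<^sup>2" 4] by (simp add: r_def power_divide diff_divide_distrib)
    have "(?F has_real_derivative ((r + x * (- x / r)) / 2 + 2 * (inverse (r / 2) * (1 / 2))) / (2 * pi)) (at x)"
      using DERIV_moment_antiderivative(3)[OF d(1)] x unfolding s1 r_def[symmetric] by auto
    moreover have "((r + x * (- x / r)) / 2 + 2 * (inverse (r / 2) * (1 / 2))) = r"
      using r by (simp add: field_simps power2_eq_square)
    ultimately show "(?F has_vector_derivative sc x) (at x)"
      by (simp add: sc_def r_def has_real_derivative_iff_has_vector_derivative)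
  qed simp
  moreover have "?F 2 - ?F (-2) = 1" by (simp add: arcsin_minus field_simps)
  ultimately show ?thesis by (simp add: sc_int_HK integral_unique)
qed

lemma sc_int_power_1: "sc_int (\<lambda>x. x) = 0"
proof -
  let ?F = "\<lambda>x::real. - ((4 - x\<^sup>2) * sqrt (4 - x\<^sup>2)) / (6 * pi)"
  have "((\<lambda>x. x * sc x) has_integral (?F 2 - ?F (-2))) {-2..2}"
  proof (rule fundamental_theorem_of_calculus_interior)
    show "continuous_on {-2..2} ?F" by (intro continuous_intros) auto
    fix x :: real assume x: "x \<in> {-2<..<2}"
    note d = sqrt_has_derivative[OF x]
    define r where "r = sqrt (4 - x\<^sup>2)"
    have r: "r > 0" "4 - x\<^sup>2 = r * r" using d(2) by (auto simp: r_def)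
    have "(?F has_real_derivative - ((- (2 * x)) * r + (4 - x\<^sup>2) * (- x / r)) / (6 * pi)) (at x)"
      using DERIV_moment_antiderivative(2)[OF d(1)] unfolding r_def[symmetric] .
    moreover have "- ((- (2 * x)) * r + (4 - x\<^sup>2) * (- x / r)) / (6 * pi) = x * sc x"
      using r(1) unfolding sc_def r_def[symmetric] r(2) by (simp add: field_simps)
    ultimately show "(?F has_vector_derivative x * sc x) (at x)"
      by (simp add: has_real_derivative_iff_has_vector_derivative)
  qed simp
  then show ?thesis by (simp add: sc_int_HK integral_unique)
qed

text \<open>The derivative of \<open>x ^ (k + 1) * (4 - x\<^sup>2) powr (3 / 2)\<close> is
  integrated; this function vanishes at both endpoints.\<close>

lemma sc_int_power_recurrence:
  "(real k + 4) * sc_int (\<lambda>x. x ^ (k + 2)) = 4 * (real k + 1) * sc_int (\<lambda>x. x ^ k)"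
proof -
  let ?F = "\<lambda>x::real. x ^ (k + 1) * (4 - x\<^sup>2) * sqrt (4 - x\<^sup>2) / (2 * pi)"
  have "((\<lambda>x. 4 * (real k + 1) * (x ^ k * sc x) - (real k + 4) * (x ^ (k + 2) * sc x)) has_integral (?F 2 - ?F (-2))) {-2..2}"
  proof (rule fundamental_theorem_of_calculus_interior)
    show "continuous_on {-2..2} ?F" by (intro continuous_intros) auto
    fix x :: real assume x: "x \<in> {-2<..<2}"
    note d = sqrt_has_derivative[OF x]
    define r where "r = sqrt (4 - x\<^sup>2)"
    have r: "r > 0" "x\<^sup>2 = 4 - r * r" using d(2) by (auto simp: r_def)
    have "(?F has_real_derivative (((real k + 1) * x ^ k * (4 - x\<^sup>2) + x ^ (k + 1) * (- (2 * x))) * r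
        + x ^ (k + 1) * (4 - x\<^sup>2) * (- x / r)) / (2 * pi)) (at x)"
      using DERIV_moment_antiderivative(1)[OF d(1), of k] unfolding r_def[symmetric] .
    moreover have "(((real k + 1) * x ^ k * (4 - x\<^sup>2) + x ^ (k + 1) * (- (2 * x))) * r
        + x ^ (k + 1) * (4 - x\<^sup>2) * (- x / r)) / (2 * pi) =
        4 * (real k + 1) * (x ^ k * sc x) - (real k + 4) * (x ^ (k + 2) * sc x)"
    proof -
      have L: "x ^ (k + 1) * (4 - x\<^sup>2) * (- x / r) = - (x ^ k * x\<^sup>2 * r)"
        using r(1) by (simp add: r(2)) (simp add: field_simps r(2)[symmetric] power2_eq_square)
      have "(((real k + 1) * x ^ k * (4 - x\<^sup>2) + x ^ (k + 1) * (- (2 * x))) * r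
        + x ^ (k + 1) * (4 - x\<^sup>2) * (- x / r)) = (4 * (real k + 1) * x ^ k - (real k + 4) * (x ^ k * x\<^sup>2)) * r"
        unfolding L by (simp add: algebra_simps power2_eq_square)
      also have "\<dots> / (2 * pi) = 4 * (real k + 1) * (x ^ k * sc x) - (real k + 4) * (x ^ (k + 2) * sc x)"
        unfolding sc_def r_def[symmetric] power_add by (simp add: left_diff_distrib diff_divide_distrib)
      finally show ?thesis .
    qed
    ultimately show "(?F has_vector_derivative 4 * (real k + 1) * (x ^ k * sc x) - (real k + 4) * (x ^ (k + 2) * sc x)) (at x)"
      by (simp add: has_real_derivative_iff_has_vector_derivative)
  qed simp
  then have "integral {-2..2} (\<lambda>x. 4 * (real k + 1) * (x ^ k * sc x) - (real k + 4) * (x ^ (k + 2) * sc x)) = 0"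
    by (simp add: integral_unique)
  moreover have "(\<lambda>x. x ^ j * sc x) integrable_on {-2..2}" for j
    by (intro integrable_continuous_real continuous_intros continuous_on_sc)
  ultimately have "4 * (real k + 1) * integral {-2..2} (\<lambda>x. x ^ k * sc x) - (real k + 4) * integral {-2..2} (\<lambda>x. x ^ (k + 2) * sc x) = 0"
    by (subst (asm) Henstock_Kurzweil_Integration.integral_diff) (auto intro!: integrable_on_mult_right simp del: power_add power_Suc)
  then show ?thesis by (simp add: sc_int_HK continuous_intros)
qed

text \<open>The convolution defining \<open>cat\<close> is not visible from the integral. Both sides
  are compared through the same two-step linear recurrence and the starting values 1 and 0.\<close>

theorem sc_int_power: "sc_int (\<lambda>x. x ^ k) = cat k"
proof (induction k rule: induct_nat_012)
  case (ge2 k)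
  have "(real k + 4) * sc_int (\<lambda>x. x ^ (k + 2)) = (real k + 4) * cat (k + 2)"
    using sc_int_power_recurrence[of k] cat_linear_recurrence[of k] ge2(1) by simp
  moreover have "real k + 4 \<noteq> 0" by linarith
  ultimately show ?case by (metis add_2_eq_Suc' mult_left_cancel)
qed (simp_all add: sc_int_power_0 sc_int_power_1 cat.simps(2))

subsection \<open>Traces of powers of a centred Wishart matrix\<close>

lemma mpow_add:
  assumes "b < n"
  shows "(\<Sum>r<n. mpow n A k a r * mpow n A l r b) = mpow n A (k + l) a b"
  using assms
proof (induction l arbitrary: b)
  case (Suc l)
  have "(\<Sum>r<n. mpow n A k a r * mpow n A (Suc l) r b) =
      (\<Sum>s<n. (\<Sum>r<n. mpow n A k a r * mpow n A l r s) * A s b)"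
    by (simp add: sum_distrib_left sum_distrib_right mult.assoc) (rule sum.swap)
  then show ?case using Suc by simp
qed (simp add: if_distrib cong: if_cong)

lemma mpow_1: "a < n \<Longrightarrow> mpow n A (Suc 0) a b = A a b"
  by (simp add: if_distrib[of "\<lambda>z. z * _"] cong: if_cong)

lemma mpow_sym:
  assumes "symm n A" "a < n" "b < n"
  shows "mpow n A k a b = mpow n A k b a"
  using assms(2,3)
proof (induction k arbitrary: a b)
  case (Suc k)
  have "mpow n A (Suc k) a b = (\<Sum>r<n. mpow n A (Suc 0) b r * mpow n A k r a)"
    unfolding mpow_1[OF \<open>b < n\<close>] mpow.simps(2)[of n A k]
    by (intro sum.cong refl) (use Suc assms(1) in \<open>simp add: symm_def\<close>)
  then show ?case using mpow_add[OF \<open>a < n\<close>, of A "Suc 0" b k] by simp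
qed simp

definition Wm :: "nat \<Rightarrow> nat \<Rightarrow> (nat \<times> nat \<Rightarrow> real) \<Rightarrow> nat \<Rightarrow> nat \<Rightarrow> real" where
  "Wm n m y a b = ((\<Sum>j<m. y (a, j) * y (b, j)) - (if a = b then real m else 0)) / sqrt (real n * real m)"

abbreviation Pw :: "nat \<Rightarrow> nat \<Rightarrow> nat \<Rightarrow> (nat \<times> nat \<Rightarrow> real) \<Rightarrow> nat \<Rightarrow> nat \<Rightarrow> real" where
  "Pw n m k y \<equiv> mpow n (Wm n m y) k"

text \<open>The entries of \<open>W\<^sup>k Y\<close>; such matrices are what differentiation of
  powers of \<open>W\<close> in the entries of \<open>Y\<close> produces.\<close>

definition Vw :: "nat \<Rightarrow> nat \<Rightarrow> nat \<Rightarrow> (nat \<times> nat \<Rightarrow> real) \<Rightarrow> nat \<Rightarrow> nat \<Rightarrow> real" where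
  "Vw n m k y a j = (\<Sum>r<n. Pw n m k y a r * y (r, j))"

definition trw :: "nat \<Rightarrow> nat \<Rightarrow> nat \<Rightarrow> (nat \<times> nat \<Rightarrow> real) \<Rightarrow> real" where
  "trw n m k y = (\<Sum>a<n. Pw n m k y a a)"

text \<open>The trace of \<open>W\<^sup>k Y Y\<^sup>T\<close>, written with an explicit factor
  \<open>y (i, j)\<close> in each term so that Gaussian integration by parts can act on it.\<close>

definition Sw :: "nat \<Rightarrow> nat \<Rightarrow> nat \<Rightarrow> (nat \<times> nat \<Rightarrow> real) \<Rightarrow> real" where
  "Sw n m k y = (\<Sum>i<n. \<Sum>j<m. y (i, j) * Vw n m k y i j)"

lemma symm_Wm: "symm n (Wm n m y)"
  by (simp add: symm_def Wm_def mult.commute)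

lemma Pw_Vw:
  assumes "i < n"
  shows "(\<Sum>a<n. Pw n m l y i a * Vw n m k y a j) = Vw n m (l + k) y i j"
proof -
  have "(\<Sum>a<n. Pw n m l y i a * Vw n m k y a j) = (\<Sum>r<n. (\<Sum>a<n. Pw n m l y i a * Pw n m k y a r) * y (r, j))"
    unfolding Vw_def by (simp add: sum_distrib_left sum_distrib_right mult.assoc) (rule sum.swap)
  also have "\<dots> = Vw n m (l + k) y i j"
    unfolding Vw_def by (intro sum.cong refl) (simp add: mpow_add)
  finally show ?thesis .
qed

lemma Vw_Vw: "(\<Sum>i<n. \<Sum>j<m. Vw n m l y i j * Vw n m k y i j) = Sw n m (l + k) y"
proof -
  have "(\<Sum>i<n. \<Sum>j<m. Vw n m l y i j * Vw n m k y i j) =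
      (\<Sum>j<m. \<Sum>i<n. \<Sum>r<n. Pw n m l y i r * y (r, j) * Vw n m k y i j)"
    by (subst sum.swap) (simp add: Vw_def[of n m l] sum_distrib_right)
  also have "\<dots> = (\<Sum>j<m. \<Sum>r<n. \<Sum>i<n. Pw n m l y i r * y (r, j) * Vw n m k y i j)"
    by (intro sum.cong refl sum.swap)
  also have "\<dots> = (\<Sum>j<m. \<Sum>r<n. y (r, j) * (\<Sum>i<n. Pw n m l y r i * Vw n m k y i j))"
    by (intro sum.cong refl)
      (simp add: sum_distrib_left mult_ac mpow_sym[OF symm_Wm, of _ n _ m y l] cong: sum.cong_simp)
  also have "\<dots> = (\<Sum>j<m. \<Sum>r<n. y (r, j) * Vw n m (l + k) y r j)"
    by (intro sum.cong refl) (simp add: Pw_Vw)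
  also have "\<dots> = Sw n m (l + k) y" unfolding Sw_def by (rule sum.swap)
  finally show ?thesis .
qed

text \<open>Since \<open>Y Y\<^sup>T = sqrt (n m) W + m I\<close>, the trace of one degree higher
  appears. The second, larger term will cancel in the loop equation.\<close>

lemma Sw_eq:
  assumes "n > 0" "m > 0"
  shows "Sw n m k y = sqrt (real n * real m) * trw n m (Suc k) y + real m * trw n m k y"
proof -
  let ?c = "sqrt (real n * real m)"
  have c: "?c \<noteq> 0" using assms by simp
  have "Sw n m k y = (\<Sum>i<n. \<Sum>j<m. \<Sum>r<n. Pw n m k y i r * (y (r, j) * y (i, j)))"
    by (simp add: Sw_def Vw_def sum_distrib_left mult_ac)
  also have "\<dots> = (\<Sum>i<n. \<Sum>r<n. Pw n m k y i r * (\<Sum>j<m. y (r, j) * y (i, j)))"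
    by (rule sum.cong[OF refl], simp only: sum_distrib_left, rule sum.swap)
  also have "\<dots> = (\<Sum>i<n. \<Sum>r<n. Pw n m k y i r * (?c * Wm n m y r i + (if r = i then real m else 0)))"
    using c by (intro sum.cong refl) (simp add: Wm_def)
  also have "\<dots> = (\<Sum>i<n. ?c * (\<Sum>r<n. Pw n m k y i r * Wm n m y r i) + real m * Pw n m k y i i)"
    by (intro sum.cong refl)
      (simp add: distrib_left sum.distrib sum_distrib_left mult_ac if_distrib[of "\<lambda>z. _ * z"] if_distrib[of "\<lambda>z. z * _"] cong: if_cong)
  finally show ?thesis by (simp add: trw_def sum.distrib sum_distrib_left)
qed

lemma pder_Wm:
  fixes n m :: nat
  assumes "a < n" "b < n" "i < n" "j < m"
  shows "pder ({..<n} \<times> {..<m}) (i, j) (\<lambda>y. Wm n m y a b)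
    (\<lambda>y. ((if a = i then y (b, j) else 0) + (if b = i then y (a, j) else 0)) / sqrt (real n * real m))"
proof -
  let ?I = "{..<n} \<times> {..<m}" and ?c = "sqrt (real n * real m)"
  have "pder ?I (i, j) (\<lambda>y. \<Sum>j'<m. y (a, j') * y (b, j'))
     (\<lambda>y. \<Sum>j'<m. (if (a, j') = (i, j) then 1 else 0) * y (b, j') + y (a, j') * (if (b, j') = (i, j) then 1 else 0))"
    by (intro pder_sum pder_mult pder_coord) (use assms in auto)
  from pder_cmult[OF pder_add[OF this pder_const[of _ _ "- (if a = b then real m else 0)"]], of "1 / ?c"]
  show ?thesis
  proof (rule pder_cong)
    fix y :: "nat \<times> nat \<Rightarrow> real"
    have "(\<Sum>j'<m. (if (a, j') = (i, j) then 1 else 0) * y (b, j') + y (a, j') * (if (b, j') = (i, j) then 1 else 0)) =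
      (\<Sum>j'<m. (if j' = j then (if a = i then y (b, j) else 0) + (if b = i then y (a, j) else 0) else 0))"
      by (intro sum.cong refl) auto
    then show "1 / ?c * ((\<Sum>j'<m. (if (a, j') = (i, j) then 1 else 0) * y (b, j') + y (a, j') * (if (b, j') = (i, j) then 1 else 0)) + 0) =
      ((if a = i then y (b, j) else 0) + (if b = i then y (a, j) else 0)) / ?c"
      using assms by simp
  qed (simp add: Wm_def)
qed

text \<open>Noncommutative product rule: the derivative hits one of the \<open>k\<close> factors,
  with \<open>l\<close> factors to its left and \<open>k - 1 - l\<close> to its right. Each factor
  yields two terms because \<open>W\<close> is quadratic in \<open>Y\<close>.\<close>

lemma pder_Pw:
  fixes n m :: nat
  assumes "a < n" "b < n" "i < n" "j < m"
  shows "pder ({..<n} \<times> {..<m}) (i, j) (\<lambda>y. Pw n m k y a b)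
    (\<lambda>y. (\<Sum>l<k. Pw n m l y a i * Vw n m (k - 1 - l) y b j + Vw n m l y a j * Pw n m (k - 1 - l) y i b)
        / sqrt (real n * real m))"
  using assms(2)
proof (induction k arbitrary: b)
  case 0
  show ?case by (simp add: pder_const)
next
  case (Suc k)
  let ?I = "{..<n} \<times> {..<m}" and ?c = "sqrt (real n * real m)"
  let ?d = "\<lambda>k b y. (\<Sum>l<k. Pw n m l y a i * Vw n m (k - 1 - l) y b j + Vw n m l y a j * Pw n m (k - 1 - l) y i b) / ?c"
  let ?w = "\<lambda>r y. ((if r = i then y (b, j) else 0) + (if b = i then y (r, j) else 0)) / ?c"
  have "pder ?I (i, j) (\<lambda>y. \<Sum>r<n. Pw n m k y a r * Wm n m y r b)
     (\<lambda>y. \<Sum>r<n. ?d k r y * Wm n m y r b + Pw n m k y a r * ?w r y)"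
    by (intro pder_sum pder_mult Suc.IH pder_Wm) (use assms Suc.prems in auto)
  then show ?case
  proof (rule pder_cong)
    fix y :: "nat \<times> nat \<Rightarrow> real"
    have V: "(\<Sum>r<n. Vw n m l y r j * Wm n m y r b) = Vw n m (Suc l) y b j" for l
    proof -
      have "(\<Sum>r<n. Vw n m l y r j * Wm n m y r b) = (\<Sum>r<n. Pw n m (Suc 0) y b r * Vw n m l y r j)"
        by (intro sum.cong refl, subst mpow_1[OF Suc.prems])
          (use Suc.prems symm_Wm[of n m y] in \<open>simp add: symm_def\<close>)
      then show ?thesis using Pw_Vw[OF Suc.prems, of m y "Suc 0" l j] by simp
    qed
    have "(\<Sum>r<n. ?d k r y * Wm n m y r b) =
      (\<Sum>r<n. \<Sum>l<k. (Pw n m l y a i * (Vw n m (k - 1 - l) y r j * Wm n m y r b) +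
         Vw n m l y a j * (Pw n m (k - 1 - l) y i r * Wm n m y r b)) / ?c)"
      by (intro sum.cong refl) (simp add: sum_divide_distrib sum_distrib_left sum_distrib_right algebra_simps add_divide_distrib)
    also have "\<dots> = (\<Sum>l<k. (Pw n m l y a i * (\<Sum>r<n. Vw n m (k - 1 - l) y r j * Wm n m y r b) +
         Vw n m l y a j * (\<Sum>r<n. Pw n m (k - 1 - l) y i r * Wm n m y r b)) / ?c)"
      by (subst sum.swap) (simp add: sum_divide_distrib sum_distrib_left sum.distrib add_divide_distrib)
    also have "\<dots> = (\<Sum>l<k. (Pw n m l y a i * Vw n m (Suc k - 1 - l) y b j +
         Vw n m l y a j * Pw n m (Suc k - 1 - l) y i b) / ?c)"
    proof (intro sum.cong refl)
      fix l assume "l \<in> {..<k}"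
      then have *: "Suc k - 1 - l = Suc (k - 1 - l)" by auto
      show "(Pw n m l y a i * (\<Sum>r<n. Vw n m (k - 1 - l) y r j * Wm n m y r b) +
         Vw n m l y a j * (\<Sum>r<n. Pw n m (k - 1 - l) y i r * Wm n m y r b)) / ?c =
         (Pw n m l y a i * Vw n m (Suc k - 1 - l) y b j + Vw n m l y a j * Pw n m (Suc k - 1 - l) y i b) / ?c"
        unfolding * V by simp
    qed
    finally have 1: "(\<Sum>r<n. ?d k r y * Wm n m y r b) = \<dots>" .
    have V0: "Vw n m 0 y b j = y (b, j)"
      using Suc.prems by (simp add: Vw_def if_distrib[of "\<lambda>z. z * _"] cong: if_cong)
    have "Pw n m k y a r * ?w r y = (if r = i then Pw n m k y a i * y (b, j) / ?c else 0)
        + (if b = i then Pw n m k y a r * y (r, j) / ?c else 0)" for r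
      by (auto simp: distrib_left add_divide_distrib)
    then have "(\<Sum>r<n. Pw n m k y a r * ?w r y) =
      (\<Sum>r<n. if r = i then Pw n m k y a i * y (b, j) / ?c else 0) + (\<Sum>r<n. if b = i then Pw n m k y a r * y (r, j) / ?c else 0)"
      by (simp only: sum.distrib)
    also have "\<dots> = (Pw n m k y a i * Vw n m 0 y b j + Vw n m k y a j * Pw n m 0 y i b) / ?c"
      using assms(3) by (auto simp: V0 Vw_def[of n m k] add_divide_distrib sum_divide_distrib)
    finally have 2: "(\<Sum>r<n. Pw n m k y a r * ?w r y) = \<dots>" .
    show "(\<Sum>r<n. ?d k r y * Wm n m y r b + Pw n m k y a r * ?w r y) = ?d (Suc k) b y"
      unfolding sum.distrib[of _ _ "{..<n}"] 1 2 by (simp add: sum_divide_distrib add_divide_distrib)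
  qed simp
qed

text \<open>Under the trace the position of the differentiated factor becomes irrelevant, so all
  \<open>2 k\<close> terms coincide.\<close>

lemma pder_trw:
  fixes n m :: nat
  assumes "i < n" "j < m"
  shows "pder ({..<n} \<times> {..<m}) (i, j) (trw n m k)
    (\<lambda>y. 2 * real k * Vw n m (k - 1) y i j / sqrt (real n * real m))"
proof -
  let ?I = "{..<n} \<times> {..<m}" and ?c = "sqrt (real n * real m)"
  have "pder ?I (i, j) (\<lambda>y. \<Sum>a<n. Pw n m k y a a)
    (\<lambda>y. \<Sum>a<n. (\<Sum>l<k. Pw n m l y a i * Vw n m (k - 1 - l) y a j + Vw n m l y a j * Pw n m (k - 1 - l) y i a) / ?c)"
    by (intro pder_sum pder_Pw) (use assms in auto)
  then show ?thesis
  proof (rule pder_cong)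
    fix y :: "nat \<times> nat \<Rightarrow> real"
    have "(\<Sum>a<n. (\<Sum>l<k. Pw n m l y a i * Vw n m (k - 1 - l) y a j + Vw n m l y a j * Pw n m (k - 1 - l) y i a) / ?c) =
      (\<Sum>a<n. \<Sum>l<k. (Pw n m l y i a * Vw n m (k - 1 - l) y a j + Pw n m (k - 1 - l) y i a * Vw n m l y a j) / ?c)"
      unfolding sum_divide_distrib
      by (intro sum.cong refl) (use assms in \<open>simp add: mpow_sym[OF symm_Wm, of _ n i m y] mult.commute\<close>)
    also have "\<dots> = (\<Sum>l<k. ((\<Sum>a<n. Pw n m l y i a * Vw n m (k - 1 - l) y a j) + (\<Sum>a<n. Pw n m (k - 1 - l) y i a * Vw n m l y a j)) / ?c)"
      by (subst sum.swap) (simp add: sum_divide_distrib sum.distrib add_divide_distrib)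
    also have "\<dots> = (\<Sum>l<k. 2 * Vw n m (k - 1) y i j / ?c)"
      unfolding Pw_Vw[OF assms(1)] by (intro sum.cong refl) auto
    finally show "(\<Sum>a<n. (\<Sum>l<k. Pw n m l y a i * Vw n m (k - 1 - l) y a j + Vw n m l y a j * Pw n m (k - 1 - l) y i a) / ?c) =
      2 * real k * Vw n m (k - 1) y i j / ?c" by simp
  qed (simp add: trw_def)
qed

text \<open>Three contributions with different fates after summing over \<open>i\<close> and
  \<open>j\<close>: the explicit \<open>Y\<close> gives \<open>m tr W\<^sup>k\<close>, the first
  part of the sum gives products of two traces, and the second part gives single traces, which are
  of lower order.\<close>

lemma pder_Vw:
  fixes n m :: nat
  assumes "i < n" "j < m"
  shows "pder ({..<n} \<times> {..<m}) (i, j) (\<lambda>y. Vw n m k y i j)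
    (\<lambda>y. Pw n m k y i i + (\<Sum>l<k. Pw n m l y i i * (\<Sum>r<n. y (r, j) * Vw n m (k - 1 - l) y r j)
        + Vw n m l y i j * Vw n m (k - 1 - l) y i j) / sqrt (real n * real m))"
proof -
  let ?I = "{..<n} \<times> {..<m}" and ?c = "sqrt (real n * real m)"
  have "pder ?I (i, j) (\<lambda>y. \<Sum>r<n. Pw n m k y i r * y (r, j))
    (\<lambda>y. \<Sum>r<n. (\<Sum>l<k. Pw n m l y i i * Vw n m (k - 1 - l) y r j + Vw n m l y i j * Pw n m (k - 1 - l) y i r) / ?c * y (r, j)
       + Pw n m k y i r * (if (r, j) = (i, j) then 1 else 0))"
    by (intro pder_sum pder_mult pder_Pw pder_coord) (use assms in auto)
  then show ?thesis
  proof (rule pder_cong)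
    fix y :: "nat \<times> nat \<Rightarrow> real"
    have 1: "(\<Sum>r<n. Pw n m k y i r * (if (r, j) = (i, j) then 1 else 0)) = Pw n m k y i i"
      using assms by (simp add: if_distrib[of "\<lambda>z. _ * z"] cong: if_cong)
    have "(\<Sum>r<n. (\<Sum>l<k. Pw n m l y i i * Vw n m (k - 1 - l) y r j + Vw n m l y i j * Pw n m (k - 1 - l) y i r) / ?c * y (r, j)) =
      (\<Sum>r<n. \<Sum>l<k. (Pw n m l y i i * (y (r, j) * Vw n m (k - 1 - l) y r j) + Vw n m l y i j * (Pw n m (k - 1 - l) y i r * y (r, j))) / ?c)"
      by (intro sum.cong refl) (simp add: sum_divide_distrib sum_distrib_left sum_distrib_right algebra_simps add_divide_distrib)
    also have "\<dots> = (\<Sum>l<k. (Pw n m l y i i * (\<Sum>r<n. y (r, j) * Vw n m (k - 1 - l) y r j)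
        + Vw n m l y i j * Vw n m (k - 1 - l) y i j) / ?c)"
      by (subst sum.swap) (simp add: Vw_def[of n m _ y i j] sum_divide_distrib sum_distrib_left sum.distrib add_divide_distrib)
    finally have 2: "(\<Sum>r<n. (\<Sum>l<k. Pw n m l y i i * Vw n m (k - 1 - l) y r j + Vw n m l y i j * Pw n m (k - 1 - l) y i r) / ?c * y (r, j)) = \<dots>" .
    show "(\<Sum>r<n. (\<Sum>l<k. Pw n m l y i i * Vw n m (k - 1 - l) y r j + Vw n m l y i j * Pw n m (k - 1 - l) y i r) / ?c * y (r, j)
       + Pw n m k y i r * (if (r, j) = (i, j) then 1 else 0)) =
       Pw n m k y i i + (\<Sum>l<k. Pw n m l y i i * (\<Sum>r<n. y (r, j) * Vw n m (k - 1 - l) y r j)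
        + Vw n m l y i j * Vw n m (k - 1 - l) y i j) / ?c"
      unfolding sum.distrib[of _ _ "{..<n}"] 1 2 by (simp only: sum_divide_distrib add.commute)
  qed (simp add: Vw_def)
qed

section \<open>Gaussian matrices and integration by parts under the trace\<close>

locale gaussian_matrix = std_gaussian_family M "{..<n} \<times> {..<m}" X
  for M :: "'a measure" and n m :: nat and X :: "nat \<times> nat \<Rightarrow> 'a \<Rightarrow> real" +
  assumes n_pos: "n > 0" and m_pos: "m > 0"
begin

abbreviation "II \<equiv> {..<n} \<times> {..<m}"

text \<open>Being a polynomial in the entries, expressed by having a formal derivative in one fixed
  coordinate. By \<open>pfunI\<close> any coordinate certifies it.\<close>

definition pfun :: "((nat \<times> nat \<Rightarrow> real) \<Rightarrow> real) \<Rightarrow> bool" where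
  "pfun f \<longleftrightarrow> (\<exists>f'. pder II (0, 0) f f')"

lemma pfunI: "pder II (i, j) f f' \<Longrightarrow> pfun f"
proof -
  assume "pder II (i, j) f f'"
  then have "\<exists>g. pder II (0, 0) f g"
  proof (induction rule: pder.induct)
    case (pder_const c)
    show ?case by (rule exI, rule pder.pder_const)
  next
    case (pder_add f f' g g')
    show ?case using pder_add.IH by (elim exE) (rule exI, erule (1) pder.pder_add)
  next
    case (pder_coord_mult q f f')
    show ?case using pder_coord_mult.IH
      by (elim exE) (rule exI, erule pder.pder_coord_mult[OF pder_coord_mult.hyps(1)])
  qed
  then show ?thesis by (simp add: pfun_def)
qed

lemma pfun_const: "pfun (\<lambda>_. c)"
  unfolding pfun_def by (rule exI, rule pder_const)

lemma pfun_add: "pfun f \<Longrightarrow> pfun g \<Longrightarrow> pfun (\<lambda>y. f y + g y)"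
  unfolding pfun_def by (elim exE) (rule exI, erule (1) pder_add)

lemma pfun_mult: "pfun f \<Longrightarrow> pfun g \<Longrightarrow> pfun (\<lambda>y. f y * g y)"
  unfolding pfun_def by (elim exE) (rule exI, erule (1) pder_mult)

lemma pfun_sum:
  assumes "\<And>s. s \<in> S \<Longrightarrow> pfun (f s)"
  shows "pfun (\<lambda>y. \<Sum>s\<in>S. f s y)"
proof -
  obtain g where "\<And>s. s \<in> S \<Longrightarrow> pder II (0, 0) (f s) (g s)"
    using assms unfolding pfun_def by metis
  then have "pder II (0, 0) (\<lambda>y. \<Sum>s\<in>S. f s y) (\<lambda>y. \<Sum>s\<in>S. g s y)" by (rule pder_sum)
  then show ?thesis unfolding pfun_def by - (rule exI, assumption)
qed

lemma pfun_integrable: "pfun f \<Longrightarrow> integrable M (\<lambda>w. f (pt w))"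
  unfolding pfun_def by (elim exE) (rule pder_integrable(1))

lemma E_add: "pfun f \<Longrightarrow> pfun g \<Longrightarrow> Exp (\<lambda>y. f y + g y) = Exp f + Exp g"
  unfolding Exp_def by (intro Bochner_Integration.integral_add pfun_integrable)

lemma E_sum: "(\<And>s. s \<in> S \<Longrightarrow> pfun (f s)) \<Longrightarrow> Exp (\<lambda>y. \<Sum>s\<in>S. f s y) = (\<Sum>s\<in>S. Exp (f s))"
  unfolding Exp_def by (intro Bochner_Integration.integral_sum pfun_integrable)

lemma Exp_double_sum:
  assumes "\<And>i j. i \<in> S \<Longrightarrow> j \<in> R \<Longrightarrow> integrable M (\<lambda>w. f i j (pt w))"
  shows "Exp (\<lambda>y. \<Sum>i\<in>S. \<Sum>j\<in>R. f i j y) = (\<Sum>i\<in>S. \<Sum>j\<in>R. Exp (f i j))"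
proof -
  have "Exp (\<lambda>y. \<Sum>i\<in>S. \<Sum>j\<in>R. f i j y) = (\<Sum>i\<in>S. Exp (\<lambda>y. \<Sum>j\<in>R. f i j y))"
    unfolding Exp_def by (rule Bochner_Integration.integral_sum) (intro Bochner_Integration.integrable_sum assms)
  also have "\<dots> = (\<Sum>i\<in>S. \<Sum>j\<in>R. Exp (f i j))"
    unfolding Exp_def by (intro sum.cong refl Bochner_Integration.integral_sum assms)
  finally show ?thesis .
qed

text \<open>Integration by parts in every coordinate of \<open>Y\<close> applied to \<open>tr (W\<^sup>k Y Y\<^sup>T) P\<close>.\<close>

lemma ibp_trace:
  assumes P: "\<And>i j. i < n \<Longrightarrow> j < m \<Longrightarrow> pder II (i, j) P (P' i j)"
  shows "Exp (\<lambda>y. Sw n m k y * P y) = Exp (\<lambda>y. (real m * trw n m k y +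
     (\<Sum>l<k. trw n m l y * Sw n m (k - 1 - l) y + Sw n m (k - 1) y) / sqrt (real n * real m)) * P y
     + (\<Sum>i<n. \<Sum>j<m. Vw n m k y i j * P' i j y))"
proof -
  let ?c = "sqrt (real n * real m)"
  let ?dV = "\<lambda>i j y. Pw n m k y i i + (\<Sum>l<k. Pw n m l y i i * (\<Sum>r<n. y (r, j) * Vw n m (k - 1 - l) y r j)
        + Vw n m l y i j * Vw n m (k - 1 - l) y i j) / ?c"
  let ?D = "\<lambda>i j y. ?dV i j y * P y + Vw n m k y i j * P' i j y"
  have pd: "pder II (i, j) (\<lambda>y. Vw n m k y i j * P y) (?D i j)" if "i < n" "j < m" for i j
    by (intro pder_mult pder_Vw P that)
  have intD: "integrable M (\<lambda>w. ?D i j (pt w))" if "i < n" "j < m" for i j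
    using pder_integrable(2)[OF pd[OF that]] .
  have intV: "integrable M (\<lambda>w. pt w (i, j) * (Vw n m k (pt w) i j * P (pt w)))" if "i < n" "j < m" for i j
    using pder_integrable(1)[OF pder_coord_mult[OF _ pd[OF that]]] that by simp
  have "Exp (\<lambda>y. Sw n m k y * P y) = Exp (\<lambda>y. \<Sum>i<n. \<Sum>j<m. y (i, j) * (Vw n m k y i j * P y))"
    by (simp add: Sw_def sum_distrib_right mult.assoc)
  also have "\<dots> = (\<Sum>i<n. \<Sum>j<m. Exp (\<lambda>y. y (i, j) * (Vw n m k y i j * P y)))"
    by (rule Exp_double_sum) (use intV in auto)
  also have "\<dots> = (\<Sum>i<n. \<Sum>j<m. Exp (?D i j))"
    by (intro sum.cong refl gaussian_ibp pd) auto
  also have "\<dots> = Exp (\<lambda>y. \<Sum>i<n. \<Sum>j<m. ?D i j y)"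
    by (rule Exp_double_sum[symmetric]) (use intD in auto)
  also have "(\<lambda>y. \<Sum>i<n. \<Sum>j<m. ?D i j y) = (\<lambda>y. (real m * trw n m k y +
     (\<Sum>l<k. trw n m l y * Sw n m (k - 1 - l) y + Sw n m (k - 1) y) / ?c) * P y
     + (\<Sum>i<n. \<Sum>j<m. Vw n m k y i j * P' i j y))"
  proof (rule ext)
    fix y :: "nat \<times> nat \<Rightarrow> real"
    have 1: "(\<Sum>i<n. \<Sum>j<m. Pw n m k y i i) = real m * trw n m k y"
      by (simp add: trw_def sum_distrib_left)
    have 2: "(\<Sum>i<n. \<Sum>j<m. Pw n m l y i i * (\<Sum>r<n. y (r, j) * Vw n m (k - 1 - l) y r j)) =
        trw n m l y * Sw n m (k - 1 - l) y" for l
    proof -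
      have "(\<Sum>i<n. \<Sum>j<m. Pw n m l y i i * (\<Sum>r<n. y (r, j) * Vw n m (k - 1 - l) y r j)) =
        (\<Sum>i<n. Pw n m l y i i * (\<Sum>j<m. \<Sum>r<n. y (r, j) * Vw n m (k - 1 - l) y r j))"
        by (simp add: sum_distrib_left)
      also have "(\<Sum>j<m. \<Sum>r<n. y (r, j) * Vw n m (k - 1 - l) y r j) = Sw n m (k - 1 - l) y"
        unfolding Sw_def by (rule sum.swap)
      finally show ?thesis by (simp add: trw_def sum_distrib_right)
    qed
    have "(\<Sum>i<n. \<Sum>j<m. ?dV i j y) = real m * trw n m k y + (\<Sum>i<n. \<Sum>j<m. \<Sum>l<k.
        Pw n m l y i i * (\<Sum>r<n. y (r, j) * Vw n m (k - 1 - l) y r j) + Vw n m l y i j * Vw n m (k - 1 - l) y i j) / ?c"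
      unfolding sum.distrib[of _ _ "{..<m}"] sum.distrib[of _ _ "{..<n}"] 1 by (simp add: sum_divide_distrib)
    also have "(\<Sum>i<n. \<Sum>j<m. \<Sum>l<k.
        Pw n m l y i i * (\<Sum>r<n. y (r, j) * Vw n m (k - 1 - l) y r j) + Vw n m l y i j * Vw n m (k - 1 - l) y i j) =
      (\<Sum>l<k. \<Sum>i<n. \<Sum>j<m. Pw n m l y i i * (\<Sum>r<n. y (r, j) * Vw n m (k - 1 - l) y r j) + Vw n m l y i j * Vw n m (k - 1 - l) y i j)"
      by (subst sum.swap[of _ "{..<k}"], subst sum.swap[of _ "{..<k}"]) (rule refl)
    also have "\<dots> = (\<Sum>l<k. trw n m l y * Sw n m (k - 1 - l) y + Sw n m (k - 1) y)"
      unfolding sum.distrib[of _ _ "{..<m}"] sum.distrib[of _ _ "{..<n}"] 2 Vw_Vw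
      by (intro sum.cong refl) auto
    finally show "(\<Sum>i<n. \<Sum>j<m. ?D i j y) = (real m * trw n m k y +
     (\<Sum>l<k. trw n m l y * Sw n m (k - 1 - l) y + Sw n m (k - 1) y) / ?c) * P y
     + (\<Sum>i<n. \<Sum>j<m. Vw n m k y i j * P' i j y)"
      unfolding sum.distrib[of _ _ "{..<m}"] sum.distrib[of _ _ "{..<n}"] sum_distrib_right[symmetric]
      by (simp only: )
  qed
  finally show ?thesis .
qed

end

subsection \<open>Asymptotics of the loop equations\<close>

text \<open>\<open>e L\<close> stands for the expectation of the product of the normalised traces \<open>T k\<close>, \<open>k\<close> in \<open>L\<close>;
  \<open>covterm\<close> collects the terms in which the derivative hits the other factors.\<close>

primrec covterm :: "real \<Rightarrow> real \<Rightarrow> (nat list \<Rightarrow> real) \<Rightarrow> nat \<Rightarrow> nat list \<Rightarrow> nat list \<Rightarrow> real" where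
  "covterm N eta e k R [] = 0"
| "covterm N eta e k R (q # Q) =
     2 * real q / N\<^sup>2 * (e ((k + q - 1) # R @ Q) + eta * e ((k + q) # R @ Q)) + covterm N eta e k (q # R) Q"

text \<open>Detached from probability: all later bounds follow from these equations alone, uniformly
  in the triple. The \<open>1 / N\<close> term stands inside the sum over \<open>l\<close>, so it
  occurs \<open>k\<close> times and the truncated \<open>k - 1\<close> at \<open>k = 0\<close> is
  never evaluated.\<close>

definition loop_systems :: "(real \<times> real \<times> (nat list \<Rightarrow> real)) set" where
  "loop_systems = {(N, eta, e). N \<ge> 1 \<and> 0 \<le> eta \<and> eta \<le> 1 \<and> e [] = 1 \<and> (\<forall>Q. e (0 # Q) = e Q) \<and>
     (\<forall>k Q. e (Suc k # Q) = (\<Sum>l<k. e (l # (k - 1 - l) # Q) + eta * e (l # (k - l) # Q)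
        + 1 / N * (e ((k - 1) # Q) + eta * e (k # Q))) + covterm N eta e k [] Q)}"

text \<open>\<open>h = O(1 / N ^ j)\<close> with one constant for all loop systems, hence for all
  matrix sizes.\<close>

definition bo :: "nat \<Rightarrow> (real \<times> real \<times> (nat list \<Rightarrow> real) \<Rightarrow> real) \<Rightarrow> bool" where
  "bo j h \<longleftrightarrow> (\<exists>C. \<forall>s\<in>loop_systems. \<bar>h s\<bar> \<le> C / fst s ^ j)"

lemma loop_systems_fst: "s \<in> loop_systems \<Longrightarrow> 1 \<le> fst s"
  by (auto simp: loop_systems_def)

lemma bo_bound:
  assumes "bo j h" shows "\<exists>C\<ge>0. \<forall>s\<in>loop_systems. \<bar>h s\<bar> \<le> C / fst s ^ j"
proof -
  obtain C where C: "\<And>s. s \<in> loop_systems \<Longrightarrow> \<bar>h s\<bar> \<le> C / fst s ^ j"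
    using assms unfolding bo_def by blast
  have "\<bar>h s\<bar> \<le> \<bar>C\<bar> / fst s ^ j" if "s \<in> loop_systems" for s
  proof -
    have "C / fst s ^ j \<le> \<bar>C\<bar> / fst s ^ j"
      using loop_systems_fst[OF that] by (intro divide_right_mono) auto
    then show ?thesis using C[OF that] by simp
  qed
  then show ?thesis by (intro exI[of _ "\<bar>C\<bar>"]) simp
qed

lemma bo_add: assumes "bo j f" "bo j g" shows "bo j (\<lambda>s. f s + g s)"
proof -
  obtain C D where C: "\<And>s. s \<in> loop_systems \<Longrightarrow> \<bar>f s\<bar> \<le> C / fst s ^ j"
    and D: "\<And>s. s \<in> loop_systems \<Longrightarrow> \<bar>g s\<bar> \<le> D / fst s ^ j"
    using bo_bound[OF assms(1)] bo_bound[OF assms(2)] by blast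
  have "\<bar>f s + g s\<bar> \<le> (C + D) / fst s ^ j" if "s \<in> loop_systems" for s
    using C[OF that] D[OF that] by (simp add: add_divide_distrib)
  then show ?thesis unfolding bo_def by blast
qed

lemma bo_mult: assumes "bo i f" "bo j g" shows "bo (i + j) (\<lambda>s. f s * g s)"
proof -
  obtain C D where C: "\<And>s. s \<in> loop_systems \<Longrightarrow> \<bar>f s\<bar> \<le> C / fst s ^ i"
    and D: "\<And>s. s \<in> loop_systems \<Longrightarrow> \<bar>g s\<bar> \<le> D / fst s ^ j"
    using bo_bound[OF assms(1)] bo_bound[OF assms(2)] by blast
  have "\<bar>f s * g s\<bar> \<le> (C * D) / fst s ^ (i + j)" if "s \<in> loop_systems" for s
  proof -
    have "\<bar>f s\<bar> * \<bar>g s\<bar> \<le> (C / fst s ^ i) * (D / fst s ^ j)"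
      using C[OF that] D[OF that] order_trans[OF abs_ge_zero C[OF that]] by (intro mult_mono) auto
    then show ?thesis by (simp add: abs_mult power_add)
  qed
  then show ?thesis unfolding bo_def by blast
qed

lemma bo_const: "bo 0 (\<lambda>_. c)"
  unfolding bo_def by auto

lemma bo_zero: "bo j (\<lambda>_. 0)"
  unfolding bo_def by (intro exI[of _ 0]) auto

lemma bo_mult0: "bo 0 f \<Longrightarrow> bo j g \<Longrightarrow> bo j (\<lambda>s. f s * g s)"
  using bo_mult[of 0 f j g] by simp

lemma bo_mult0r: "bo j f \<Longrightarrow> bo 0 g \<Longrightarrow> bo j (\<lambda>s. f s * g s)"
  using bo_mult[of j f 0 g] by simp

lemma bo_minus: "bo j f \<Longrightarrow> bo j (\<lambda>s. - f s)"
  using bo_mult0[OF bo_const[of "-1"]] by simp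

lemma bo_diff: "bo j f \<Longrightarrow> bo j g \<Longrightarrow> bo j (\<lambda>s. f s - g s)"
  using bo_add[OF _ bo_minus] by simp

lemma bo_sum: "finite S \<Longrightarrow> (\<And>x. x \<in> S \<Longrightarrow> bo j (f x)) \<Longrightarrow> bo j (\<lambda>s. \<Sum>x\<in>S. f x s)"
proof (induction S rule: finite_induct)
  case empty then show ?case by (simp add: bo_zero)
next
  case (insert x F)
  have "bo j (\<lambda>s. f x s + (\<Sum>x\<in>F. f x s))" using insert by (intro bo_add) auto
  then show ?case using insert by simp
qed

lemma bo_cong: "bo j f \<Longrightarrow> (\<And>s. s \<in> loop_systems \<Longrightarrow> f s = g s) \<Longrightarrow> bo j g"
  unfolding bo_def by simp

lemma bo_weaken: assumes "bo j f" "i \<le> j" shows "bo i f"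
proof -
  obtain C where C: "C \<ge> 0" "\<And>s. s \<in> loop_systems \<Longrightarrow> \<bar>f s\<bar> \<le> C / fst s ^ j"
    using bo_bound[OF assms(1)] by blast
  have "\<bar>f s\<bar> \<le> C / fst s ^ i" if "s \<in> loop_systems" for s
  proof -
    have "C / fst s ^ j \<le> C / fst s ^ i"
      using loop_systems_fst[OF that] C(1) assms(2)
      by (intro divide_left_mono power_increasing mult_pos_pos zero_less_power) auto
    then show ?thesis using C(2)[OF that] by simp
  qed
  then show ?thesis unfolding bo_def by blast
qed

lemma bo_inv: "bo j (\<lambda>s. 1 / fst s ^ j)"
  unfolding bo_def
proof (intro exI[of _ 1] ballI)
  fix s assume "s \<in> loop_systems"
  then have "1 \<le> fst s" by (rule loop_systems_fst)
  then show "\<bar>1 / fst s ^ j\<bar> \<le> 1 / fst s ^ j" by simp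
qed

abbreviation et :: "real \<times> real \<times> (nat list \<Rightarrow> real) \<Rightarrow> real" where "et s \<equiv> fst (snd s)"
abbreviation em :: "nat list \<Rightarrow> real \<times> real \<times> (nat list \<Rightarrow> real) \<Rightarrow> real" where "em L s \<equiv> snd (snd s) L"
abbreviation cvt :: "nat \<Rightarrow> nat list \<Rightarrow> nat list \<Rightarrow> real \<times> real \<times> (nat list \<Rightarrow> real) \<Rightarrow> real" where
  "cvt k R Q s \<equiv> covterm (fst s) (et s) (snd (snd s)) k R Q"

lemma bo_et: "bo 0 et"
  unfolding bo_def by (intro exI[of _ 1]) (auto simp: loop_systems_def)

lemma loop_systemsD:
  assumes "s \<in> loop_systems"
  shows "em [] s = 1" "em (0 # Q) s = em Q s"
    "em (Suc k # Q) s = (\<Sum>l<k. em (l # (k - 1 - l) # Q) s + et s * em (l # (k - l) # Q) s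
        + 1 / fst s ^ 1 * (em ((k - 1) # Q) s + et s * em (k # Q) s)) + cvt k [] Q s"
  using assms by (auto simp: loop_systems_def)

text \<open>The induction measure. Passing from \<open>Suc k # Q\<close> to
  \<open>l # (k - l) # Q\<close> lowers the sum by one but lengthens the list by one, so the sum has
  to count twice.\<close>

definition wt :: "nat list \<Rightarrow> nat" where "wt L = 2 * sum_list L + length L"

lemma wt_simps [simp]: "wt [] = 0" "wt (k # L) = 2 * k + 1 + wt L" "wt (L @ L') = wt L + wt L'"
  by (auto simp: wt_def)

lemma bo_cvt:
  assumes "\<And>L. wt L < 2 * k + 3 + wt R + wt Q \<Longrightarrow> bo 0 (em L)"
  shows "bo 2 (cvt k R Q)"
  using assms
proof (induction Q arbitrary: R)
  case Nil
  then show ?case by (simp add: bo_zero)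
next
  case (Cons q Q)
  have IH: "bo 2 (cvt k (q # R) Q)" by (rule Cons.IH) (use Cons.prems in auto)
  have "bo 2 (\<lambda>s. 2 * real q * (1 / fst s ^ 2 * (em ((k + q - 1) # R @ Q) s + et s * em ((k + q) # R @ Q) s)))"
    by (intro bo_mult0[OF bo_const] bo_mult0r[OF bo_inv] bo_add bo_mult0[OF bo_et] Cons.prems) auto
  from bo_add[OF this IH] show ?case by (rule bo_cong) simp
qed

text \<open>A loop equation expresses each moment through moments of smaller weight with bounded
  coefficients, so boundedness propagates by induction on \<open>wt\<close>.\<close>

lemma bo_em: "bo 0 (em L)"
proof (induction "wt L" arbitrary: L rule: less_induct)
  case less
  show ?case
  proof (cases L)
    case Nil
    show ?thesis by (rule bo_cong[OF bo_const[of 1]]) (simp add: Nil loop_systemsD)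
  next
    case (Cons k Q)
    show ?thesis
    proof (cases k)
      case 0
      have "bo 0 (em Q)" by (rule less) (simp add: Cons)
      then show ?thesis by (rule bo_cong) (simp add: Cons 0 loop_systemsD)
    next
      case (Suc k')
      have cv: "bo 0 (cvt k' [] Q)"
        by (rule bo_weaken[OF bo_cvt]) (auto intro!: less simp: Cons Suc)
      have inv: "bo 0 (\<lambda>s. 1 / fst s ^ 1)" by (rule bo_weaken[OF bo_inv]) simp
      have "bo 0 (\<lambda>s. (\<Sum>l<k'. em (l # (k' - 1 - l) # Q) s + et s * em (l # (k' - l) # Q) s
        + 1 / fst s ^ 1 * (em ((k' - 1) # Q) s + et s * em (k' # Q) s)) + cvt k' [] Q s)"
        by (intro bo_add bo_sum bo_mult0 bo_et inv cv less) (auto simp: Cons Suc)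
      then show ?thesis unfolding Cons Suc by (rule bo_cong) (simp add: loop_systemsD(3))
    qed
  qed
qed

definition fact_em :: "nat list \<Rightarrow> real \<times> real \<times> (nat list \<Rightarrow> real) \<Rightarrow> real" where
  "fact_em L s = prod_list (map (\<lambda>k. em [k] s) L)"

lemma fact_em_simps [simp]: "fact_em [] s = 1" "fact_em (k # L) s = em [k] s * fact_em L s"
  "fact_em (L @ L') s = fact_em L s * fact_em L' s"
  by (auto simp: fact_em_def)

lemma bo_fact_em: "bo 0 (fact_em L)"
proof (induction L)
  case Nil show ?case by (rule bo_cong[OF bo_const[of 1]]) simp
next
  case (Cons k L)
  from bo_mult0[OF bo_em[of "[k]"] Cons] show ?case by (rule bo_cong) simp
qed

text \<open>The loop equation for \<open>[Suc k']\<close>, multiplied by \<open>em Q\<close>, is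
  subtracted from the one for \<open>Suc k' # Q\<close>. Each term under the sum becomes a
  difference of the same kind at smaller weight; what remains is \<open>covterm\<close>, which
  carries an explicit \<open>1 / N\<^sup>2\<close>.\<close>

lemma bo_factorization: "bo 2 (\<lambda>s. em L s - fact_em L s)"
proof (induction "wt L" arbitrary: L rule: less_induct)
  case less
  show ?case
  proof (cases L)
    case Nil
    show ?thesis by (rule bo_cong[OF bo_zero]) (simp add: Nil loop_systemsD)
  next
    case (Cons k Q)
    have Q: "bo 2 (\<lambda>s. em Q s - fact_em Q s)" by (rule less) (simp add: Cons)
    show ?thesis
    proof (cases k)
      case 0
      show ?thesis by (rule bo_cong[OF Q]) (simp add: Cons 0 loop_systemsD)
    next
      case (Suc k')
      \<comment> \<open>Splitting off \<open>Q\<close> follows from the factorisations of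
        \<open>X @ Q\<close>, \<open>X\<close> and \<open>Q\<close>, all of smaller weight than
        \<open>L\<close>.\<close>
      have split: "bo 2 (\<lambda>s. em (X @ Q) s - em X s * em Q s)" if "wt (X @ Q) < wt L" for X
      proof -
        have "bo 2 (\<lambda>s. (em (X @ Q) s - fact_em (X @ Q) s) - (em X s - fact_em X s) * em Q s
            - fact_em X s * (em Q s - fact_em Q s))"
          by (intro bo_diff bo_mult0r[OF _ bo_em] bo_mult0[OF bo_fact_em] Q less) (use that in auto)
        then show ?thesis by (rule bo_cong) (simp add: algebra_simps)
      qed
      have cv: "bo 2 (cvt k' [] Q)" by (rule bo_cvt) (rule bo_em)
      have inv: "bo 0 (\<lambda>s. 1 / fst s ^ 1)" by (rule bo_weaken[OF bo_inv]) simp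
      have A: "bo 2 (\<lambda>s. (\<Sum>l<k'. (em ([l, k' - 1 - l] @ Q) s - em [l, k' - 1 - l] s * em Q s)
          + et s * (em ([l, k' - l] @ Q) s - em [l, k' - l] s * em Q s)
          + 1 / fst s ^ 1 * ((em ([k' - 1] @ Q) s - em [k' - 1] s * em Q s) + et s * (em ([k'] @ Q) s - em [k'] s * em Q s)))
          + cvt k' [] Q s)"
        by (intro bo_add bo_sum bo_mult0 bo_et inv cv split) (auto simp: Cons Suc)
      have "bo 2 (\<lambda>s. em (Suc k' # Q) s - em [Suc k'] s * em Q s)"
      proof (rule bo_cong[OF A])
        fix s assume s: "s \<in> loop_systems"
        have aux: "((\<Sum>l<k'. A l) + c) - ((\<Sum>l<k'. B l) + 0) * q = (\<Sum>l<k'. A l - B l * q) + c"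
          for A B :: "nat \<Rightarrow> real" and c q
          by (simp add: sum_subtractf sum_distrib_right)
        show "(\<Sum>l<k'. (em ([l, k' - 1 - l] @ Q) s - em [l, k' - 1 - l] s * em Q s)
          + et s * (em ([l, k' - l] @ Q) s - em [l, k' - l] s * em Q s)
          + 1 / fst s ^ 1 * ((em ([k' - 1] @ Q) s - em [k' - 1] s * em Q s) + et s * (em ([k'] @ Q) s - em [k'] s * em Q s)))
          + cvt k' [] Q s = em (Suc k' # Q) s - em [Suc k'] s * em Q s"
          unfolding loop_systemsD(3)[OF s] covterm.simps(1) aux
          by (intro arg_cong2[of _ _ _ _ "(+)"] sum.cong refl) (simp add: algebra_simps)
      qed
      from bo_add[OF this bo_mult0[OF bo_em[of "[Suc k']"] Q]]
      show ?thesis unfolding Cons Suc by (rule bo_cong) (simp add: algebra_simps)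
    qed
  qed
qed

lemma bo_tendsto_0:
  assumes "bo j h" "j > 0" and S: "\<And>i. S i \<in> loop_systems" and N: "filterlim (\<lambda>i. fst (S i)) at_top sequentially"
  shows "(\<lambda>i. h (S i)) \<longlonglongrightarrow> 0"
proof -
  have "bo 1 h" using assms(1,2) by (intro bo_weaken[of j h 1]) auto
  then obtain C where C: "\<And>s. s \<in> loop_systems \<Longrightarrow> \<bar>h s\<bar> \<le> C / fst s ^ 1"
    using bo_bound by blast
  show ?thesis
  proof (rule Lim_null_comparison)
    show "\<forall>\<^sub>F i in sequentially. norm (h (S i)) \<le> C / fst (S i)" using C[OF S] by simp
    show "(\<lambda>i. C / fst (S i)) \<longlonglongrightarrow> 0"
      using N by (intro tendsto_divide_0[OF tendsto_const] filterlim_at_top_imp_at_infinity)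
  qed
qed

text \<open>Terms with a factor \<open>eta\<close> or \<open>1 / N\<close> vanish since moments are
  bounded, and factorisation turns each pair moment into a product. What survives is the recursion
  of \<open>cat\<close>.\<close>

theorem loop_systems_mean_limit:
  assumes S: "\<And>i. S i \<in> loop_systems" and N: "filterlim (\<lambda>i. fst (S i)) at_top sequentially"
    and eta: "(\<lambda>i. et (S i)) \<longlonglongrightarrow> 0"
  shows "(\<lambda>i. em [k] (S i)) \<longlonglongrightarrow> cat k"
proof (induction k rule: less_induct)
  case (less k)
  show ?case
  proof (cases k)
    case 0
    then show ?thesis by (simp add: loop_systemsD[OF S])
  next
    case (Suc k')
    have bounded: "(\<lambda>i. f i * em L (S i)) \<longlonglongrightarrow> 0" if "f \<longlonglongrightarrow> 0" for f L
    proof -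
      obtain C where C: "\<And>s. s \<in> loop_systems \<Longrightarrow> \<bar>em L s\<bar> \<le> C / fst s ^ 0" using bo_bound[OF bo_em[of L]] by blast
      show ?thesis
        by (rule Lim_null_comparison[of _ "\<lambda>i. \<bar>f i\<bar> * C"], rule always_eventually) (use C[OF S] that in \<open>auto simp: abs_mult intro!: mult_left_mono tendsto_mult_left_zero tendsto_rabs_zero\<close>)
    qed
    have inv: "(\<lambda>i. 1 / fst (S i)) \<longlonglongrightarrow> 0"
      using N by (intro tendsto_divide_0[OF tendsto_const] filterlim_at_top_imp_at_infinity)
    have pair: "(\<lambda>i. em [l, k' - 1 - l] (S i)) \<longlonglongrightarrow> cat l * cat (k' - 1 - l)" if "l < k'" for l
    proof -
      have "(\<lambda>i. (em [l, k' - 1 - l] (S i) - fact_em [l, k' - 1 - l] (S i)) + em [l] (S i) * em [k' - 1 - l] (S i))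
          \<longlonglongrightarrow> 0 + cat l * cat (k' - 1 - l)"
        by (intro tendsto_add tendsto_mult less bo_tendsto_0[OF bo_factorization _ S N]) (use that Suc in auto)
      then show ?thesis by simp
    qed
    have "(\<lambda>i. (\<Sum>l<k'. em [l, k' - 1 - l] (S i) + et (S i) * em [l, k' - l] (S i)
        + (1 / fst (S i) * em [k' - 1] (S i) + (1 / fst (S i) * et (S i)) * em [k'] (S i))))
        \<longlonglongrightarrow> (\<Sum>l<k'. cat l * cat (k' - 1 - l) + 0 + (0 + 0))"
      using tendsto_mult_zero[OF inv eta]
      by (intro tendsto_sum tendsto_add pair bounded inv eta) auto
    then show ?thesis
      by (simp add: Suc loop_systemsD(3)[OF S] cat.simps(2) algebra_simps)
  qed
qed

subsection \<open>The loop equations\<close>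

definition Tm :: "nat \<Rightarrow> nat \<Rightarrow> nat \<Rightarrow> (nat \<times> nat \<Rightarrow> real) \<Rightarrow> real" where
  "Tm n m k y = trw n m k y / real n"

definition Tprod :: "nat \<Rightarrow> nat \<Rightarrow> nat list \<Rightarrow> (nat \<times> nat \<Rightarrow> real) \<Rightarrow> real" where
  "Tprod n m Q y = prod_list (map (\<lambda>k. Tm n m k y) Q)"

lemma Tprod_simps [simp]: "Tprod n m [] y = 1" "Tprod n m (q # Q) y = Tm n m q y * Tprod n m Q y"
  "Tprod n m (Q @ R) y = Tprod n m Q y * Tprod n m R y"
  by (simp_all add: Tprod_def)

definition eta :: "nat \<Rightarrow> nat \<Rightarrow> real" where "eta n m = real n / sqrt (real n * real m)"

text \<open>The partial derivative of \<open>Tprod\<close> in the entry \<open>(i, j)\<close>, by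
  the product rule along the list.\<close>

primrec Tprod_deriv :: "nat \<Rightarrow> nat \<Rightarrow> nat \<Rightarrow> nat \<Rightarrow> nat list \<Rightarrow> (nat \<times> nat \<Rightarrow> real) \<Rightarrow> real" where
  "Tprod_deriv n m i j [] y = 0"
| "Tprod_deriv n m i j (q # Q) y =
     (2 * real q * Vw n m (q - 1) y i j / sqrt (real n * real m)) / real n * Tprod n m Q y + Tm n m q y * Tprod_deriv n m i j Q y"

text \<open>The gradient of \<open>Tprod\<close> contracted with \<open>W\<^sup>k Y\<close> over all
  entries and divided by \<open>c0 * n\<close>; its expectation is \<open>covterm\<close>.\<close>

primrec Gt :: "nat \<Rightarrow> nat \<Rightarrow> nat \<Rightarrow> nat list \<Rightarrow> (nat \<times> nat \<Rightarrow> real) \<Rightarrow> real" where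
  "Gt n m k [] y = 0"
| "Gt n m k (q # Q) y =
     2 * real q / (real n)\<^sup>2 * (Tm n m (k + q - 1) y + eta n m * Tm n m (k + q) y) * Tprod n m Q y + Tm n m q y * Gt n m k Q y"

definition mean_tr :: "'a measure \<Rightarrow> nat \<Rightarrow> nat \<Rightarrow> (nat \<times> nat \<Rightarrow> 'a \<Rightarrow> real) \<Rightarrow> nat list \<Rightarrow> real" where
  "mean_tr M n m X Q = (\<integral>w. Tprod n m Q (\<lambda>p. X p w) \<partial>M)"

context gaussian_matrix
begin

abbreviation "c0 \<equiv> sqrt (real n * real m)"

lemma c0: "c0 > 0" "c0 * c0 = real n * real m"
  using n_pos m_pos by auto

lemma mean_tr_eq: "mean_tr M n m X Q = Exp (Tprod n m Q)"
  by (simp add: mean_tr_def Exp_def pt_def)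

lemma Tm_0: "Tm n m 0 y = 1"
  using n_pos by (simp add: Tm_def trw_def)

lemma trw_Tm: "trw n m k y = real n * Tm n m k y"
  using n_pos by (simp add: Tm_def)

lemma Sw_Tm: "Sw n m k y = c0 * real n * Tm n m (Suc k) y + real m * real n * Tm n m k y"
  by (simp add: Sw_eq[OF n_pos m_pos] trw_Tm)

lemma pder_Tm:
  assumes "i < n" "j < m"
  shows "pder II (i, j) (Tm n m k) (\<lambda>y. (2 * real k * Vw n m (k - 1) y i j / c0) / real n)"
  by (rule pder_cong[OF pder_cmult[OF pder_trw[OF assms, of k], of "1 / real n"]]) (simp_all add: Tm_def)

lemma pder_Tprod:
  assumes "i < n" "j < m"
  shows "pder II (i, j) (Tprod n m Q) (Tprod_deriv n m i j Q)"
proof (induction Q)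
  case Nil
  show ?case by (rule pder_cong[OF pder_const[of _ _ 1]]) simp_all
next
  case (Cons q Q)
  show ?case by (rule pder_cong[OF pder_mult[OF pder_Tm[OF assms, of q] Cons]]) simp_all
qed

lemma pfun_Tprod: "pfun (Tprod n m Q)"
  using pder_Tprod[OF n_pos m_pos] by (rule pfunI)

lemma pfun_Tm: "pfun (Tm n m k)"
  using pder_Tm[OF n_pos m_pos] by (rule pfunI)

lemma pfun_Gt: "pfun (Gt n m k Q)"
proof (induction Q)
  case Nil
  show ?case using pfun_const[of 0] by simp
next
  case (Cons q Q)
  show ?case unfolding Gt.simps(2)
    by (intro pfun_add pfun_mult pfun_const pfun_Tm pfun_Tprod Cons)
qed

text \<open>The source of the factor \<open>1 / n\<^sup>2\<close>: contracting two matrices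
  \<open>W\<^sup>k Y\<close> and \<open>W\<^sup>q\<^sup>-\<^sup>1 Y\<close> gives a single trace
  \<open>Sw\<close>, of size \<open>m n\<close>, while the normalisations divide by
  \<open>(c0 n)\<^sup>2 = m n\<^sup>3\<close>.\<close>

lemma sum_Vw_Tprod_deriv:
  "(\<Sum>i<n. \<Sum>j<m. Vw n m k y i j * Tprod_deriv n m i j Q y) = c0 * real n * Gt n m k Q y"
proof (induction Q)
  case (Cons q Q)
  have "(\<Sum>i<n. \<Sum>j<m. Vw n m k y i j * Tprod_deriv n m i j (q # Q) y) =
     (\<Sum>i<n. \<Sum>j<m. 2 * real q / (c0 * real n) * Tprod n m Q y * (Vw n m k y i j * Vw n m (q - 1) y i j)
        + Tm n m q y * (Vw n m k y i j * Tprod_deriv n m i j Q y))"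
    by (intro sum.cong refl) (simp add: algebra_simps)
  also have "\<dots> = 2 * real q / (c0 * real n) * Tprod n m Q y * Sw n m (k + (q - 1)) y
     + Tm n m q y * (c0 * real n * Gt n m k Q y)"
    by (simp only: sum.distrib sum_distrib_left[symmetric] Vw_Vw Cons)
  also have "2 * real q / (c0 * real n) * Tprod n m Q y * Sw n m (k + (q - 1)) y =
     c0 * real n * (2 * real q / (real n)\<^sup>2 * (Tm n m (k + q - 1) y + eta n m * Tm n m (k + q) y) * Tprod n m Q y)"
  proof (cases q)
    case (Suc q')
    have N: "real n > 0" using n_pos by simp
    have M: "real m = c0 * c0 / real n" using c0 N by (simp add: field_simps)
    have id: "2 * Q / (c * N) * P * (c * N * x + (c * c / N) * N * z) = c * N * (2 * Q / N\<^sup>2 * (z + N / c * x) * P)"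
      if "c > 0" "N > 0" for c N P x z Q :: real
      using that by (simp add: field_simps power2_eq_square)
    show ?thesis
      unfolding Sw_Tm eta_def using id[OF c0(1) N, of "real q" "Tprod n m Q y" "Tm n m (k + q) y" "Tm n m (k + q - 1) y"]
      by (simp only: M[symmetric]) (simp add: Suc)
  qed simp
  finally show ?case by (simp add: algebra_simps)
qed simp

text \<open>\<open>R\<close> accumulates the factors already passed over, because
  \<open>covterm\<close> needs the expectation of the whole product and not a product of
  expectations.\<close>

lemma covterm_mean_tr:
  "covterm (real n) (eta n m) (mean_tr M n m X) k R Q = Exp (\<lambda>y. Tprod n m R y * Gt n m k Q y)"
proof (induction Q arbitrary: R)
  case Nil
  then show ?case by (simp add: Exp_def)
next
  case (Cons q Q)
  let ?c = "2 * real q / (real n)\<^sup>2"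
  have "Exp (\<lambda>y. Tprod n m R y * Gt n m k (q # Q) y) =
    Exp (\<lambda>y. ?c * (Tprod n m ((k + q - 1) # R @ Q) y + eta n m * Tprod n m ((k + q) # R @ Q) y)
       + Tprod n m (q # R) y * Gt n m k Q y)"
    by (simp add: algebra_simps)
  also have "\<dots> = ?c * (Exp (Tprod n m ((k + q - 1) # R @ Q)) + eta n m * Exp (Tprod n m ((k + q) # R @ Q)))
       + Exp (\<lambda>y. Tprod n m (q # R) y * Gt n m k Q y)"
    by (subst E_add, intro pfun_add pfun_mult pfun_const pfun_Tprod, intro pfun_mult pfun_Tprod pfun_Gt,
        subst Exp_cmult, subst E_add, rule pfun_Tprod, intro pfun_mult pfun_const pfun_Tprod,
        subst Exp_cmult, rule refl)
  finally show ?case unfolding covterm.simps Cons by (simp only: mean_tr_eq)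
qed

text \<open>Both sides of the integration by parts contain \<open>m n E (T k ...)\<close>: on the
  left from the centring in \<open>Sw_eq\<close>, on the right from differentiating the explicit
  \<open>Y\<close>. After cancellation the rest is divided by \<open>c0 n\<close>.\<close>

theorem loop_equation:
  "mean_tr M n m X (Suc k # Q) = (\<Sum>l<k. mean_tr M n m X (l # (k - 1 - l) # Q) + eta n m * mean_tr M n m X (l # (k - l) # Q)
        + 1 / real n * (mean_tr M n m X ((k - 1) # Q) + eta n m * mean_tr M n m X (k # Q)))
     + covterm (real n) (eta n m) (mean_tr M n m X) k [] Q"
proof -
  let ?T = "Tprod n m"
  let ?g = "\<lambda>l y. ?T (l # (k - 1 - l) # Q) y + eta n m * ?T (l # (k - l) # Q) y
        + 1 / real n * (?T ((k - 1) # Q) y + eta n m * ?T (k # Q) y)"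
  let ?Z = "\<lambda>y. (\<Sum>l<k. ?g l y) + Gt n m k Q y"
  have N: "real n > 0" using n_pos by simp
  have M: "real m = c0 * c0 / real n" using c0 N by (simp add: field_simps)
  have pg: "pfun (?g l)" for l
    by (intro pfun_add pfun_mult pfun_const pfun_Tprod)
  have pZ: "pfun ?Z" by (intro pfun_add pfun_sum pg pfun_Gt)
  have "Exp (\<lambda>y. c0 * real n * ?T (Suc k # Q) y + real m * real n * ?T (k # Q) y) = Exp (\<lambda>y. Sw n m k y * ?T Q y)"
    by (simp add: Sw_Tm algebra_simps)
  also have "\<dots> = Exp (\<lambda>y. (real m * trw n m k y +
     (\<Sum>l<k. trw n m l y * Sw n m (k - 1 - l) y + Sw n m (k - 1) y) / c0) * ?T Q y
     + (\<Sum>i<n. \<Sum>j<m. Vw n m k y i j * Tprod_deriv n m i j Q y))"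
    by (rule ibp_trace) (rule pder_Tprod)
  also have "(\<lambda>y. (real m * trw n m k y +
     (\<Sum>l<k. trw n m l y * Sw n m (k - 1 - l) y + Sw n m (k - 1) y) / c0) * ?T Q y
     + (\<Sum>i<n. \<Sum>j<m. Vw n m k y i j * Tprod_deriv n m i j Q y)) =
     (\<lambda>y. real m * real n * ?T (k # Q) y + c0 * real n * ?Z y)"
  proof (rule ext)
    fix y :: "nat \<times> nat \<Rightarrow> real"
    \<comment> \<open>Pure rescaling, with \<open>c\<close> for \<open>c0\<close>, \<open>N\<close>
      for \<open>n\<close>, \<open>c * c / N\<close> for \<open>m\<close> and \<open>N / c\<close>
      for \<open>eta\<close>.\<close>
    have id: "(N * a * (c * N * b1 + (c * c / N) * N * b0) + (c * N * d1 + (c * c / N) * N * d0)) / c * P =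
        c * N * (a * (b0 * P) + N / c * (a * (b1 * P)) + 1 / N * (d0 * P + N / c * (d1 * P)))"
      if "c > 0" "N > 0" for c N a b0 b1 d0 d1 P :: real
      using that by (simp add: field_simps)
    have "(trw n m l y * Sw n m (k - 1 - l) y + Sw n m (k - 1) y) / c0 * ?T Q y = c0 * real n * ?g l y" if "l < k" for l
    proof -
      have k: "Suc (k - 1 - l) = k - l" "Suc (k - 1) = k" using that by auto
      show ?thesis
        unfolding Sw_Tm trw_Tm k eta_def Tprod_simps
        using id[OF c0(1) N, of "Tm n m l y" "Tm n m (k - l) y" "Tm n m (k - 1 - l) y" "Tm n m k y" "Tm n m (k - 1) y" "?T Q y"]
        by (simp only: M[symmetric])
    qed
    then have "(\<Sum>l<k. trw n m l y * Sw n m (k - 1 - l) y + Sw n m (k - 1) y) / c0 * ?T Q y = c0 * real n * (\<Sum>l<k. ?g l y)"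
      by (simp only: sum_divide_distrib sum_distrib_right sum_distrib_left) (rule sum.cong, rule refl, simp)
    then show "(real m * trw n m k y +
     (\<Sum>l<k. trw n m l y * Sw n m (k - 1 - l) y + Sw n m (k - 1) y) / c0) * ?T Q y
     + (\<Sum>i<n. \<Sum>j<m. Vw n m k y i j * Tprod_deriv n m i j Q y) = real m * real n * ?T (k # Q) y + c0 * real n * ?Z y"
      unfolding sum_Vw_Tprod_deriv distrib_right trw_Tm by (simp only: distrib_left Tprod_simps mult.assoc add.assoc)
  qed
  also have "Exp (\<lambda>y. real m * real n * ?T (k # Q) y + c0 * real n * ?Z y) = real m * real n * Exp (?T (k # Q)) + c0 * real n * Exp ?Z"
    by (subst E_add, intro pfun_mult pfun_const pfun_Tprod, intro pfun_mult pfun_const pZ, simp only: Exp_cmult)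
  also have "Exp (\<lambda>y. c0 * real n * ?T (Suc k # Q) y + real m * real n * ?T (k # Q) y) =
     c0 * real n * Exp (?T (Suc k # Q)) + real m * real n * Exp (?T (k # Q))"
    by (subst E_add, intro pfun_mult pfun_const pfun_Tprod, intro pfun_mult pfun_const pfun_Tprod, simp only: Exp_cmult)
  finally have eq: "c0 * real n * Exp (?T (Suc k # Q)) = c0 * real n * Exp ?Z" by linarith
  have nz: "c0 * real n \<noteq> 0" using N m_pos by simp
  have "Exp (?T (Suc k # Q)) = Exp ?Z" by (rule mult_left_cancel[THEN iffD1, OF nz eq])
  also have "Exp ?Z = (\<Sum>l<k. Exp (?g l)) + Exp (Gt n m k Q)"
    by (subst E_add, intro pfun_sum pg, rule pfun_Gt, subst E_sum, rule pg, rule refl)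
  finally have e: "Exp (?T (Suc k # Q)) = (\<Sum>l<k. Exp (?g l)) + Exp (Gt n m k Q)" .
  have g: "Exp (?g l) = mean_tr M n m X (l # (k - 1 - l) # Q) + eta n m * mean_tr M n m X (l # (k - l) # Q)
        + 1 / real n * (mean_tr M n m X ((k - 1) # Q) + eta n m * mean_tr M n m X (k # Q))" for l
    unfolding mean_tr_eq
    by (subst E_add, intro pfun_add pfun_mult pfun_const pfun_Tprod, intro pfun_add pfun_mult pfun_const pfun_Tprod,
        subst E_add, rule pfun_Tprod, intro pfun_mult pfun_const pfun_Tprod, subst Exp_cmult, subst Exp_cmult,
        subst E_add, rule pfun_Tprod, intro pfun_mult pfun_const pfun_Tprod, subst Exp_cmult, rule refl)
  have c: "covterm (real n) (eta n m) (mean_tr M n m X) k [] Q = Exp (Gt n m k Q)"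
    by (simp add: covterm_mean_tr)
  show ?thesis unfolding c mean_tr_eq[of "Suc k # Q"] e g by (rule refl)
qed

lemma eta_bounds: assumes "n \<le> m" shows "0 \<le> eta n m" "eta n m \<le> 1"
proof -
  have "sqrt (real n * real n) \<le> c0"
    using assms by (intro real_sqrt_le_mono mult_left_mono) auto
  then show "eta n m \<le> 1" using c0(1) by (simp add: eta_def)
qed (simp add: eta_def)

theorem loop_system: assumes "n \<le> m" shows "(real n, eta n m, mean_tr M n m X) \<in> loop_systems"
proof -
  have "mean_tr M n m X [] = 1" by (simp add: mean_tr_def prob_space)
  moreover have "mean_tr M n m X (0 # Q) = mean_tr M n m X Q" for Q
    by (simp add: mean_tr_def Tm_0)
  ultimately show ?thesis
    unfolding loop_systems_def using loop_equation eta_bounds[OF assms] n_pos by auto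
qed

text \<open>The variance is the factorisation error of the list \<open>[k, k]\<close>, hence of
  order \<open>1 / n\<^sup>2\<close>.\<close>

lemma variance_Tm:
  "integrable M (\<lambda>w. (Tm n m k (\<lambda>p. X p w) - mean_tr M n m X [k])\<^sup>2)"
  "(\<integral>w. (Tm n m k (\<lambda>p. X p w) - mean_tr M n m X [k])\<^sup>2 \<partial>M) = mean_tr M n m X [k, k] - mean_tr M n m X [k] * mean_tr M n m X [k]"
proof -
  let ?e = "mean_tr M n m X [k]"
  have eq: "(Tm n m k y - ?e)\<^sup>2 = Tprod n m [k, k] y + ((- 2 * ?e) * Tprod n m [k] y + ?e * ?e)" for y
    by (simp add: power2_eq_square algebra_simps)
  have pf: "pfun (\<lambda>y. (- 2 * ?e) * Tprod n m [k] y + ?e * ?e)"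
    by (intro pfun_add pfun_mult pfun_const pfun_Tprod)
  show "integrable M (\<lambda>w. (Tm n m k (\<lambda>p. X p w) - ?e)\<^sup>2)"
    using pfun_integrable[OF pfun_add[OF pfun_Tprod[of "[k, k]"] pf]] unfolding eq pt_def .
  have "(\<integral>w. (Tm n m k (\<lambda>p. X p w) - ?e)\<^sup>2 \<partial>M) = Exp (\<lambda>y. Tprod n m [k, k] y + ((- 2 * ?e) * Tprod n m [k] y + ?e * ?e))"
    unfolding eq Exp_def pt_def by (rule refl)
  also have "\<dots> = Exp (Tprod n m [k, k]) + ((- 2 * ?e) * Exp (Tprod n m [k]) + ?e * ?e)"
    by (subst E_add[OF pfun_Tprod pf], subst E_add, intro pfun_mult pfun_const pfun_Tprod, rule pfun_const,
        subst Exp_cmult) (simp add: Exp_def prob_space)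
  finally show "(\<integral>w. (Tm n m k (\<lambda>p. X p w) - ?e)\<^sup>2 \<partial>M) = mean_tr M n m X [k, k] - ?e * ?e"
    by (simp add: mean_tr_eq)
qed

end

section \<open>Almost sure convergence of the moments\<close>

lemma AE_tendsto_0_of_summable_expectation:
  fixes D :: "nat \<Rightarrow> 'a \<Rightarrow> real"
  assumes int: "\<And>n. integrable M (D n)" and nn: "\<And>n w. 0 \<le> D n w"
    and le: "\<And>n. integral\<^sup>L M (D n) \<le> b n" and b: "summable b"
  shows "AE w in M. (\<lambda>n. D n w) \<longlonglongrightarrow> 0"
proof -
  have [measurable]: "D n \<in> borel_measurable M" for n using int by auto
  have b0: "0 \<le> b n" for n 
  proof -
    have "0 \<le> integral\<^sup>L M (D n)" by (rule Bochner_Integration.integral_nonneg) (rule nn)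
    then show ?thesis using le[of n] by linarith
  qed
  \<comment> \<open>The expectation of the whole series is finite, so the series converges almost
    surely and its terms tend to 0. No joint law of the terms is involved.\<close>
  have "(\<integral>\<^sup>+w. (\<Sum>n. ennreal (D n w)) \<partial>M) = (\<Sum>n. \<integral>\<^sup>+w. ennreal (D n w) \<partial>M)"
    by (rule nn_integral_suminf) simp
  also have "\<dots> = (\<Sum>n. ennreal (integral\<^sup>L M (D n)))"
    by (subst nn_integral_eq_integral[OF int]) (simp_all add: nn)
  also have "\<dots> \<le> (\<Sum>n. ennreal (b n))"
    by (intro suminf_le ennreal_leI le) auto
  also have "\<dots> < \<infinity>" using b b0 by (simp add: suminf_ennreal_eq[OF b0 summable_sums[OF b]])
  finally have "(\<integral>\<^sup>+w. (\<Sum>n. ennreal (D n w)) \<partial>M) \<noteq> \<infinity>" by simp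
  then have "AE w in M. (\<Sum>n. ennreal (D n w)) \<noteq> \<infinity>"
    by (intro nn_integral_PInf_AE) auto
  then show ?thesis
  proof eventually_elim
    case (elim w)
    then have "summable (\<lambda>n. D n w)" by (intro summable_suminf_not_top) (auto simp: nn)
    then show ?case by (rule summable_LIMSEQ_zero)
  qed
qed

theorem wishart_moments_AE:
  fixes Z :: "nat \<Rightarrow> nat \<times> nat \<Rightarrow> 'a \<Rightarrow> real" and m :: "nat \<Rightarrow> nat"
  assumes gm: "\<And>n. n \<ge> 1 \<Longrightarrow> gaussian_matrix M n (m n) (Z n)"
    and le: "\<And>n. n \<le> m n" and lim: "(\<lambda>n. real n / real (m n)) \<longlonglongrightarrow> 0"
  shows "AE w in M. \<forall>k. (\<lambda>n. Tm n (m n) k (\<lambda>p. Z n p w)) \<longlonglongrightarrow> cat k"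
proof -
  \<comment> \<open>Shifted by one, so that every index gives a matrix of positive size and thus a
    loop system.\<close>
  define S where "S = (\<lambda>i. (real (Suc i), eta (Suc i) (m (Suc i)), mean_tr M (Suc i) (m (Suc i)) (Z (Suc i))))"
  have S: "S i \<in> loop_systems" for i
    unfolding S_def by (rule gaussian_matrix.loop_system[OF gm le]) simp
  have N: "filterlim (\<lambda>i. fst (S i)) at_top sequentially"
    unfolding S_def fst_conv by (rule filterlim_compose[OF filterlim_real_sequentially filterlim_Suc])
  have "eta n (m n) = sqrt (real n / real (m n))" for n
  proof -
    have "eta n (m n) = (real n / sqrt (real n)) / sqrt (real (m n))" by (simp add: eta_def real_sqrt_mult)
    then show ?thesis by (simp add: real_div_sqrt real_sqrt_divide)
  qed
  then have "(\<lambda>n. eta n (m n)) \<longlonglongrightarrow> sqrt 0"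
    using tendsto_real_sqrt[OF lim] by simp
  then have eta: "(\<lambda>i. et (S i)) \<longlonglongrightarrow> 0"
    unfolding S_def using LIMSEQ_Suc by force
  have "AE w in M. (\<lambda>i. Tm (Suc i) (m (Suc i)) k (\<lambda>p. Z (Suc i) p w)) \<longlonglongrightarrow> cat k" for k
  proof -
    obtain C where C: "\<And>s. s \<in> loop_systems \<Longrightarrow> \<bar>em [k, k] s - fact_em [k, k] s\<bar> \<le> C / fst s ^ 2"
      using bo_bound[OF bo_factorization[of "[k, k]"]] by blast
    let ?D = "\<lambda>i w. (Tm (Suc i) (m (Suc i)) k (\<lambda>p. Z (Suc i) p w) - em [k] (S i))\<^sup>2"
    have "AE w in M. (\<lambda>i. ?D i w) \<longlonglongrightarrow> 0"
    proof (rule AE_tendsto_0_of_summable_expectation)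
      fix i
      interpret gaussian_matrix M "Suc i" "m (Suc i)" "Z (Suc i)" by (rule gm) simp
      show "integrable M (?D i)" using variance_Tm(1) by (simp add: S_def)
      have "integral\<^sup>L M (?D i) = em [k, k] (S i) - fact_em [k, k] (S i)"
        using variance_Tm(2) by (simp add: S_def)
      also have "\<dots> \<le> C / fst (S i) ^ 2" using C[OF S, of i] by linarith
      finally show "integral\<^sup>L M (?D i) \<le> C * inverse (real (Suc i) ^ 2)" by (simp add: S_def divide_inverse)
    next
      show "summable (\<lambda>i. C * inverse (real (Suc i) ^ 2))"
        by (intro summable_mult, subst summable_Suc_iff) (rule inverse_power_summable, simp)
    qed simp
    then show ?thesis
    proof eventually_elim
      case (elim w)
      from tendsto_real_sqrt[OF elim]
      have "(\<lambda>i. \<bar>Tm (Suc i) (m (Suc i)) k (\<lambda>p. Z (Suc i) p w) - em [k] (S i)\<bar>) \<longlonglongrightarrow> 0" by simp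
      then have "(\<lambda>i. Tm (Suc i) (m (Suc i)) k (\<lambda>p. Z (Suc i) p w) - em [k] (S i)) \<longlonglongrightarrow> 0"
        by (rule tendsto_rabs_zero_cancel)
      from tendsto_add[OF this loop_systems_mean_limit[OF S N eta, of k]] show ?case by simp
    qed
  qed
  then have "AE w in M. \<forall>k. (\<lambda>i. Tm (Suc i) (m (Suc i)) k (\<lambda>p. Z (Suc i) p w)) \<longlonglongrightarrow> cat k"
    by (simp add: AE_all_countable)
  then show ?thesis
  proof eventually_elim
    case (elim w)
    show ?case
    proof
      fix k
      from elim have "(\<lambda>i. Tm (Suc i) (m (Suc i)) k (\<lambda>p. Z (Suc i) p w)) \<longlonglongrightarrow> cat k" ..
      then show "(\<lambda>n. Tm n (m n) k (\<lambda>p. Z n p w)) \<longlonglongrightarrow> cat k" by (rule LIMSEQ_imp_Suc)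
    qed
  qed
qed

subsection \<open>Almost sure invertibility\<close>

text \<open>The determinant is affine in its corner entry, with the leading principal minor as
  slope.\<close>

lemma det_split_last:
  fixes f :: "nat \<times> nat \<Rightarrow> real"
  shows "det (mat (Suc p) (Suc p) f) = f (p, p) * det (mat p p f) + det (mat (Suc p) (Suc p) (f((p, p) := 0)))"
proof -
  let ?A = "mat (Suc p) (Suc p) f" and ?B = "mat (Suc p) (Suc p) (f((p, p) := 0))"
  have del: "mat_delete ?A p j = mat_delete ?B p j" for j
    by (rule eq_matI) (auto simp: mat_delete_def)
  have pp: "mat_delete ?A p p = mat p p f"
    by (rule eq_matI) (auto simp: mat_delete_def)
  have "det ?A = (\<Sum>j<Suc p. ?A $$ (p, j) * cofactor ?A p j)"
    by (rule laplace_expansion_row) auto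
  also have "\<dots> = (\<Sum>j<p. f (p, j) * cofactor ?A p j) + f (p, p) * det (mat p p f)"
    by (simp add: cofactor_def pp)
  also have "(\<Sum>j<p. f (p, j) * cofactor ?A p j) = (\<Sum>j<Suc p. ?B $$ (p, j) * cofactor ?B p j)"
    by (simp add: cofactor_def del)
  also have "\<dots> = det ?B"
    by (rule laplace_expansion_row[symmetric]) auto
  finally show ?thesis by simp
qed

lemma measurable_det:
  fixes F :: "'b \<Rightarrow> nat \<times> nat \<Rightarrow> real"
  assumes "\<And>i j. i < n \<Longrightarrow> j < n \<Longrightarrow> (\<lambda>x. F x (i, j)) \<in> borel_measurable N"
  shows "(\<lambda>x. det (mat n n (F x))) \<in> borel_measurable N"
proof -
  have eq: "det (mat n n (F x)) = (\<Sum>\<pi> \<in> {\<pi>. \<pi> permutes {0..<n}}. signof \<pi> * (\<Prod>i = 0..<n. F x (i, \<pi> i)))" for x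
    by (subst det_def') (auto intro!: sum.cong prod.cong arg_cong2[of _ _ _ _ "(*)"] simp: permutes_in_image)
  show ?thesis unfolding eq
    by (intro borel_measurable_sum borel_measurable_times borel_measurable_prod borel_measurable_const assms)
      (auto simp: permutes_in_image)
qed

text \<open>By Fubini the diagonal is null for a product law whose first factor has no
  atoms.\<close>

lemma (in prob_space) indep_density_AE_noteq:
  fixes V U :: "'a \<Rightarrow> real"
  assumes ind: "indep_var borel V borel U" and dens: "distributed M lborel V f"
  shows "AE w in M. V w \<noteq> U w"
proof -
  have rv: "random_variable borel V" "random_variable borel U"
    and eq: "distr M borel V \<Otimes>\<^sub>M distr M borel U = distr M (borel \<Otimes>\<^sub>M borel) (\<lambda>w. (V w, U w))"
    using ind unfolding indep_var_distribution_eq by auto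
  interpret V: prob_space "distr M borel V" by (rule prob_space_distr) (rule rv)
  interpret U: prob_space "distr M borel U" by (rule prob_space_distr) (rule rv)
  interpret VU: pair_sigma_finite "distr M borel V" "distr M borel U" ..
  let ?A = "{z. fst z = snd z} :: (real \<times> real) set"
  have "closed ?A" by (intro closed_Collect_eq continuous_intros)
  then have A: "?A \<in> sets (borel \<Otimes>\<^sub>M borel)" unfolding borel_prod by (rule borel_closed)
  have null: "emeasure (distr M borel V) {u} = 0" for u
  proof -
    have "emeasure (distr M borel V) {u} = emeasure (distr M lborel V) {u}"
      by (simp add: emeasure_distr rv)
    also have "distr M lborel V = density lborel f" using dens by (simp add: distributed_def)
    also have "emeasure (density lborel f) {u} = (\<integral>\<^sup>+x. f x * indicator {u} x \<partial>lborel)"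
      by (rule emeasure_density) (use distributed_borel_measurable[OF dens] in auto)
    also have "\<dots> = (\<integral>\<^sup>+x. 0 \<partial>(lborel :: real measure))"
      by (rule nn_integral_cong_AE, rule eventually_mono[OF AE_lborel_singleton[of u]]) auto
    also have "\<dots> = 0" by simp
    finally show ?thesis .
  qed
  have "emeasure M {w \<in> space M. V w = U w} = emeasure (distr M (borel \<Otimes>\<^sub>M borel) (\<lambda>w. (V w, U w))) ?A"
    by (subst emeasure_distr) (use rv A in \<open>auto intro!: arg_cong[of _ _ "emeasure M"]\<close>)
  also have "\<dots> = (\<integral>\<^sup>+u. emeasure (distr M borel V) ((\<lambda>v. (v, u)) -` ?A) \<partial>distr M borel U)"
    unfolding eq[symmetric] by (rule VU.emeasure_pair_measure_alt2) (use A in \<open>simp cong: sets_pair_measure_cong\<close>)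
  also have "\<dots> = (\<integral>\<^sup>+u. 0 \<partial>distr M borel U)"
  proof (rule nn_integral_cong)
    fix u
    have "(\<lambda>v. (v, u)) -` ?A = {u}" by auto
    then show "emeasure (distr M borel V) ((\<lambda>v. (v, u)) -` ?A) = 0" using null[of u] by simp
  qed
  finally have "emeasure M {w \<in> space M. V w = U w} = 0" by simp
  moreover have "{w \<in> space M. V w = U w} \<in> sets M" using rv by measurable
  ultimately show ?thesis
    by (intro AE_I[of _ _ "{w \<in> space M. V w = U w}"]) auto
qed

text \<open>Expanding along the last row, the determinant vanishes only if the corner entry equals a
  function of the other, independent entries.\<close>

theorem (in std_gaussian_family) AE_det_nonzero:
  fixes h :: "nat \<times> nat \<Rightarrow> 'i"
  assumes h: "inj_on h ({..<n} \<times> {..<n})" "h ` ({..<n} \<times> {..<n}) \<subseteq> I"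
  shows "AE w in M. det (mat n n (\<lambda>z. X (h z) w)) \<noteq> 0"
proof -
  \<comment> \<open>Induction over the leading principal minors: the previous minor is the slope in
    the new corner entry and is almost surely nonzero.\<close>
  have "AE w in M. det (mat p p (\<lambda>z. X (h z) w)) \<noteq> 0" if "p \<le> n" for p
    using that
  proof (induction p)
    case 0
    show ?case by simp
  next
    case (Suc p)
    let ?J = "{..<Suc p} \<times> {..<Suc p}"
    let ?A = "{h (p, p)}" and ?B = "h ` (?J - {(p, p)})"
    have J: "?J \<subseteq> {..<n} \<times> {..<n}" using Suc.prems by auto
    then have "h ` ?J \<subseteq> I" using h(2) by blast
    moreover have "h (p, p) \<notin> ?B"
    proof
      assume "h (p, p) \<in> ?B"
      then obtain z where z: "z \<in> ?J" "z \<noteq> (p, p)" "h z = h (p, p)" by force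
      then show False using inj_onD[OF inj_on_subset[OF h(1) J] z(3) z(1)] by simp
    qed
    ultimately have AB: "?A \<inter> ?B = {}" "?A \<subseteq> I" "?B \<subseteq> I" by auto
    let ?D = "\<lambda>f :: 'i \<Rightarrow> real. det (mat p p (\<lambda>z. f (h z)))"
    let ?R = "\<lambda>f :: 'i \<Rightarrow> real. det (mat (Suc p) (Suc p) ((\<lambda>z. f (h z))((p, p) := 0)))"
    have D: "?D \<in> borel_measurable (PiM ?B (\<lambda>_. borel))"
      by (rule measurable_det) (auto intro!: measurable_component_singleton)
    have R: "?R \<in> borel_measurable (PiM ?B (\<lambda>_. borel))"
    proof (rule measurable_det)
      fix i j assume "i < Suc p" "j < Suc p"
      then show "(\<lambda>f. ((\<lambda>z. f (h z))((p, p) := 0)) (i, j)) \<in> borel_measurable (PiM ?B (\<lambda>_. borel))"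
        by (cases "(i, j) = (p, p)") (auto intro!: measurable_component_singleton)
    qed
    \<comment> \<open>The quotient is the only corner value that makes the new minor vanish. Its
      junk value where the slope is 0 does no harm, since that event is null by the induction
      hypothesis.\<close>
    have "indep_var borel ((\<lambda>f. f (h (p, p))) \<circ> (\<lambda>w. restrict (\<lambda>i. X i w) ?A))
       borel ((\<lambda>f. - ?R f / ?D f) \<circ> (\<lambda>w. restrict (\<lambda>i. X i w) ?B))"
      by (rule indep_var_compose[OF indep_var_restrict[OF indep AB]])
        (intro measurable_component_singleton borel_measurable_divide borel_measurable_uminus D R; simp)+
    moreover have "?D (restrict (\<lambda>i. X i w) ?B) = ?D (\<lambda>i. X i w)" for w
      by (rule arg_cong[of _ _ det], rule eq_matI) auto
    moreover have "?R (restrict (\<lambda>i. X i w) ?B) = ?R (\<lambda>i. X i w)" for w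
      by (rule arg_cong[of _ _ det], rule eq_matI) auto
    ultimately have "indep_var borel (X (h (p, p))) borel (\<lambda>w. - ?R (\<lambda>i. X i w) / ?D (\<lambda>i. X i w))"
      by (simp add: comp_def)
    moreover have "distributed M lborel (X (h (p, p))) std_normal_density"
      using AB by (intro normal) auto
    ultimately have "AE w in M. X (h (p, p)) w \<noteq> - ?R (\<lambda>i. X i w) / ?D (\<lambda>i. X i w)"
      by (rule indep_density_AE_noteq)
    moreover have "AE w in M. ?D (\<lambda>i. X i w) \<noteq> 0" using Suc by simp
    ultimately show ?case
    proof eventually_elim
      case (elim w)
      then show ?case using det_split_last[of p "\<lambda>z. X (h z) w"] by (auto simp: field_simps)
    qed
  qed
  then show ?thesis by simp
qed

subsection \<open>Method of moments\<close>

lemma sc_int_add: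
  assumes "g \<in> borel_measurable borel" "h \<in> borel_measurable borel"
    and "\<And>x. x \<in> {-2..2} \<Longrightarrow> \<bar>g x\<bar> \<le> B" "\<And>x. x \<in> {-2..2} \<Longrightarrow> \<bar>h x\<bar> \<le> C"
  shows "sc_int (\<lambda>x. g x + h x) = sc_int g + sc_int h"
  unfolding sc_int_def distrib_right by (rule set_integral_add(2)) (rule sc_integrable; fact assms)+

lemma sc_int_cmult: "sc_int (\<lambda>x. c * g x) = c * sc_int g"
  unfolding sc_int_def mult.assoc by (rule set_integral_mult_right)

lemma sc_int_const: "sc_int (\<lambda>_. c) = c"
  using sc_int_cmult[of c "\<lambda>_. 1"] by (simp add: sc_int_power_0)

lemma abs_power_le_2: "x \<in> {-2..2} \<Longrightarrow> \<bar>x ^ k\<bar> \<le> (2::real) ^ k"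
  unfolding power_abs by (intro power_mono) auto

text \<open>The growth rate 4 reflects the support radius 2. It is beaten by the 9 that belongs to
  the window \<open>[-3, 3]\<close> used for polynomial approximation.\<close>

lemma cat_even_le: "cat (2 * K) \<le> 4 ^ K"
proof -
  have "sc_int (\<lambda>x. x ^ (2 * K)) \<le> sc_int (\<lambda>_. 4 ^ K)"
  proof (rule sc_int_mono[where B = "4 ^ K"])
    fix x :: real assume x: "x \<in> {-2..2}"
    have "(2::real) ^ (2 * K) = 4 ^ K" by (simp add: power_mult)
    then show "\<bar>x ^ (2 * K)\<bar> \<le> 4 ^ K" using abs_power_le_2[OF x, of "2 * K"] by simp
    then show "x ^ (2 * K) \<le> 4 ^ K" by linarith
  qed auto
  then show ?thesis by (simp add: sc_int_power sc_int_const)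
qed

lemma sc_int_polynomial: "sc_int (\<lambda>x. \<Sum>i\<le>d. a i * x ^ i) = (\<Sum>i\<le>d. a i * cat i)"
proof (induction d)
  case 0
  show ?case by (simp add: sc_int_const)
next
  case (Suc d)
  have b: "\<bar>\<Sum>i\<le>d. a i * x ^ i\<bar> \<le> (\<Sum>i\<le>d. \<bar>a i\<bar> * 2 ^ i)" if "x \<in> {-2..2}" for x
    by (rule order_trans[OF sum_abs]) (auto simp: abs_mult intro!: sum_mono mult_left_mono abs_power_le_2[OF that])
  have "sc_int (\<lambda>x. (\<Sum>i\<le>d. a i * x ^ i) + a (Suc d) * x ^ Suc d) =
      sc_int (\<lambda>x. \<Sum>i\<le>d. a i * x ^ i) + sc_int (\<lambda>x. a (Suc d) * x ^ Suc d)"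
  proof (rule sc_int_add[OF _ _ b])
    fix x :: real assume "x \<in> {-2..2}"
    then show "\<bar>a (Suc d) * x ^ Suc d\<bar> \<le> \<bar>a (Suc d)\<bar> * 2 ^ Suc d"
      unfolding abs_mult by (intro mult_left_mono abs_power_le_2) auto
  qed auto
  then show ?case using Suc by (simp add: sc_int_cmult sc_int_power del: power_Suc)
qed

text \<open>Outside \<open>[-3, 3]\<close> both \<open>h\<close> and the polynomial are at most a
  multiple of \<open>\<bar>x\<bar> ^ d\<close>, hence of
  \<open>(\<bar>x\<bar> / 3) ^ (2 * K)\<close>. The error is thus controlled by one even
  moment.\<close>

lemma polynomial_approx_bound:
  fixes h :: "real \<Rightarrow> real"
  assumes near: "\<And>x. \<bar>x\<bar> \<le> 3 \<Longrightarrow> \<bar>h x - (\<Sum>i\<le>d. a i * x ^ i)\<bar> \<le> \<epsilon>"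
    and B: "\<And>x. \<bar>h x\<bar> \<le> B" and K: "d \<le> 2 * K" and "\<epsilon> \<ge> 0"
  shows "\<bar>h x - (\<Sum>i\<le>d. a i * x ^ i)\<bar> \<le> \<epsilon> + (B + (\<Sum>i\<le>d. \<bar>a i\<bar>)) * 3 ^ d / 9 ^ K * x ^ (2 * K)"
proof -
  let ?A = "B + (\<Sum>i\<le>d. \<bar>a i\<bar>)"
  have B0: "B \<ge> 0" using B[of 0] by linarith
  have A0: "?A \<ge> 0" using B0 by (intro add_nonneg_nonneg sum_nonneg) auto
  have xK: "x ^ (2 * K) = \<bar>x\<bar> ^ (2 * K)" by (simp add: power_mult)
  have nn: "0 \<le> ?A * 3 ^ d / 9 ^ K * x ^ (2 * K)"
    unfolding xK using A0 by (intro mult_nonneg_nonneg divide_nonneg_nonneg) auto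
  show ?thesis
  proof (cases "\<bar>x\<bar> \<le> 3")
    case True
    then show ?thesis using near[of x] nn by linarith
  next
    case False
    then have x1: "1 \<le> \<bar>x\<bar>" "1 \<le> \<bar>x\<bar> / 3" by auto
    have "\<bar>\<Sum>i\<le>d. a i * x ^ i\<bar> \<le> (\<Sum>i\<le>d. \<bar>a i\<bar> * \<bar>x\<bar> ^ d)"
      by (rule order_trans[OF sum_abs])
        (auto simp: abs_mult power_abs intro!: sum_mono mult_left_mono power_increasing x1)
    moreover have "\<bar>h x\<bar> \<le> B * \<bar>x\<bar> ^ d"
      using B[of x] mult_left_mono[OF one_le_power[OF x1(1)] B0, of d] by simp
    ultimately have "\<bar>h x - (\<Sum>i\<le>d. a i * x ^ i)\<bar> \<le> ?A * \<bar>x\<bar> ^ d"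
      by (simp add: distrib_right sum_distrib_right[symmetric])
    also have "\<dots> = ?A * 3 ^ d * (\<bar>x\<bar> / 3) ^ d" by (simp add: power_divide)
    also have "\<dots> \<le> ?A * 3 ^ d * (\<bar>x\<bar> / 3) ^ (2 * K)"
      using A0 by (intro mult_left_mono power_increasing K x1) auto
    also have "\<dots> = ?A * 3 ^ d / 9 ^ K * x ^ (2 * K)"
      unfolding xK by (simp add: power_divide power_mult)
    finally show ?thesis using assms(4) by linarith
  qed
qed

text \<open>The eigenvalues need not stay in a compact set, so Weierstrass approximation on
  \<open>[-3, 3]\<close> is combined with a high even moment, whose contribution is of order
  \<open>(4 / 9) ^ K\<close>.\<close>

theorem moments_imp_test_functions:
  fixes e :: "nat \<Rightarrow> nat \<Rightarrow> real" and h :: "real \<Rightarrow> real"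
  assumes mom: "\<And>k. (\<lambda>n. (\<Sum>i<n. e n i ^ k) / real n) \<longlonglongrightarrow> cat k"
    and h: "continuous_on UNIV h" and B: "\<And>x. \<bar>h x\<bar> \<le> B"
  shows "(\<lambda>n. (\<Sum>i<n. h (e n i)) / real n) \<longlonglongrightarrow> sc_int h"
proof (rule tendstoI)
  fix r :: real assume "r > 0"
  \<comment> \<open>Two parts for approximation under the empirical measure (near and far), one for
    the convergence of polynomial averages, one for approximation under the semicircle law.\<close>
  define \<epsilon> where "\<epsilon> = r / 4"
  have eps: "\<epsilon> > 0" "r = 4 * \<epsilon>" using \<open>r > 0\<close> by (auto simp: \<epsilon>_def)
  obtain p where p: "real_polynomial_function p" "\<And>x. x \<in> {-3..3} \<Longrightarrow> \<bar>h x - p x\<bar> < \<epsilon>"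
    using Stone_Weierstrass_real_polynomial_function[of "{-3..3}" h \<epsilon>] continuous_on_subset[OF h] eps(1) by auto
  then obtain a d where pa: "p = (\<lambda>x. \<Sum>i\<le>d. a i * x ^ i)"
    unfolding real_polynomial_function_iff_sum by blast
  let ?A = "(B + (\<Sum>i\<le>d. \<bar>a i\<bar>)) * 3 ^ d"
  have B0: "B \<ge> 0" using B[of 0] by linarith
  have A0: "?A \<ge> 0" using B0 by (intro mult_nonneg_nonneg add_nonneg_nonneg sum_nonneg) auto
  have "(\<lambda>K. ?A * (4 / 9) ^ K) \<longlonglongrightarrow> ?A * 0"
    by (intro tendsto_mult tendsto_const LIMSEQ_realpow_zero) auto
  then have "\<forall>\<^sub>F K in sequentially. ?A * (4 / 9) ^ K < \<epsilon>"
    using eps(1) by (intro order_tendstoD) auto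
  then have "\<forall>\<^sub>F K in sequentially. ?A * (4 / 9) ^ K < \<epsilon> \<and> d \<le> 2 * K"
    by (rule eventually_conj) (rule eventually_sequentiallyI[of d], simp)
  then obtain K where K: "?A * (4 / 9) ^ K < \<epsilon>" "d \<le> 2 * K"
    by (metis (no_types, lifting) eventually_sequentially order_refl)
  have bd: "\<bar>h x - p x\<bar> \<le> \<epsilon> + ?A / 9 ^ K * x ^ (2 * K)" for x
  proof -
    have "\<bar>h x - (\<Sum>i\<le>d. a i * x ^ i)\<bar> \<le> \<epsilon>" if "\<bar>x\<bar> \<le> 3" for x
    proof -
      have "x \<in> {-3..3}" using that by auto
      from p(2)[OF this] show ?thesis unfolding pa by linarith
    qed
    then show ?thesis unfolding pa
      by (rule polynomial_approx_bound[OF _ B K(2)]) (use eps(1) in auto)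
  qed
  have lim1: "(\<lambda>n. ?A / 9 ^ K * ((\<Sum>i<n. e n i ^ (2 * K)) / real n)) \<longlonglongrightarrow> ?A / 9 ^ K * cat (2 * K)"
    by (intro tendsto_mult tendsto_const mom)
  have "?A / 9 ^ K * cat (2 * K) \<le> ?A / 9 ^ K * 4 ^ K"
    using A0 by (intro mult_left_mono cat_even_le) auto
  also have "\<dots> < \<epsilon>" using K(1) by (simp add: power_divide)
  finally have ev1: "\<forall>\<^sub>F n in sequentially. ?A / 9 ^ K * ((\<Sum>i<n. e n i ^ (2 * K)) / real n) < \<epsilon>"
    by (rule order_tendstoD(2)[OF lim1])
  have "(\<lambda>n. \<Sum>k\<le>d. a k * ((\<Sum>i<n. e n i ^ k) / real n)) \<longlonglongrightarrow> (\<Sum>k\<le>d. a k * cat k)"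
    by (intro tendsto_sum tendsto_mult tendsto_const mom)
  moreover have "(\<Sum>k\<le>d. a k * ((\<Sum>i<n. e n i ^ k) / real n)) = (\<Sum>i<n. p (e n i)) / real n" for n
    unfolding pa by (subst sum.swap) (simp add: sum_distrib_left sum_divide_distrib)
  ultimately have "(\<lambda>n. (\<Sum>i<n. p (e n i)) / real n) \<longlonglongrightarrow> sc_int p"
    by (simp add: pa sc_int_polynomial)
  then have ev2: "\<forall>\<^sub>F n in sequentially. dist ((\<Sum>i<n. p (e n i)) / real n) (sc_int p) < \<epsilon>"
    using eps(1) by (rule tendstoD)
  have hp: "\<bar>sc_int h - sc_int p\<bar> \<le> \<epsilon>"
  proof -
    have [measurable]: "h \<in> borel_measurable borel" by (rule borel_measurable_continuous_onI[OF h])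
    have [measurable]: "p \<in> borel_measurable borel" unfolding pa by measurable
    have pb: "\<bar>p x\<bar> \<le> B + \<epsilon>" if "x \<in> {-2..2}" for x using p(2)[of x] B[of x] that by auto
    have "sc_int h \<le> sc_int (\<lambda>x. p x + \<epsilon>)"
    proof (rule sc_int_mono[where B = "B + 2 * \<epsilon>"])
      fix x :: real assume x: "x \<in> {-2..2}"
      show "\<bar>h x\<bar> \<le> B + 2 * \<epsilon>" using B[of x] eps(1) by linarith
      show "\<bar>p x + \<epsilon>\<bar> \<le> B + 2 * \<epsilon>" using pb[OF x] eps(1) by linarith
      have "x \<in> {-3..3}" using x by auto
      then show "h x \<le> p x + \<epsilon>" using p(2)[of x] by linarith
    qed measurable
    also have "\<dots> = sc_int p + \<epsilon>"
      by (subst sc_int_add[where B = "B + \<epsilon>" and C = \<epsilon>]) (use pb eps(1) in \<open>auto simp: sc_int_const\<close>)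
    finally have 1: "sc_int h \<le> sc_int p + \<epsilon>" .
    have "sc_int p \<le> sc_int (\<lambda>x. h x + \<epsilon>)"
    proof (rule sc_int_mono[where B = "B + 2 * \<epsilon>"])
      fix x :: real assume x: "x \<in> {-2..2}"
      show "\<bar>h x + \<epsilon>\<bar> \<le> B + 2 * \<epsilon>" using B[of x] eps(1) by linarith
      show "\<bar>p x\<bar> \<le> B + 2 * \<epsilon>" using pb[OF x] eps(1) by linarith
      have "x \<in> {-3..3}" using x by auto
      then show "p x \<le> h x + \<epsilon>" using p(2)[of x] by linarith
    qed measurable
    also have "\<dots> = sc_int h + \<epsilon>"
      by (subst sc_int_add[where B = B and C = \<epsilon>]) (use B eps(1) in \<open>auto simp: sc_int_const\<close>)
    finally show ?thesis using 1 by linarith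
  qed
  show "\<forall>\<^sub>F n in sequentially. dist ((\<Sum>i<n. h (e n i)) / real n) (sc_int h) < r"
    using ev1 ev2
  proof eventually_elim
    case (elim n)
    have "\<bar>(\<Sum>i<n. h (e n i)) - (\<Sum>i<n. p (e n i))\<bar> \<le> (\<Sum>i<n. \<epsilon> + ?A / 9 ^ K * e n i ^ (2 * K))"
      unfolding sum_subtractf[symmetric] by (rule order_trans[OF sum_abs]) (intro sum_mono bd)
    also have "\<dots> = real n * \<epsilon> + ?A / 9 ^ K * (\<Sum>i<n. e n i ^ (2 * K))"
      by (simp add: sum.distrib sum_distrib_left)
    finally have "\<bar>(\<Sum>i<n. h (e n i)) - (\<Sum>i<n. p (e n i))\<bar> / real n \<le>
        (real n * \<epsilon> + ?A / 9 ^ K * (\<Sum>i<n. e n i ^ (2 * K))) / real n"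
      by (rule divide_right_mono) simp
    also have "\<dots> \<le> \<epsilon> + ?A / 9 ^ K * ((\<Sum>i<n. e n i ^ (2 * K)) / real n)"
      using eps(1) by (cases "n = 0") (auto simp: add_divide_distrib)
    finally have "\<bar>(\<Sum>i<n. h (e n i)) / real n - (\<Sum>i<n. p (e n i)) / real n\<bar> < 2 * \<epsilon>"
      using elim(1) by (simp add: diff_divide_distrib[symmetric] abs_divide)
    then show ?case using elim(2) hp eps(2) unfolding dist_real_def by linarith
  qed
qed

definition sc_tail :: "real \<Rightarrow> real" where "sc_tail a = sc_int (indicat_real {a..})"

text \<open>The density is at most \<open>1 / 2\<close>, so the tail is Lipschitz. This quantitative
  continuity absorbs all shifts of thresholds later on.\<close>

lemma sc_tail_diff_le: assumes "a \<le> b" shows "sc_tail a \<le> sc_tail b + (b - a)"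
proof -
  let ?I = "indicat_real {a..<b}"
  have "indicat_real {a..} = (\<lambda>x. indicat_real {b..} x + ?I x)"
    using assms by (auto simp: fun_eq_iff split: split_indicator)
  then have "sc_tail a = sc_tail b + sc_int ?I"
    unfolding sc_tail_def by (simp only:) (rule sc_int_add[where B = 1 and C = 1], auto split: split_indicator)
  moreover have "sc_int ?I \<le> (\<integral>x. indicat_real {a..<b} x \<partial>lborel)"
    unfolding sc_int_def set_lebesgue_integral_def
  proof (rule integral_mono)
    show "integrable lborel (\<lambda>x. indicat_real {-2..2} x *\<^sub>R (?I x * sc x))"
      using sc_integrable[of ?I 1] unfolding set_integrable_def by (auto split: split_indicator)
    show "integrable lborel ?I" using assms by (simp add: integrable_indicator_iff)
    fix x :: real
    show "indicat_real {-2..2} x *\<^sub>R (?I x * sc x) \<le> ?I x"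
      using sc_le[of x] by (auto split: split_indicator)
  qed
  moreover have "(\<integral>x. indicat_real {a..<b} x \<partial>lborel) = b - a" using assms by simp
  ultimately show ?thesis by linarith
qed

lemma real_card_eq_sum: "real (card {i. i < n \<and> P i}) = (\<Sum>i<n. if P i then 1 else 0)" for n :: nat
  using sum.inter_filter[of "{..<n}" "\<lambda>_. 1::real" P] by simp

text \<open>Indicators are sandwiched by ramps of width \<delta>. They start at
  \<open>a + \<delta>\<close> or at \<open>a - 2 * \<delta>\<close>, so that they stay on the
  correct side of the moving threshold \<open>a' n\<close>, which is eventually within \<delta> of
  \<open>a\<close>.\<close>

theorem moments_imp_counts:
  fixes e :: "nat \<Rightarrow> nat \<Rightarrow> real"
  assumes mom: "\<And>k. (\<lambda>n. (\<Sum>i<n. e n i ^ k) / real n) \<longlonglongrightarrow> cat k"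
    and a: "a' \<longlonglongrightarrow> a" and "r > 0"
  shows "\<forall>\<^sub>F n in sequentially. sc_tail a - r < real (card {i. i < n \<and> a' n < e n i}) / real n"
    and "\<forall>\<^sub>F n in sequentially. real (card {i. i < n \<and> a' n \<le> e n i}) / real n < sc_tail a + r"
proof -
  define \<delta> where "\<delta> = r / 3"
  have d: "\<delta> > 0" "r = 3 * \<delta>" using \<open>r > 0\<close> by (auto simp: \<delta>_def)
  define ramp where "ramp = (\<lambda>b x. min 1 (max 0 ((x - b) / \<delta>)))"
  have cont: "continuous_on UNIV (ramp b)" for b unfolding ramp_def by (intro continuous_intros) (use d in auto)
  have meas [measurable]: "ramp b \<in> borel_measurable borel" for b by (rule borel_measurable_continuous_onI[OF cont])
  have bnd: "\<bar>ramp b x\<bar> \<le> 1" for b x by (auto simp: ramp_def)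
  have lim: "(\<lambda>n. (\<Sum>i<n. ramp b (e n i)) / real n) \<longlonglongrightarrow> sc_int (ramp b)" for b
    by (rule moments_imp_test_functions[OF mom cont bnd])
  have ev: "\<forall>\<^sub>F n in sequentially. dist (a' n) a < \<delta>" using a d(1) by (rule tendstoD)
  have ramp0: "ramp b x = 0" if "x \<le> b" for b x using that d(1) by (simp add: ramp_def divide_le_0_iff)
  have ramp1: "ramp b x = 1" if "b + \<delta> \<le> x" for b x using that d(1) by (simp add: ramp_def le_divide_eq)
  have ramp01: "0 \<le> ramp b x" "ramp b x \<le> 1" for b x by (auto simp: ramp_def)
  have up: "sc_int (ramp b) \<le> sc_tail b" for b
    unfolding sc_tail_def by (rule sc_int_mono[where B = 1]) (auto simp: bnd ramp01 ramp0 split: split_indicator)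
  have lo: "sc_tail (b + \<delta>) \<le> sc_int (ramp b)" for b
    unfolding sc_tail_def by (rule sc_int_mono[where B = 1]) (auto simp: bnd ramp01 ramp1 split: split_indicator)
  have "sc_tail a \<le> sc_int (ramp (a + \<delta>)) + 2 * \<delta>"
    using sc_tail_diff_le[of a "a + \<delta> + \<delta>"] lo[of "a + \<delta>"] d(1) by simp
  then have "sc_tail a - r < sc_int (ramp (a + \<delta>))" using d by linarith
  then have "\<forall>\<^sub>F n in sequentially. sc_tail a - r < (\<Sum>i<n. ramp (a + \<delta>) (e n i)) / real n"
    by (rule order_tendstoD(1)[OF lim])
  then show "\<forall>\<^sub>F n in sequentially. sc_tail a - r < real (card {i. i < n \<and> a' n < e n i}) / real n"
    using ev
  proof eventually_elim
    case (elim n)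
    have "(\<Sum>i<n. ramp (a + \<delta>) (e n i)) \<le> (\<Sum>i<n. if a' n < e n i then 1 else 0)"
    proof (rule sum_mono)
      fix i
      show "ramp (a + \<delta>) (e n i) \<le> (if a' n < e n i then 1 else 0)"
        using elim(2) ramp01[of "a + \<delta>" "e n i"] ramp0[of "e n i" "a + \<delta>"] by (auto simp: dist_real_def abs_less_iff)
    qed
    then show ?case using elim(1) unfolding real_card_eq_sum by (meson divide_right_mono less_le_trans of_nat_0_le_iff)
  qed
  have "sc_int (ramp (a - 2 * \<delta>)) \<le> sc_tail a + 2 * \<delta>"
    using sc_tail_diff_le[of "a - 2 * \<delta>" a] up[of "a - 2 * \<delta>"] d(1) by simp
  then have "sc_int (ramp (a - 2 * \<delta>)) < sc_tail a + r" using d by linarith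
  then have "\<forall>\<^sub>F n in sequentially. (\<Sum>i<n. ramp (a - 2 * \<delta>) (e n i)) / real n < sc_tail a + r"
    by (rule order_tendstoD(2)[OF lim])
  then show "\<forall>\<^sub>F n in sequentially. real (card {i. i < n \<and> a' n \<le> e n i}) / real n < sc_tail a + r"
    using ev
  proof eventually_elim
    case (elim n)
    have "(\<Sum>i<n. if a' n \<le> e n i then 1 else 0) \<le> (\<Sum>i<n. ramp (a - 2 * \<delta>) (e n i))"
    proof (rule sum_mono)
      fix i
      show "(if a' n \<le> e n i then 1 else 0) \<le> ramp (a - 2 * \<delta>) (e n i)"
        using elim(2) ramp01[of "a - 2 * \<delta>" "e n i"] ramp1[of "a - 2 * \<delta>" "e n i"] by (auto simp: dist_real_def abs_less_iff)
    qed
    then show ?case using elim(1) unfolding real_card_eq_sum by (meson divide_right_mono le_less_trans of_nat_0_le_iff)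
  qed
qed

section \<open>The limit density as a reflected semicircle\<close>

lemma lim_density_reflect:
  assumes "u \<in> {-2..2}" shows "lim_density (- 2 - 2 * u) = sc u / 2"
proof -
  have "(6 + (- 2 - 2 * u)) * (2 - (- 2 - 2 * u)) = 4 * (4 - u\<^sup>2)"
    by (simp add: algebra_simps power2_eq_square)
  then have "sqrt ((6 + (- 2 - 2 * u)) * (2 - (- 2 - 2 * u))) = 2 * sqrt (4 - u\<^sup>2)"
    by (simp only: real_sqrt_mult real_sqrt_four)
  then show ?thesis using assms by (simp add: lim_density_def sc_def)
qed

text \<open>Substitution \<open>y = - 2 - 2 u\<close>: the half-line below \<open>x\<close> becomes
  the half-line above \<open>- 1 - x / 2\<close>, and the Jacobian 2 cancels the factor
  \<open>1 / 2\<close> of the reflected density.\<close>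

lemma integral_lim_density: "integral {..x} lim_density = sc_tail (- 1 - x / 2)"
proof -
  let ?f = "\<lambda>y. indicat_real {..x} y *\<^sub>R lim_density y"
  let ?g = "\<lambda>u. indicat_real {-2..2} u *\<^sub>R (indicat_real {- 1 - x / 2..} u * sc u)"
  have fg: "?f (- 2 + (- 2) * u) = 1 / 2 * ?g u" for u
  proof (cases "u \<in> {-2..2}")
    case True
    then show ?thesis using lim_density_reflect[OF True] by (auto split: split_indicator)
  next
    case False
    then show ?thesis by (auto simp: lim_density_def)
  qed
  have "integrable lborel ?g"
    using sc_integrable[of "indicat_real {- 1 - x / 2..}" 1]
    unfolding set_integrable_def by (auto split: split_indicator)
  then have "integrable lborel (\<lambda>u. ?f (- 2 + (- 2) * u))" unfolding fg by (rule integrable_mult_right)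
  then have int: "set_integrable lborel {..x} lim_density"
    unfolding set_integrable_def by (subst (asm) lborel_integrable_real_affine_iff) auto
  have "integral {..x} lim_density = (\<integral>y. ?f y \<partial>lborel)"
    using set_borel_integral_eq_integral(2)[OF int] by (simp add: set_lebesgue_integral_def)
  also have "\<dots> = \<bar>- 2\<bar> *\<^sub>R (\<integral>u. ?f (- 2 + (- 2) * u) \<partial>lborel)"
    by (rule lborel_integral_real_affine) simp
  also have "\<dots> = (\<integral>u. ?g u \<partial>lborel)" unfolding fg integral_mult_right_zero by simp
  finally show ?thesis by (simp add: sc_tail_def sc_int_def set_lebesgue_integral_def)
qed

subsection \<open>The F-matrix\<close>

text \<open>The scaled eigenvalue of \<open>\<lambda>\<close> is at most \<open>\<xi>\<close> iff
  \<open>(1 - thr_x) m2 - thr_x m1 \<lambda> \<ge> 0\<close>; \<open>thr_z\<close> and \<open>thr_eps\<close> are the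
  coefficients of \<open>I\<close> and \<open>- W\<^sub>X\<close> once \<open>W\<^sub>Y\<close> has coefficient 1.\<close>

definition thr_s :: "nat \<Rightarrow> nat \<Rightarrow> real" where
  "thr_s n m2 = sqrt (real n * (real m2 - real n))"

definition thr_x :: "nat \<Rightarrow> nat \<Rightarrow> nat \<Rightarrow> real \<Rightarrow> real" where
  "thr_x n m1 m2 \<xi> = (real m2 - thr_s n m2) / (real m1 + real m2) - \<xi> * thr_s n m2 / (2 * (real m1 - real n))"

definition thr_z :: "nat \<Rightarrow> nat \<Rightarrow> nat \<Rightarrow> real \<Rightarrow> real" where
  "thr_z n m1 m2 \<xi> = ((1 - thr_x n m1 m2 \<xi>) * real m2 - thr_x n m1 m2 \<xi> * real m1) /
     ((1 - thr_x n m1 m2 \<xi>) * sqrt (real n * real m2))"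

definition thr_eps :: "nat \<Rightarrow> nat \<Rightarrow> nat \<Rightarrow> real \<Rightarrow> real" where
  "thr_eps n m1 m2 \<xi> = thr_x n m1 m2 \<xi> * sqrt (real n * real m1) /
     ((1 - thr_x n m1 m2 \<xi>) * sqrt (real n * real m2))"

lemma thr_s_bounds:
  assumes "n \<le> m2" shows "0 \<le> thr_s n m2" "thr_s n m2 \<le> real m2"
proof -
  show "0 \<le> thr_s n m2" using assms by (simp add: thr_s_def)
  have "real n * (real m2 - real n) \<le> real m2 * real m2" using assms by (intro mult_mono) auto
  then have "thr_s n m2 \<le> sqrt (real m2 * real m2)" unfolding thr_s_def by (rule real_sqrt_le_mono)
  then show "thr_s n m2 \<le> real m2" by simp
qed

section \<open>Limits of the threshold coefficients\<close>

context
  fixes n1 n2 :: "nat \<Rightarrow> nat"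
  assumes n1_ge: "\<And>n. n1 n \<ge> n" and n2_ge: "\<And>n. n2 n \<ge> n"
    and lim1: "(\<lambda>n. real n / real (n1 n)) \<longlonglongrightarrow> 0"
    and lim2: "(\<lambda>n. real n / real (n2 n)) \<longlonglongrightarrow> 0"
    and lim3: "filterlim (\<lambda>n. real (n1 n) / real (n2 n)) at_top sequentially"
begin

lemma eventually_dims: "\<forall>\<^sub>F n in sequentially. 0 < n \<and> n < n1 n \<and> n < n2 n"
proof -
  have "\<forall>\<^sub>F n in sequentially. real n / real (n1 n) < 1" using lim1 by (rule order_tendstoD) simp
  moreover have "\<forall>\<^sub>F n in sequentially. real n / real (n2 n) < 1" using lim2 by (rule order_tendstoD) simp
  moreover have "\<forall>\<^sub>F n in sequentially. 0 < n" by (rule eventually_gt_at_top)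
  ultimately show ?thesis
  proof eventually_elim
    case (elim n)
    then show ?case using n1_ge[of n] n2_ge[of n] by (auto simp: divide_less_eq)
  qed
qed

abbreviation (input) "rho n \<equiv> real (n2 n) / real (n1 n)"
abbreviation (input) "uu n \<equiv> real n / real (n1 n)"

lemma rho_lim: "rho \<longlonglongrightarrow> 0"
  using tendsto_inverse_0_at_top[OF lim3] by simp

text \<open>Convergence of \<open>thr_x\<close> to 0 would be too weak: \<open>thr_eps\<close>
  divides it by \<open>sqrt (rho n)\<close>, so the rate \<open>O(rho n)\<close> is
  required.\<close>

lemma abs_thr_x_le:
  assumes "0 < n" "n < n1 n" "n < n2 n"
  shows "\<bar>thr_x n (n1 n) (n2 n) \<xi>\<bar> \<le> rho n * (1 + \<bar>\<xi>\<bar> / 2 / (1 - uu n))"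
proof -
  define a b s where "a = real (n1 n)" and "b = real (n2 n)" and "s = thr_s n (n2 n)"
  have s: "0 \<le> s" "s \<le> b" using thr_s_bounds[of n "n2 n"] assms by (auto simp: s_def b_def)
  have ab: "a > 0" "b > 0" "a - real n > 0" using assms by (auto simp: a_def b_def)
  have 1: "\<bar>(b - s) / (a + b)\<bar> \<le> b / a"
  proof -
    have "(b - s) / (a + b) \<le> b / a" using s ab by (intro frac_le) auto
    then show ?thesis using s ab by simp
  qed
  have "\<bar>\<xi> * s / (2 * (a - real n))\<bar> = \<bar>\<xi>\<bar> * s / (2 * (a - real n))" using s ab by (simp add: abs_mult)
  also have "\<dots> \<le> \<bar>\<xi>\<bar> * b / (2 * (a - real n))" using s ab by (intro divide_right_mono mult_left_mono) auto
  also have "\<dots> = b / a * (\<bar>\<xi>\<bar> / 2 / (1 - real n / a))"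
  proof -
    have "a - real n = a * (1 - real n / a)" using ab by (simp add: right_diff_distrib)
    then show ?thesis by (simp add: mult_ac)
  qed
  finally have 2: "\<bar>\<xi> * s / (2 * (a - real n))\<bar> \<le> b / a * (\<bar>\<xi>\<bar> / 2 / (1 - real n / a))" .
  have "\<bar>thr_x n (n1 n) (n2 n) \<xi>\<bar> \<le> \<bar>(b - s) / (a + b)\<bar> + \<bar>\<xi> * s / (2 * (a - real n))\<bar>"
    unfolding thr_x_def a_def b_def s_def by (rule abs_triangle_ineq4)
  also have "\<dots> \<le> b / a * (1 + \<bar>\<xi>\<bar> / 2 / (1 - real n / a))"
    using 1 2 by (simp add: distrib_left)
  finally show ?thesis by (simp add: a_def b_def)
qed

lemma factor_lim: "(\<lambda>n. 1 + c / (1 - uu n)) \<longlonglongrightarrow> 1 + c / (1 - 0)"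
  by (intro tendsto_intros lim1) auto

lemma thr_x_lim: "(\<lambda>n. thr_x n (n1 n) (n2 n) \<xi>) \<longlonglongrightarrow> 0"
proof (rule Lim_null_comparison)
  show "\<forall>\<^sub>F n in sequentially. norm (thr_x n (n1 n) (n2 n) \<xi>) \<le> rho n * (1 + \<bar>\<xi>\<bar> / 2 / (1 - uu n))"
    using eventually_dims by eventually_elim (use abs_thr_x_le in auto)
  show "(\<lambda>n. rho n * (1 + \<bar>\<xi>\<bar> / 2 / (1 - uu n))) \<longlonglongrightarrow> 0"
    using tendsto_mult[OF rho_lim factor_lim[of "\<bar>\<xi>\<bar> / 2"]] by simp
qed

text \<open>Here \<open>thr_eps = thr_x / sqrt (rho n) / (1 - thr_x)\<close>, which is
  \<open>O(sqrt (rho n))\<close>.\<close>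

lemma thr_eps_lim: "(\<lambda>n. thr_eps n (n1 n) (n2 n) \<xi>) \<longlonglongrightarrow> 0"
proof -
  have "(\<lambda>n. thr_x n (n1 n) (n2 n) \<xi> / sqrt (rho n)) \<longlonglongrightarrow> 0"
  proof (rule Lim_null_comparison)
    show "\<forall>\<^sub>F n in sequentially. norm (thr_x n (n1 n) (n2 n) \<xi> / sqrt (rho n)) \<le> sqrt (rho n) * (1 + \<bar>\<xi>\<bar> / 2 / (1 - uu n))"
      using eventually_dims
    proof eventually_elim
      case (elim n)
      have r: "rho n > 0" using elim by simp
      have "norm (thr_x n (n1 n) (n2 n) \<xi> / sqrt (rho n)) = \<bar>thr_x n (n1 n) (n2 n) \<xi>\<bar> / sqrt (rho n)"
        using r by (simp only: real_norm_def abs_divide abs_of_nonneg[OF real_sqrt_ge_zero[OF less_imp_le[OF r]]])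
      also have "\<dots> \<le> rho n * (1 + \<bar>\<xi>\<bar> / 2 / (1 - uu n)) / sqrt (rho n)"
        using abs_thr_x_le[of n \<xi>] elim r by (intro divide_right_mono real_sqrt_ge_zero) auto
      also have "\<dots> = rho n / sqrt (rho n) * (1 + \<bar>\<xi>\<bar> / 2 / (1 - uu n))" by simp
      also have "rho n / sqrt (rho n) = sqrt (rho n)" using r by (intro real_div_sqrt) simp
      finally show ?case .
    qed
    have "(\<lambda>n. sqrt (rho n)) \<longlonglongrightarrow> sqrt 0" by (intro tendsto_real_sqrt rho_lim)
    then show "(\<lambda>n. sqrt (rho n) * (1 + \<bar>\<xi>\<bar> / 2 / (1 - uu n))) \<longlonglongrightarrow> 0"
      using tendsto_mult[OF _ factor_lim[of "\<bar>\<xi>\<bar> / 2"]] by fastforce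
  qed
  moreover have "(\<lambda>n. 1 - thr_x n (n1 n) (n2 n) \<xi>) \<longlonglongrightarrow> 1 - 0" by (intro tendsto_intros thr_x_lim)
  ultimately have "(\<lambda>n. (thr_x n (n1 n) (n2 n) \<xi> / sqrt (rho n)) / (1 - thr_x n (n1 n) (n2 n) \<xi>)) \<longlonglongrightarrow> 0 / (1 - 0)"
    by (rule tendsto_divide) simp
  moreover have "\<forall>\<^sub>F n in sequentially. (thr_x n (n1 n) (n2 n) \<xi> / sqrt (rho n)) / (1 - thr_x n (n1 n) (n2 n) \<xi>) = thr_eps n (n1 n) (n2 n) \<xi>"
    using eventually_dims
    by eventually_elim (simp add: thr_eps_def real_sqrt_mult real_sqrt_divide)
  ultimately show ?thesis using Lim_transform_eventually by force
qed

text \<open>The centring and scaling in \<open>scale_eig\<close> are fitted to the semicircle here.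
  With \<open>s = thr_s n (n2 n)\<close> the numerator is exactly
  \<open>s * (1 + \<xi> / 2 * (n1 + n2) / (n1 - n))\<close>, and \<open>s\<close> divided by
  \<open>sqrt (n * n2)\<close> tends to 1.\<close>

lemma thr_z_lim: "(\<lambda>n. thr_z n (n1 n) (n2 n) \<xi>) \<longlonglongrightarrow> 1 + \<xi> / 2"
proof -
  let ?L = "\<lambda>n. sqrt (1 - real n / real (n2 n)) * (1 + \<xi> / 2 * ((1 + rho n) / (1 - uu n))) / (1 - thr_x n (n1 n) (n2 n) \<xi>)"
  have "?L \<longlonglongrightarrow> sqrt (1 - 0) * (1 + \<xi> / 2 * ((1 + 0) / (1 - 0))) / (1 - 0)"
    by (intro tendsto_intros lim1 lim2 rho_lim thr_x_lim) auto
  moreover have "\<forall>\<^sub>F n in sequentially. ?L n = thr_z n (n1 n) (n2 n) \<xi>"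
    using eventually_dims
  proof eventually_elim
    case (elim n)
    define a b s N where "a = real (n1 n)" and "b = real (n2 n)" and "s = thr_s n (n2 n)" and "N = real n"
    have ab: "a > 0" "b > 0" "a - N > 0" "N > 0" using elim by (auto simp: a_def b_def N_def)
    define x where "x = thr_x n (n1 n) (n2 n) \<xi>"
    have x: "x = (b - s) / (a + b) - \<xi> * s / (2 * (a - N))"
      unfolding x_def thr_x_def a_def b_def s_def N_def by (rule refl)
    have "(1 - x) * b - x * a = b - (a + b) * x" by (simp add: algebra_simps)
    also have "(a + b) * x = (b - s) - \<xi> / 2 * ((a + b) / (a - N)) * s"
    proof -
      have "(a + b) * x = (a + b) * ((b - s) / (a + b)) - (a + b) * (\<xi> * s / (2 * (a - N)))"
        unfolding x by (rule right_diff_distrib)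
      also have "(a + b) * ((b - s) / (a + b)) = b - s" using ab by simp
      also have "(a + b) * (\<xi> * s / (2 * (a - N))) = \<xi> / 2 * ((a + b) / (a - N)) * s" by simp
      finally show ?thesis .
    qed
    also have "(a + b) / (a - N) = (1 + b / a) / (1 - N / a)"
    proof -
      have "a + b = a * (1 + b / a)" "a - N = a * (1 - N / a)" using ab by (simp_all add: distrib_left right_diff_distrib)
      then show ?thesis using ab by (metis mult_divide_mult_cancel_left less_irrefl)
    qed
    finally have num: "(1 - x) * b - x * a = s * (1 + \<xi> / 2 * ((1 + b / a) / (1 - N / a)))"
      by (simp add: algebra_simps)
    have "N * (b - N) / (N * b) = 1 - N / b" using ab by (simp add: diff_divide_distrib)
    then have sc: "s / sqrt (N * b) = sqrt (1 - N / b)"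
      unfolding s_def thr_s_def N_def[symmetric] b_def[symmetric] real_sqrt_divide[symmetric] by simp
    have "thr_z n (n1 n) (n2 n) \<xi> = ((1 - x) * b - x * a) / ((1 - x) * sqrt (N * b))"
      unfolding thr_z_def x_def a_def b_def N_def by (rule refl)
    also have "\<dots> = (s / sqrt (N * b)) * (1 + \<xi> / 2 * ((1 + b / a) / (1 - N / a))) / (1 - x)"
      unfolding num by simp
    finally show ?case unfolding sc by (simp add: a_def b_def N_def x_def)
  qed
  ultimately show ?thesis using Lim_transform_eventually by force
qed

end

text \<open>An arbitrary choice of eigenvalues suffices: they enter only through power sums and
  counts at a fixed sample point, while the probabilistic statements concern the traces
  \<open>Tm\<close>.\<close>

definition weigs :: "nat \<Rightarrow> nat \<Rightarrow> (nat \<times> nat \<Rightarrow> real) \<Rightarrow> nat \<Rightarrow> real" where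
  "weigs n m y = (SOME e. \<exists>v. spectral_decomp n (Wm n m y) v e)"

lemma weigs: "\<exists>v. spectral_decomp n (Wm n m y) v (weigs n m y)"
proof -
  have "\<exists>e v. spectral_decomp n (Wm n m y) v e" using spectral_theorem[OF symm_Wm] by metis
  then show ?thesis unfolding weigs_def by (rule someI_ex)
qed

lemma sum_weigs_power: "(\<Sum>i<n. weigs n m y i ^ k) / real n = Tm n m k y"
proof -
  obtain v where "spectral_decomp n (Wm n m y) v (weigs n m y)" using weigs by blast
  from trace_mpow_spectral[OF this, of k] show ?thesis by (simp add: Tm_def trw_def)
qed

section \<open>From sample covariance matrices to counts for centred Wishart matrices\<close>

definition scov :: "nat \<Rightarrow> (nat \<times> nat \<Rightarrow> real) \<Rightarrow> nat \<Rightarrow> nat \<Rightarrow> real" where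
  "scov m y i j = (1 / real m) * (\<Sum>k<m. y (i, k) * y (j, k))"

lemma sample_cov_eq: "sample_cov n m Z = mat n n (\<lambda>(i, j). scov m (\<lambda>(i, j). Z i j) i j)"
  unfolding sample_cov_def scov_def
  by (rule eq_matI) (auto simp: scalar_prod_def atLeast0LessThan)

lemma symm_scov: "symm n (scov m y)"
  by (simp add: symm_def scov_def mult.commute)

lemma scov_Wm:
  assumes "n > 0" "m > 0"
  shows "real m * scov m y i j = sqrt (real n * real m) * Wm n m y i j + (if i = j then real m else 0)"
  using assms by (simp add: scov_def Wm_def)

lemma scov_form: "ip n x (mv n (scov m y) x) = (1 / real m) * (\<Sum>k<m. (\<Sum>i<n. x i * y (i, k))\<^sup>2)"
proof -
  have "ip n x (mv n (scov m y) x) = (\<Sum>i<n. \<Sum>j<n. \<Sum>k<m. (1 / real m) * ((x i * y (i, k)) * (x j * y (j, k))))"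
    unfolding ip_def mv_def scov_def by (simp add: sum_distrib_left sum_distrib_right mult_ac)
  also have "\<dots> = (\<Sum>i<n. \<Sum>k<m. \<Sum>j<n. (1 / real m) * ((x i * y (i, k)) * (x j * y (j, k))))"
    by (intro sum.cong refl sum.swap)
  also have "\<dots> = (\<Sum>k<m. \<Sum>i<n. \<Sum>j<n. (1 / real m) * ((x i * y (i, k)) * (x j * y (j, k))))"
    by (rule sum.swap)
  also have "\<dots> = (\<Sum>k<m. (1 / real m) * (\<Sum>i<n. x i * y (i, k))\<^sup>2)"
    unfolding power2_eq_square sum_product by (simp only: sum_distrib_left)
  finally show ?thesis by (simp only: sum_distrib_left)
qed

text \<open>A zero of the quadratic form is orthogonal to every column of \<open>Y\<close>. The
  first \<open>n\<close> columns form an invertible block, so it vanishes.\<close>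

lemma posdef_scov:
  assumes "n \<le> m" "n > 0" and det: "det (mat n n y) \<noteq> 0"
  shows "posdef n (scov m y)"
  unfolding posdef_def
proof (intro allI impI)
  fix x :: "nat \<Rightarrow> real" assume x: "\<exists>i<n. x i \<noteq> 0"
  have m: "m > 0" using assms by simp
  show "0 < ip n x (mv n (scov m y) x)"
  proof (rule ccontr)
    assume "\<not> ?thesis"
    then have "(\<Sum>k<m. (\<Sum>i<n. x i * y (i, k))\<^sup>2) \<le> 0"
      using m unfolding scov_form by (simp add: not_less divide_le_0_iff)
    moreover have "0 \<le> (\<Sum>k<m. (\<Sum>i<n. x i * y (i, k))\<^sup>2)" by (intro sum_nonneg) auto
    ultimately have "(\<Sum>k<m. (\<Sum>i<n. x i * y (i, k))\<^sup>2) = 0" by linarith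
    then have "\<forall>k\<in>{..<m}. (\<Sum>i<n. x i * y (i, k))\<^sup>2 = 0" by (subst (asm) sum_nonneg_eq_0_iff) auto
    then have z: "(\<Sum>i<n. x i * y (i, k)) = 0" if "k < n" for k using that assms(1) by auto
    have "transpose_mat (mat n n y) *\<^sub>v vec n x = 0\<^sub>v n"
      by (rule eq_vecI) (auto simp: scalar_prod_def atLeast0LessThan z[symmetric] mult.commute)
    moreover have "vec n x \<noteq> 0\<^sub>v n" using x by (auto simp: vec_eq_iff)
    ultimately have "det (transpose_mat (mat n n y)) = 0"
      by (subst det_0_iff_vec_prod_zero[of _ n]) (auto intro!: exI[of _ "vec n x"])
    moreover have "det (transpose_mat (mat n n y)) = det (mat n n y)" by (rule det_transpose[of _ n]) simp
    ultimately show False using det by simp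
  qed
qed

lemma spectral_decomp_uminus:
  "spectral_decomp n A v e \<Longrightarrow> spectral_decomp n (\<lambda>a b. - A a b) v (\<lambda>i. - e i)"
  by (simp add: spectral_decomp_def sum_negf)

lemma mv_uminus: "mv n (\<lambda>a b. - A a b) x = (\<lambda>i. - mv n A x i)"
  by (simp add: mv_def sum_negf)

lemma ip_uminus_right: "ip n x (\<lambda>i. - y i) = - ip n x y"
  by (simp add: ip_def sum_negf)

text \<open>Put \<open>t = m1 / m2 * l\<close>. The fractional linear scaling is affine and
  decreasing in \<open>1 / (1 + t)\<close>, and the condition reads
  \<open>thr_x \<le> 1 / (1 + t)\<close>. Nonnegativity of \<open>l\<close> keeps
  \<open>1 + t\<close> positive when denominators are cleared.\<close>

lemma scale_eig_le_iff:
  assumes n: "0 < n" "n < m1" "n < m2" and l: "0 \<le> l"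
  shows "scale_eig n m1 m2 l \<le> \<xi> \<longleftrightarrow>
    0 \<le> (1 - thr_x n m1 m2 \<xi>) * real m2 - thr_x n m1 m2 \<xi> * real m1 * l"
proof -
  define s where "s = thr_s n m2"
  have s: "s > 0" using n by (simp add: s_def thr_s_def)
  define a b where "a = real m1" and "b = real m2"
  have ab: "a > 0" "b > 0" "a - real n > 0" using n by (auto simp: a_def b_def)
  define t where "t = a / b * l"
  have t: "1 + t > 0" using ab l by (simp add: t_def add_pos_nonneg)
  have tl: "a * l = b * t" using ab by (simp add: t_def)
  define P where "P = (a + b) / (2 * (a - real n))"
  have P: "P > 0" using ab by (simp add: P_def)
  have e1: "scale_eig n m1 m2 l = (1 / P) * (((b - s) * t - (a + s)) / (s * (1 + t)))"
    unfolding scale_eig_def Let_def P_def t_def s_def thr_s_def a_def b_def by (simp add: mult_ac)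
  have "scale_eig n m1 m2 l \<le> \<xi> \<longleftrightarrow> ((b - s) * t - (a + s)) / (s * (1 + t)) \<le> \<xi> * P"
  proof -
    have "1 / P * K \<le> \<xi> \<longleftrightarrow> K \<le> \<xi> * P" for K using P by (simp add: pos_divide_le_eq)
    then show ?thesis unfolding e1 .
  qed
  also have "\<dots> \<longleftrightarrow> (b - s) * t - (a + s) \<le> \<xi> * P * (s * (1 + t))"
    using s t by (simp add: divide_le_eq)
  also have "\<dots> \<longleftrightarrow> 0 \<le> (a + b) - ((b - s) - \<xi> * P * s) * (1 + t)"
    by (simp add: algebra_simps)
  also have "(b - s) - \<xi> * P * s = (a + b) * thr_x n m1 m2 \<xi>"
  proof -
    have "(a + b) * thr_x n m1 m2 \<xi> = (a + b) * ((b - s) / (a + b)) - (a + b) * (\<xi> * s / (2 * (a - real n)))"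
      unfolding thr_x_def s_def[symmetric] a_def[symmetric] b_def[symmetric] by (rule right_diff_distrib)
    also have "(a + b) * ((b - s) / (a + b)) = b - s" using ab by simp
    also have "(a + b) * (\<xi> * s / (2 * (a - real n))) = \<xi> * P * s" by (simp add: P_def)
    finally show ?thesis by simp
  qed
  also have "0 \<le> (a + b) - (a + b) * thr_x n m1 m2 \<xi> * (1 + t) \<longleftrightarrow> 0 \<le> (a + b) * (1 - thr_x n m1 m2 \<xi> * (1 + t))"
    by (simp add: algebra_simps)
  also have "\<dots> \<longleftrightarrow> 0 \<le> 1 - thr_x n m1 m2 \<xi> * (1 + t)"
    using ab by (simp add: zero_le_mult_iff)
  also have "\<dots> \<longleftrightarrow> 0 \<le> b * (1 - thr_x n m1 m2 \<xi> * (1 + t))"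
    using ab by (simp add: zero_le_mult_iff)
  also have "b * (1 - thr_x n m1 m2 \<xi> * (1 + t)) = (1 - thr_x n m1 m2 \<xi>) * b - thr_x n m1 m2 \<xi> * (b * t)"
    by (simp add: algebra_simps)
  also have "thr_x n m1 m2 \<xi> * (b * t) = thr_x n m1 m2 \<xi> * a * l" by (simp only: tl[symmetric] mult.assoc)
  finally show ?thesis unfolding a_def b_def .
qed

text \<open>The upper bound is \<open>card_nonneg_le_perturbed\<close> for the pencil in the basis
  \<open>p\<close>. The lower bound is the same lemma for the negated data, followed by taking
  complements.\<close>

theorem emp_df_F_bounds:
  fixes X Y :: "nat \<Rightarrow> nat \<Rightarrow> real"
  defines "x \<equiv> \<lambda>(i, j). X i j" and "y \<equiv> \<lambda>(i, j). Y i j"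
  assumes n: "0 < n" "n < m1" "n < m2" and det: "det (mat n n y) \<noteq> 0"
    and x1: "thr_x n m1 m2 \<xi> < 1" and \<delta>: "\<delta> > 0"
  defines "emp \<equiv> emp_df n (\<lambda>i. scale_eig n m1 m2 (sorted_eigenvalues (F_mat n m1 m2 X Y) ! i)) \<xi>"
    and "err \<equiv> (thr_eps n m1 m2 \<xi> / \<delta>)\<^sup>2 * Tm n m1 2 x"
  shows "emp \<le> real (card {i. i < n \<and> - thr_z n m1 m2 \<xi> - \<delta> \<le> weigs n m2 y i}) / real n + err"
    and "real (card {i. i < n \<and> - thr_z n m1 m2 \<xi> + \<delta> < weigs n m2 y i}) / real n - err \<le> emp"
proof -
  let ?x = "thr_x n m1 m2 \<xi>" and ?z = "thr_z n m1 m2 \<xi>" and ?eps = "thr_eps n m1 m2 \<xi>"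
  let ?A = "scov m1 x" and ?G = "scov m2 y" and ?W = "Wm n m2 y" and ?V = "Wm n m1 x"
  let ?e = "weigs n m2 y" and ?f = "weigs n m1 x"
  have m: "m1 > 0" "m2 > 0" "n \<le> m2" using n by auto
  obtain p d where PG: "\<And>j l. j < n \<Longrightarrow> l < n \<Longrightarrow> ip n (p j) (mv n ?G (p l)) = (if j = l then 1 else 0)"
    and PA: "\<And>j l. j < n \<Longrightarrow> l < n \<Longrightarrow> ip n (p j) (mv n ?A (p l)) = (if j = l then d j else 0)"
    using pencil_diagonalization[OF symm_scov symm_scov posdef_scov[OF m(3) n(1) det]] by metis
  have d0: "0 \<le> d j" if "j < n" for j
  proof -
    have "d j = ip n (p j) (mv n ?A (p j))" using PA[OF that that] by simp
    also have "\<dots> \<ge> 0" unfolding scov_form by (intro mult_nonneg_nonneg sum_nonneg) auto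
    finally show ?thesis .
  qed
  have "char_poly (F_mat n m1 m2 X Y) = (\<Prod>j\<leftarrow>[0..<n]. [:- d j, 1:])"
    unfolding F_mat_def sample_cov_eq x_def[symmetric] y_def[symmetric] by (rule char_poly_mult_minv[OF PG PA])
  then have "emp = (1 / real n) * (\<Sum>j<n. if scale_eig n m1 m2 (d j) \<le> \<xi> then 1 else 0)"
    unfolding emp_def emp_df_def
    using sum_sorted_eigenvalues[of "F_mat n m1 m2 X Y" d n "\<lambda>l. if scale_eig n m1 m2 l \<le> \<xi> then 1 else 0"] by simp
  also have "\<dots> = real (card {j. j < n \<and> scale_eig n m1 m2 (d j) \<le> \<xi>}) / real n"
    by (simp add: real_card_eq_sum)
  finally have emp: "emp = real (card {j. j < n \<and> scale_eig n m1 m2 (d j) \<le> \<xi>}) / real n" .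
  let ?c2 = "sqrt (real n * real m2)"
  define q where "q = (1 - ?x) * ?c2"
  have q: "q > 0" using x1 n by (simp add: q_def)
  \<comment> \<open>Division by the positive \<open>q\<close> normalises the coefficient of
    \<open>W\<^sub>Y\<close> to 1 without changing signs.\<close>
  define D where "D = (\<lambda>j. ((1 - ?x) * real m2 - ?x * real m1 * d j) / q)"
  have set: "{j. j < n \<and> scale_eig n m1 m2 (d j) \<le> \<xi>} = {j. j < n \<and> 0 \<le> D j}"
    using scale_eig_le_iff[OF n d0] q by (auto simp: D_def zero_le_divide_iff)
  obtain v where v: "spectral_decomp n ?W v ?e" using weigs by blast
  obtain w where w: "spectral_decomp n ?V w ?f" using weigs by blast
  have form: "let u = (\<lambda>a. \<Sum>j<n. c j * p j a) in
        ip n u (mv n ?W u) + ?z * ip n u u - ?eps * ip n u (mv n ?V u) = (\<Sum>j<n. D j * (c j)\<^sup>2)" for c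
  proof -
    define u where "u = (\<lambda>a. \<Sum>j<n. c j * p j a)"
    have diag: "ip n u (mv n B u) = (\<Sum>j<n. b j * (c j)\<^sup>2)"
      if "\<And>j l. j < n \<Longrightarrow> l < n \<Longrightarrow> ip n (p j) (mv n B (p l)) = (if j = l then b j else 0)" for B b
    proof -
      have "ip n u (mv n B u) = (\<Sum>j<n. \<Sum>l<n. if l = j then b j * (c j)\<^sup>2 else 0)"
        unfolding u_def ip_mv_sum using that by (intro sum.cong refl) (auto simp: power2_eq_square)
      then show ?thesis by simp
    qed
    have Gu: "ip n u (mv n ?G u) = (\<Sum>j<n. 1 * (c j)\<^sup>2)" by (rule diag) (rule PG)
    have Au: "ip n u (mv n ?A u) = (\<Sum>j<n. d j * (c j)\<^sup>2)" by (rule diag) (rule PA)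
    have lin: "real m' * ip n u (mv n (scov m' t) u) = sqrt (real n * real m') * ip n u (mv n (Wm n m' t) u) + real m' * ip n u u"
      if "m' > 0" for m' t
    proof -
      have "real m' * ip n u (mv n (scov m' t) u) = (\<Sum>i<n. \<Sum>j<n. u i * (real m' * scov m' t i j) * u j)"
        by (simp add: ip_def mv_def sum_distrib_left mult_ac)
      also have "\<dots> = (\<Sum>i<n. \<Sum>j<n. sqrt (real n * real m') * (u i * (Wm n m' t i j * u j)) + (if j = i then real m' * (u i * u i) else 0))"
        unfolding scov_Wm[OF n(1) that] by (intro sum.cong refl) (auto simp: algebra_simps)
      finally show ?thesis
        by (simp add: sum.distrib ip_def mv_def sum_distrib_left)
    qed
    have "q * (ip n u (mv n ?W u) + ?z * ip n u u - ?eps * ip n u (mv n ?V u)) =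
      (1 - ?x) * (?c2 * ip n u (mv n ?W u) + real m2 * ip n u u) - ?x * (sqrt (real n * real m1) * ip n u (mv n ?V u) + real m1 * ip n u u)"
    proof -
      have "q * ?z = (1 - ?x) * real m2 - ?x * real m1" "q * ?eps = ?x * sqrt (real n * real m1)"
        using q unfolding thr_z_def thr_eps_def q_def by auto
      then show ?thesis by (simp only: distrib_left right_diff_distrib mult.assoc[symmetric]) (simp add: q_def algebra_simps)
    qed
    also have "\<dots> = (1 - ?x) * (real m2 * ip n u (mv n ?G u)) - ?x * (real m1 * ip n u (mv n ?A u))"
      by (simp only: lin[OF m(1)] lin[OF m(2)])
    also have "\<dots> = (\<Sum>j<n. ((1 - ?x) * real m2 - ?x * real m1 * d j) * (c j)\<^sup>2)"
      unfolding Gu Au sum_distrib_left sum_subtractf[symmetric]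
      by (intro sum.cong refl) (simp add: algebra_simps)
    also have "\<dots> = q * (\<Sum>j<n. D j * (c j)\<^sup>2)"
      using q by (simp add: D_def sum_distrib_left)
    finally show ?thesis using q unfolding u_def[symmetric] Let_def by simp
  qed
  have indep: "\<forall>j<n. c j = 0" if "\<forall>a<n. (\<Sum>j<n. c j * p j a) = 0" for c :: "nat \<Rightarrow> real"
  proof (intro allI impI)
    fix l assume l: "l < n"
    have "0 = ip n (p l) (mv n ?G (\<lambda>a. \<Sum>j<n. c j * p j a))"
    proof -
      have "mv n ?G (\<lambda>a. \<Sum>j<n. c j * p j a) = mv n ?G (\<lambda>a. 0)" by (rule mv_cong) (use that in simp)
      then show ?thesis by (simp add: mv_def ip_def)
    qed
    also have "\<dots> = ip n (\<lambda>a. \<Sum>j<n. (if j = l then 1 else 0) * p j a) (mv n ?G (\<lambda>a. \<Sum>j<n. c j * p j a))"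
      using l by (intro ip_cong) (simp_all add: if_distrib[of "\<lambda>z. z * _"] cong: if_cong)
    also have "\<dots> = (\<Sum>i<n. \<Sum>k<n. if k = l then (if i = l then c l else 0) else 0)"
      unfolding ip_mv_sum by (intro sum.cong refl) (auto simp: PG)
    also have "\<dots> = c l" using l by simp
    finally show "c l = 0" by simp
  qed
  let ?r = "real (card {i. i < n \<and> \<delta> < \<bar>?eps * ?f i\<bar>})"
  have rerr: "?r / real n \<le> err"
  proof -
    have "?r \<le> (?eps / \<delta>)\<^sup>2 * (\<Sum>i<n. (?f i)\<^sup>2)" by (rule card_gt_le_sum_squares[OF \<delta>])
    then have "?r / real n \<le> (?eps / \<delta>)\<^sup>2 * (\<Sum>i<n. (?f i)\<^sup>2) / real n" by (rule divide_right_mono) simp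
    then show ?thesis by (simp add: err_def sum_weigs_power[symmetric])
  qed
  have up: "card {j. j < n \<and> 0 \<le> D j} \<le> card {i. i < n \<and> - ?z - \<delta> \<le> ?e i} + card {i. i < n \<and> \<delta> < \<bar>?eps * ?f i\<bar>}"
    by (rule card_nonneg_le_perturbed[OF v w form indep])
  then have "real (card {j. j < n \<and> 0 \<le> D j}) \<le> real (card {i. i < n \<and> - ?z - \<delta> \<le> ?e i}) + ?r"
    by linarith
  then have "real (card {j. j < n \<and> 0 \<le> D j}) / real n \<le> (real (card {i. i < n \<and> - ?z - \<delta> \<le> ?e i}) + ?r) / real n"
    by (rule divide_right_mono) simp
  then show "emp \<le> real (card {i. i < n \<and> - ?z - \<delta> \<le> ?e i}) / real n + err"
    unfolding emp set using rerr by (simp add: add_divide_distrib)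
  have form': "let u = (\<lambda>a. \<Sum>j<n. c j * p j a) in
        ip n u (mv n (\<lambda>a b. - ?W a b) u) + (- ?z) * ip n u u - (- ?eps) * ip n u (mv n ?V u) = (\<Sum>j<n. (- D j) * (c j)\<^sup>2)" for c
    using form[of c] unfolding Let_def mv_uminus ip_uminus_right by (simp add: sum_negf)
  have "card {j. j < n \<and> 0 \<le> - D j} \<le> card {i. i < n \<and> - (- ?z) - \<delta> \<le> - ?e i} + card {i. i < n \<and> \<delta> < \<bar>(- ?eps) * ?f i\<bar>}"
    by (rule card_nonneg_le_perturbed[OF spectral_decomp_uminus[OF v] w form' indep])
  moreover have "{i. i < n \<and> - (- ?z) - \<delta> \<le> - ?e i} = {i. i < n \<and> \<not> - ?z + \<delta> < ?e i}" by auto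
  moreover have "{i. i < n \<and> \<delta> < \<bar>(- ?eps) * ?f i\<bar>} = {i. i < n \<and> \<delta> < \<bar>?eps * ?f i\<bar>}" by simp
  ultimately have c1: "card {j. j < n \<and> 0 \<le> - D j} \<le>
      card {i. i < n \<and> \<not> - ?z + \<delta> < ?e i} + card {i. i < n \<and> \<delta> < \<bar>?eps * ?f i\<bar>}"
    by (simp only:)
  \<comment> \<open>Directions with \<open>D j = 0\<close> belong to the right-hand set only, which
    is harmless for the inequality wanted.\<close>
  have c2: "card {j. j < n \<and> \<not> 0 \<le> D j} \<le> card {j. j < n \<and> 0 \<le> - D j}" by (rule card_mono) auto
  have compl: "card {i. i < n \<and> \<not> P i} + card {i. i < n \<and> P i} = n" for P
  proof -
    have "card ({i. i < n \<and> \<not> P i} \<union> {i. i < n \<and> P i}) = card {i. i < n \<and> \<not> P i} + card {i. i < n \<and> P i}"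
      by (rule card_Un_disjoint) auto
    moreover have "{i. i < n \<and> \<not> P i} \<union> {i. i < n \<and> P i} = {..<n}" by auto
    ultimately show ?thesis by simp
  qed
  have "card {i. i < n \<and> - ?z + \<delta> < ?e i} \<le> card {j. j < n \<and> 0 \<le> D j} + card {i. i < n \<and> \<delta> < \<bar>?eps * ?f i\<bar>}"
    using c1 c2 compl[of "\<lambda>j. 0 \<le> D j"] compl[of "\<lambda>i. - ?z + \<delta> < ?e i"] by linarith
  then have "real (card {i. i < n \<and> - ?z + \<delta> < ?e i}) \<le> real (card {j. j < n \<and> 0 \<le> D j}) + ?r" by linarith
  then have "real (card {i. i < n \<and> - ?z + \<delta> < ?e i}) / real n \<le> (real (card {j. j < n \<and> 0 \<le> D j}) + ?r) / real n"
    by (rule divide_right_mono) simp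
  then show "real (card {i. i < n \<and> - ?z + \<delta> < ?e i}) / real n - err \<le> emp"
    unfolding emp set using rerr by (simp add: add_divide_distrib)
qed

text \<open>Independence is given for both matrices jointly on a sum type. It is restricted to one
  of them by pulling back along an injection \<open>emb\<close>, later \<open>Inl\<close> or
  \<open>Inr\<close>.\<close>

lemma gaussian_matrix_of_sum_family:
  assumes "prob_space M" and n: "0 < n" "n \<le> m" and inj: "inj_on emb ({..<n} \<times> {..<m})" and sub: "emb ` ({..<n} \<times> {..<m}) \<subseteq> K"
    and normal: "\<And>i j. i < n \<Longrightarrow> j < m \<Longrightarrow> distributed M lborel (V (emb (i, j))) std_normal_density"
    and indep: "prob_space.indep_vars M (\<lambda>_. borel) V K"
  shows "gaussian_matrix M n m (\<lambda>p. V (emb p))"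
proof -
  interpret prob_space M by fact
  let ?I = "{..<n} \<times> {..<m}"
  have iv: "indep_vars (\<lambda>_. borel) V (emb ` ?I)" by (rule indep_vars_subset[OF indep sub])
  have "indep_vars (\<lambda>_. borel) (\<lambda>p. V (emb p)) ?I"
    unfolding indep_vars_def2
  proof (intro conjI ballI indep_setsI)
    fix p assume "p \<in> ?I"
    then show "random_variable borel (V (emb p))" using iv by (auto simp: indep_vars_def2)
    then show "{V (emb p) -` A \<inter> space M |A. A \<in> sets borel} \<subseteq> events" by auto
  next
    fix A J assume J: "J \<noteq> {}" "J \<subseteq> ?I" "finite J"
      and A: "\<forall>j\<in>J. A j \<in> {V (emb j) -` A \<inter> space M |A. A \<in> sets borel}"
    have injJ: "inj_on emb J" by (rule inj_on_subset[OF inj J(2)])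
    \<comment> \<open>The events are relabelled by the inverse of \<open>emb\<close>, so that
      independence over the image can be applied.\<close>
    define B where "B = (\<lambda>q. A (the_inv_into J emb q))"
    have B: "B (emb j) = A j" if "j \<in> J" for j using that by (simp add: B_def the_inv_into_f_f[OF injJ])
    have "prob (\<Inter>q\<in>emb ` J. B q) = (\<Prod>q\<in>emb ` J. prob (B q))"
    proof (rule indep_setsD)
      show "indep_sets (\<lambda>q. {V q -` A \<inter> space M |A. A \<in> sets borel}) (emb ` ?I)"
        using iv by (simp add: indep_vars_def2)
      show "\<forall>q\<in>emb ` J. B q \<in> {V q -` A \<inter> space M |A. A \<in> sets borel}"
      proof
        fix q assume "q \<in> emb ` J"
        then obtain j where "j \<in> J" "q = emb j" by blast
        then show "B q \<in> {V q -` A \<inter> space M |A. A \<in> sets borel}" using A B by simp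
      qed
    qed (use J in auto)
    moreover have "(\<Inter>q\<in>emb ` J. B q) = (\<Inter>j\<in>J. A j)" using B by auto
    moreover have "(\<Prod>q\<in>emb ` J. prob (B q)) = (\<Prod>j\<in>J. prob (A j))"
      using B by (simp add: prod.reindex[OF injJ])
    ultimately show "prob (\<Inter>j\<in>J. A j) = (\<Prod>j\<in>J. prob (A j))" by simp
  qed
  then show ?thesis
    by (intro gaussian_matrix.intro std_gaussian_family.intro std_gaussian_family_axioms.intro gaussian_matrix_axioms.intro)
      (use n normal prob_space_axioms in auto)
qed

section \<open>Passage to the limit\<close>

lemma squeeze_counts:
  fixes emp up lo err :: "nat \<Rightarrow> real \<Rightarrow> real"
  assumes bounds: "\<And>\<delta>. \<delta> > 0 \<Longrightarrow> \<forall>\<^sub>F n in sequentially. lo n \<delta> - err n \<delta> \<le> E n \<and> E n \<le> up n \<delta> + err n \<delta>"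
    and up: "\<And>\<delta>. \<delta> > 0 \<Longrightarrow> \<forall>\<^sub>F n in sequentially. up n \<delta> < L + 2 * \<delta>"
    and lo: "\<And>\<delta>. \<delta> > 0 \<Longrightarrow> \<forall>\<^sub>F n in sequentially. L - 2 * \<delta> < lo n \<delta>"
    and err: "\<And>\<delta>. \<delta> > 0 \<Longrightarrow> (\<lambda>n. err n \<delta>) \<longlonglongrightarrow> 0"
  shows "E \<longlonglongrightarrow> L"
proof (rule tendstoI)
  fix r :: real assume r: "r > 0"
  define \<delta> where "\<delta> = r / 3"
  have d: "\<delta> > 0" using r by (simp add: \<delta>_def)
  have "\<forall>\<^sub>F n in sequentially. err n \<delta> < \<delta>" using err[OF d] d by (rule order_tendstoD)
  with bounds[OF d] up[OF d] lo[OF d] show "\<forall>\<^sub>F n in sequentially. dist (E n) L < r"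
    by eventually_elim (auto simp: dist_real_def abs_less_iff \<delta>_def)
qed

text \<open>The deterministic core, for one fixed sample point: randomness enters only through the
  moment limits and the nonvanishing determinants.\<close>

theorem F_matrix_counts_limit:
  fixes X Y :: "nat \<Rightarrow> nat \<Rightarrow> nat \<Rightarrow> real"
  assumes n1_ge: "\<And>n. n1 n \<ge> n" and n2_ge: "\<And>n. n2 n \<ge> n"
    and lim1: "(\<lambda>n. real n / real (n1 n)) \<longlonglongrightarrow> 0"
    and lim2: "(\<lambda>n. real n / real (n2 n)) \<longlonglongrightarrow> 0"
    and lim3: "filterlim (\<lambda>n. real (n1 n) / real (n2 n)) at_top sequentially"
    and momX: "(\<lambda>n. Tm n (n1 n) 2 (\<lambda>(i, j). X n i j)) \<longlonglongrightarrow> cat 2"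
    and momY: "\<And>k. (\<lambda>n. Tm n (n2 n) k (\<lambda>(i, j). Y n i j)) \<longlonglongrightarrow> cat k"
    and det: "\<And>n. 0 < n \<Longrightarrow> det (mat n n (\<lambda>(i, j). Y n i j)) \<noteq> 0"
  shows "(\<lambda>n. emp_df n (\<lambda>i. scale_eig n (n1 n) (n2 n) (sorted_eigenvalues (F_mat n (n1 n) (n2 n) (X n) (Y n)) ! i)) \<xi>)
    \<longlonglongrightarrow> sc_tail (- 1 - \<xi> / 2)"
proof -
  let ?z = "\<lambda>n. thr_z n (n1 n) (n2 n) \<xi>"
  let ?e = "\<lambda>n. weigs n (n2 n) (\<lambda>(i, j). Y n i j)"
  let ?err = "\<lambda>n \<delta>. (thr_eps n (n1 n) (n2 n) \<xi> / \<delta>)\<^sup>2 * Tm n (n1 n) 2 (\<lambda>(i, j). X n i j)"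
  let ?lo = "\<lambda>n \<delta>. real (card {i. i < n \<and> - ?z n + \<delta> < ?e n i}) / real n"
  let ?up = "\<lambda>n \<delta>. real (card {i. i < n \<and> - ?z n - \<delta> \<le> ?e n i}) / real n"
  note dims = n1_ge n2_ge lim1 lim2 lim3
  have mom: "(\<lambda>n. (\<Sum>i<n. ?e n i ^ k) / real n) \<longlonglongrightarrow> cat k" for k
    unfolding sum_weigs_power by (rule momY)
  have z: "?z \<longlonglongrightarrow> 1 + \<xi> / 2" by (rule thr_z_lim[OF dims])
  have x: "\<forall>\<^sub>F n in sequentially. thr_x n (n1 n) (n2 n) \<xi> < 1"
    using thr_x_lim[OF dims] by (rule order_tendstoD) simp
  let ?E = "\<lambda>n. emp_df n (\<lambda>i. scale_eig n (n1 n) (n2 n) (sorted_eigenvalues (F_mat n (n1 n) (n2 n) (X n) (Y n)) ! i)) \<xi>"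
  show ?thesis
  proof (rule squeeze_counts[where lo = ?lo and up = ?up and err = ?err])
    fix \<delta> :: real assume \<delta>: "\<delta> > 0"
    show "\<forall>\<^sub>F n in sequentially. ?lo n \<delta> - ?err n \<delta> \<le> ?E n \<and> ?E n \<le> ?up n \<delta> + ?err n \<delta>"
      using eventually_dims[OF dims] x
    proof eventually_elim
      case (elim n)
      then have n: "0 < n" "n < n1 n" "n < n2 n" by auto
      show ?case using emp_df_F_bounds[OF n det[OF n(1)] elim(2) \<delta>] by (intro conjI)
    qed
    have "(\<lambda>n. - ?z n - \<delta>) \<longlonglongrightarrow> - (1 + \<xi> / 2) - \<delta>" by (intro tendsto_intros z)
    from moments_imp_counts(2)[OF mom this \<delta>]
    have "\<forall>\<^sub>F n in sequentially. ?up n \<delta> < sc_tail (- (1 + \<xi> / 2) - \<delta>) + \<delta>" .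
    moreover have "sc_tail (- (1 + \<xi> / 2) - \<delta>) \<le> sc_tail (- 1 - \<xi> / 2) + \<delta>"
      using sc_tail_diff_le[of "- (1 + \<xi> / 2) - \<delta>" "- 1 - \<xi> / 2"] \<delta> by simp
    ultimately show "\<forall>\<^sub>F n in sequentially. ?up n \<delta> < sc_tail (- 1 - \<xi> / 2) + 2 * \<delta>"
      by (auto elim!: eventually_mono)
    have "(\<lambda>n. - ?z n + \<delta>) \<longlonglongrightarrow> - (1 + \<xi> / 2) + \<delta>" by (intro tendsto_intros z)
    from moments_imp_counts(1)[OF mom this \<delta>]
    have "\<forall>\<^sub>F n in sequentially. sc_tail (- (1 + \<xi> / 2) + \<delta>) - \<delta> < ?lo n \<delta>" .
    moreover have "sc_tail (- 1 - \<xi> / 2) \<le> sc_tail (- (1 + \<xi> / 2) + \<delta>) + \<delta>"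
      using sc_tail_diff_le[of "- 1 - \<xi> / 2" "- (1 + \<xi> / 2) + \<delta>"] \<delta> by simp
    ultimately show "\<forall>\<^sub>F n in sequentially. sc_tail (- 1 - \<xi> / 2) - 2 * \<delta> < ?lo n \<delta>"
      by (auto elim!: eventually_mono)
    have "(\<lambda>n. ?err n \<delta>) \<longlonglongrightarrow> (0 / \<delta>)\<^sup>2 * cat 2"
      using \<delta> by (intro tendsto_intros thr_eps_lim[OF dims] momX) simp
    then show "(\<lambda>n. ?err n \<delta>) \<longlonglongrightarrow> 0" by simp
  qed
qed

theorem theorem4p4:
  fixes M :: "'a measure"
    and n1 n2 :: "nat \<Rightarrow> nat"
    and X Y :: "nat \<Rightarrow> nat \<Rightarrow> nat \<Rightarrow> 'a \<Rightarrow> real"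
    and \<nu> \<mu> C1 C2 :: real
  assumes "prob_space M"
    and n1_ge: "\<And>n. n1 n \<ge> n" and n2_ge: "\<And>n. n2 n \<ge> n"
    and X_normal: "\<And>n i j. i < n \<Longrightarrow> j < n1 n \<Longrightarrow> distributed M lborel (X n i j) std_normal_density"
    and Y_normal: "\<And>n i j. i < n \<Longrightarrow> j < n2 n \<Longrightarrow> distributed M lborel (Y n i j) std_normal_density"
    and indep: "\<And>n. prob_space.indep_vars M (\<lambda>_. borel)
        (\<lambda>k. case k of Inl (i, j) \<Rightarrow> X n i j | Inr (i, j) \<Rightarrow> Y n i j)
        ({(i, j). i < n \<and> j < n1 n} <+> {(i, j). i < n \<and> j < n2 n})"
    and lim1: "(\<lambda>n. real n / real (n1 n)) \<longlonglongrightarrow> 0"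
    and lim2: "(\<lambda>n. real n / real (n2 n)) \<longlonglongrightarrow> 0"
    and lim3: "filterlim (\<lambda>n. real (n1 n) / real (n2 n)) at_top sequentially"
    and nu: "0 < \<nu>" "\<nu> < 1"
    and C: "C1 > 0" "C2 > 0"
    and mu: "\<mu> > 3 / 2 * \<nu> - 1 / 2"
    and bound1: "\<And>n. n \<ge> 1 \<Longrightarrow> real (n1 n) \<le> C1 * real n powr (1 + \<nu>)"
    and bound2: "\<And>n. n \<ge> 1 \<Longrightarrow> real (n2 n) \<ge> C2 * real n powr (1 + \<mu>)"
  shows "AE \<omega> in M. \<forall>x. (\<lambda>n. emp_df n
            (\<lambda>i. scale_eig n (n1 n) (n2 n)
                   (sorted_eigenvalues (F_mat n (n1 n) (n2 n) (\<lambda>i j. X n i j \<omega>) (\<lambda>i j. Y n i j \<omega>)) ! i)) x)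
          \<longlonglongrightarrow> integral {..x} lim_density"
proof -
  let ?V = "\<lambda>n k. case k of Inl (i, j) \<Rightarrow> X n i j | Inr (i, j) \<Rightarrow> Y n i j"
  let ?ZX = "\<lambda>n p. ?V n (Inl p)" and ?ZY = "\<lambda>n p. ?V n (Inr p)"
  have gX: "gaussian_matrix M n (n1 n) (?ZX n)" if "n \<ge> 1" for n
    by (rule gaussian_matrix_of_sum_family[OF assms(1) _ n1_ge _ _ _ indep[of n]])
      (use that X_normal in \<open>auto simp: inj_on_def\<close>)
  have gY: "gaussian_matrix M n (n2 n) (?ZY n)" if "n \<ge> 1" for n
    by (rule gaussian_matrix_of_sum_family[OF assms(1) _ n2_ge _ _ _ indep[of n]])
      (use that Y_normal in \<open>auto simp: inj_on_def\<close>)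
  have "AE \<omega> in M. 0 < n \<longrightarrow> det (mat n n (\<lambda>p. ?ZY n p \<omega>)) \<noteq> 0" for n
  proof (cases "n > 0")
    case True
    interpret gaussian_matrix M n "n2 n" "?ZY n" by (rule gY) (use True in simp)
    have "AE \<omega> in M. det (mat n n (\<lambda>z. ?ZY n (id z) \<omega>)) \<noteq> 0"
      by (rule AE_det_nonzero) (use n2_ge[of n] in auto)
    then show ?thesis by eventually_elim simp
  qed simp
  then have "AE \<omega> in M. \<forall>n. 0 < n \<longrightarrow> det (mat n n (\<lambda>p. ?ZY n p \<omega>)) \<noteq> 0"
    by (simp add: AE_all_countable)
  moreover have "AE \<omega> in M. \<forall>k. (\<lambda>n. Tm n (n1 n) k (\<lambda>p. ?ZX n p \<omega>)) \<longlonglongrightarrow> cat k"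
    by (rule wishart_moments_AE[where Z = ?ZX and m = n1]) (fact gX n1_ge lim1)+
  moreover have "AE \<omega> in M. \<forall>k. (\<lambda>n. Tm n (n2 n) k (\<lambda>p. ?ZY n p \<omega>)) \<longlonglongrightarrow> cat k"
    by (rule wishart_moments_AE[where Z = ?ZY and m = n2]) (fact gY n2_ge lim2)+
  \<comment> \<open>The exceptional events are indexed by the countably many sizes and degrees, so a
    single null set serves all thresholds \<open>x\<close>.\<close>
  ultimately show ?thesis
  proof eventually_elim
    case (elim \<omega>)
    have eqX: "(\<lambda>p. ?ZX n p \<omega>) = (\<lambda>(i, j). X n i j \<omega>)" and eqY: "(\<lambda>p. ?ZY n p \<omega>) = (\<lambda>(i, j). Y n i j \<omega>)" for n
      by auto
    show ?case
    proof
      fix x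
      show "(\<lambda>n. emp_df n
            (\<lambda>i. scale_eig n (n1 n) (n2 n)
                   (sorted_eigenvalues (F_mat n (n1 n) (n2 n) (\<lambda>i j. X n i j \<omega>) (\<lambda>i j. Y n i j \<omega>)) ! i)) x)
          \<longlonglongrightarrow> integral {..x} lim_density"
        unfolding integral_lim_density
      proof (rule F_matrix_counts_limit[OF n1_ge n2_ge lim1 lim2 lim3])
        show "(\<lambda>n. Tm n (n1 n) 2 (\<lambda>(i, j). X n i j \<omega>)) \<longlonglongrightarrow> cat 2"
          using elim(2)[unfolded eqX] by blast
        show "(\<lambda>n. Tm n (n2 n) k (\<lambda>(i, j). Y n i j \<omega>)) \<longlonglongrightarrow> cat k" for k
          using elim(3)[unfolded eqY] by blast
        show "det (mat n n (\<lambda>(i, j). Y n i j \<omega>)) \<noteq> 0" if "0 < n" for n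
          using elim(1)[unfolded eqY] that by blast
      qed
    qed
  qed
qed

end
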